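(* Let $\tilde w\in \mathrm{FC}(\tilde C_n)$ and let $H=H(\tilde w)$ be its heap. The heap $\mathfrak R(H)$ and the integer $\mathrm{del}(H)$ produced by the reduction algorithm do not depend on the order in which the forks are eliminated. Moreover $\mathfrak R(H)=H(\tau(\tilde w))$ and $\mathrm{del}(H)=\alpha(\tilde w)$.
   Context: Let $n\ge 2$. $\tilde C_n$ is the Coxeter group with generators $\tilde s_1,\dots,\tilde s_{n+1}$ whose Coxeter graph is the path $\tilde s_1-\tilde s_2-\cdots-\tilde s_{n+1}$, the edges $\{\tilde s_1,\tilde s_2\}$ and $\{\tilde s_n,\tilde s_{n+1}\}$ having label $4$ and the other edges label $3$. $A_{n+1}$ is the Coxeter group with generators $s_1,\dots,s_{n+1}$ and Coxeter graph the path with all labels $3$. An element is fully commutative (FC) if any two of its reduced expressions are related by commutation relations only; $\mathrm{FC}(\cdot)$ is the set of such elements. Heaps: the heap of a word $s_{a_1}\cdots s_{a_l}$ is the poset on $\{1,\dots,l\}$ obtained by transitive closure of $i\prec j$ when $i<j$ and $s_{a_i},s_{a_j}$ do not commute, with $i$ labeled $s_{a_i}$; heaps are considered up to label-preserving isomorphism. For $w$ FC, $H(w)$ is the heap of any reduced expression. In the Hasse diagram, drawn from top to bottom ($i$ above $j$ if $i\prec j$), nodes labeled $\tilde s_i$ (or $s_i$) lie in column $i$. Diagrams: the standard $(n+2)$-box is a rectangle with nodes $1,\dots,n+2$ on the north face and $1',\dots,(n+2)'$ on the south face, from left to right. A pseudo $(n+2)$-diagram is an isotopy class of finitely many disjoint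 plane curves (edges) in the box, which join the nodes in pairs or are closed (loops). The product $d'd$ is obtained by placing $d'$ on top of $d$. $\mathbb D(A_{n+1})$ is the $\mathbb Z[\delta]$-algebra with basis the pseudo $(n+2)$-diagrams modulo the relation that a loop may be removed and replaced by the factor $\delta$. The simple diagram $d_i$, $1\le i\le n+1$, has edges $(i,i+1)$, $(i',(i+1)')$ and vertical edges $(j,j')$ for $j\ne i,i+1$. For $w\in\mathrm{FC}(A_{n+1})$ with reduced expression $s_{i_1}\cdots s_{i_k}$ put $d_w=d_{i_1}\cdots d_{i_k}$; $w\mapsto d_w$ is a bijection from $\mathrm{FC}(A_{n+1})$ onto the loop-free diagrams. For $\tilde w\in \mathrm{FC}(\tilde C_n)$ with reduced expression $\tilde s_{i_1}\cdots\tilde s_{i_k}$ put $d(\tilde w)=d_{i_1}\cdots d_{i_k}$ (independent of the reduced expression). The integer $\alpha(\tilde w)\ge0$ and the element $\tau(\tilde w)\in\mathrm{FC}(A_{n+1})$ are defined by $d(\tilde w)=\delta^{\alpha(\tilde w)}d_{\tau(\tilde w)}$ in $\mathbb D(A_{n+1})$. Fork: in a heap $H$ of type $\tilde C_n$, a fork is a convex subheap that is the heap of $\tilde s_i\tilde s_{i+1}\tilde s_i$ ($1\le i\le n$) or of $\tilde s_i\tilde s_{i-1}\tilde s_i$ ($2\le i\le n+1$). Fork elimination: given a fork $f=\tilde s_i\tilde s_{i\pm1}\tilde s_i$ of $H$, the heap $H\setminus f$ is obtained by (F1) deleting the middle node $\tilde s_{i\pm1}$ of $f$ and all edges of $H$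 incident to it; (F2) identifying the two nodes $\tilde s_i$ of $f$; (F3) if $f=\tilde s_i\tilde s_{i+1}\tilde s_i$ with $i<n$ (resp. $f=\tilde s_i\tilde s_{i-1}\tilde s_i$ with $i>2$) and in column $i+2$ (resp. $i-2$) two consecutive unconnected nodes appear (i.e. no node of a neighbouring column lies between them any more), identifying these two nodes. Reduction algorithm: starting from $H$, apply fork elimination iteratively until no fork remains; $\mathfrak R(H)$ is the final heap, with nodes in column $i$ relabeled $s_i$; $\mathrm{del}(H)$ is the total number of identifications made in the steps (F3). *)

theory Defs
  imports "HOL-Algebra.Group" "HOL-Computational_Algebra.Polynomial"
begin

section \<open>Coxeter groups and full commutativity\<close>

text \<open>
  A Coxeter system is given by a set \<open>S\<close> of generators and a matrix \<open>m\<close>, with \<open>m s s = 1\<close>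
  and \<open>m s t = 0\<close> standing for the absence of a relation.  The group is the quotient of the
  monoid of words by the congruence generated by \<open>(s t)\<^bsup>m s t\<^esup> = 1\<close>; since this includes
  \<open>s s = 1\<close>, it is the group with that presentation.
\<close>

inductive cox_cong :: "(nat \<Rightarrow> nat \<Rightarrow> nat) \<Rightarrow> nat set \<Rightarrow> nat list \<Rightarrow> nat list \<Rightarrow> bool"
  for m S where
  relator: "\<lbrakk>u \<in> lists S; v \<in> lists S; s \<in> S; t \<in> S\<rbrakk> \<Longrightarrow>
     cox_cong m S (u @ concat (replicate (m s t) [s, t]) @ v) (u @ v)"
| refl: "u \<in> lists S \<Longrightarrow> cox_cong m S u u"
| sym: "cox_cong m S u v \<Longrightarrow> cox_cong m S v u"
| trans: "cox_cong m S u v \<Longrightarrow> cox_cong m S v w \<Longrightarrow> cox_cong m S u w"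

definition cox_class :: "(nat \<Rightarrow> nat \<Rightarrow> nat) \<Rightarrow> nat set \<Rightarrow> nat list \<Rightarrow> nat list set" where
  "cox_class m S u = {v. cox_cong m S u v}"

definition coxeter_group :: "(nat \<Rightarrow> nat \<Rightarrow> nat) \<Rightarrow> nat set \<Rightarrow> nat list set monoid" where
  "coxeter_group m S =
     \<lparr>carrier = cox_class m S ` lists S,
      monoid.mult = (\<lambda>x y. \<Union>u\<in>x. \<Union>v\<in>y. cox_class m S (u @ v)),
      one = cox_class m S []\<rparr>"

definition cox_prod :: "(nat \<Rightarrow> nat \<Rightarrow> nat) \<Rightarrow> nat set \<Rightarrow> nat list \<Rightarrow> nat list set" where
  "cox_prod m S u =
     foldr (\<lambda>x y. x \<otimes>\<^bsub>coxeter_group m S\<^esub> y) (map (\<lambda>s. cox_class m S [s]) u)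
       \<one>\<^bsub>coxeter_group m S\<^esub>"

lemma cox_cong_lists: "cox_cong m S u v \<Longrightarrow> u \<in> lists S \<and> v \<in> lists S"
  by (induction rule: cox_cong.induct) (auto split: if_splits)

lemma cox_cong_context:
  assumes "cox_cong m S u v" "p \<in> lists S" "q \<in> lists S"
  shows "cox_cong m S (p @ u @ q) (p @ v @ q)"
  using assms
proof (induction rule: cox_cong.induct)
  case (relator u v s t)
  then show ?case
    using cox_cong.relator[of "p @ u" S "v @ q" s t m] by auto
next
  case (refl u)
  then show ?case by (intro cox_cong.refl) auto
qed (auto intro: cox_cong.sym cox_cong.trans)

lemma cox_class_eq_iff:
  "u \<in> lists S \<Longrightarrow> cox_class m S u = cox_class m S v \<longleftrightarrow> cox_cong m S u v"
  unfolding cox_class_def by (auto intro: cox_cong.intros)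

lemma cox_mult:
  assumes "u \<in> lists S" "v \<in> lists S"
  shows "cox_class m S u \<otimes>\<^bsub>coxeter_group m S\<^esub> cox_class m S v = cox_class m S (u @ v)"
proof -
  have eq: "cox_class m S (u' @ v') = cox_class m S (u @ v)"
    if "cox_cong m S u u'" "cox_cong m S v v'" for u' v'
  proof -
    have l: "u' \<in> lists S" "v' \<in> lists S" using that cox_cong_lists by blast+
    have "cox_cong m S (u @ v) (u' @ v)"
      using cox_cong_context[OF that(1), of "[]" v] assms by simp
    moreover have "cox_cong m S (u' @ v) (u' @ v')"
      using cox_cong_context[OF that(2), of u' "[]"] l by simp
    ultimately have "cox_cong m S (u @ v) (u' @ v')" by (rule cox_cong.trans)
    moreover have "u @ v \<in> lists S" using assms by simp
    ultimately show ?thesis using cox_class_eq_iff by metis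
  qed
  have mem: "u \<in> cox_class m S u" "v \<in> cox_class m S v"
    using assms cox_cong.refl[of _ S m] by (simp_all add: cox_class_def)
  have "(\<Union>u'\<in>cox_class m S u. \<Union>v'\<in>cox_class m S v. cox_class m S (u' @ v')) =
      (\<Union>u'\<in>cox_class m S u. \<Union>v'\<in>cox_class m S v. cox_class m S (u @ v))"
    using eq by (intro SUP_cong[OF HOL.refl]) (simp add: cox_class_def)
  also have "\<dots> = cox_class m S (u @ v)" using mem by blast
  finally show ?thesis by (simp add: coxeter_group_def)
qed

lemma cox_cong_rev_cancel:
  assumes "\<And>s. s \<in> S \<Longrightarrow> m s s = 1" "u \<in> lists S"
  shows "cox_cong m S (rev u @ u) []"
  using assms(2)
proof (induction u)
  case Nil
  then show ?case by (auto intro: cox_cong.refl)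
next
  case (Cons s u)
  then have "cox_cong m S (rev u @ [s, s] @ u) (rev u @ u)"
    using cox_cong.relator[of "rev u" S u s s m] assms(1) by (auto simp: in_lists_conv_set)
  then show ?case using Cons by (auto intro: cox_cong.trans)
qed

lemma group_coxeter_group:
  assumes "\<And>s. s \<in> S \<Longrightarrow> m s s = 1"
  shows "group (coxeter_group m S)"
proof (rule groupI)
  have car: "carrier (coxeter_group m S) = cox_class m S ` lists S"
    and one: "\<one>\<^bsub>coxeter_group m S\<^esub> = cox_class m S []"
    by (simp_all add: coxeter_group_def)
  show "\<one>\<^bsub>coxeter_group m S\<^esub> \<in> carrier (coxeter_group m S)"
    by (auto simp: car one)
  fix x assume "x \<in> carrier (coxeter_group m S)"
  then obtain u where u: "u \<in> lists S" "x = cox_class m S u" by (auto simp: car)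
  show "\<one>\<^bsub>coxeter_group m S\<^esub> \<otimes>\<^bsub>coxeter_group m S\<^esub> x = x"
    using u by (simp add: one cox_mult del: in_lists_conv_set)
  have rev_u: "rev u \<in> lists S" using u(1) by (simp add: in_lists_conv_set)
  have rev_cancel: "cox_cong m S (rev u @ u) []"
    by (rule cox_cong_rev_cancel) (use assms u(1) in auto)
  have "cox_class m S (rev u) \<otimes>\<^bsub>coxeter_group m S\<^esub> x = \<one>\<^bsub>coxeter_group m S\<^esub>"
    using u(1) rev_u rev_cancel cox_class_eq_iff[of "rev u @ u" S m "[]"]
    by (simp add: u(2) one cox_mult)
  moreover have "cox_class m S (rev u) \<in> carrier (coxeter_group m S)"
    using rev_u by (auto simp: car)
  ultimately show "\<exists>y\<in>carrier (coxeter_group m S).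
      y \<otimes>\<^bsub>coxeter_group m S\<^esub> x = \<one>\<^bsub>coxeter_group m S\<^esub>"
    by blast
  fix y assume "y \<in> carrier (coxeter_group m S)"
  then obtain v where v: "v \<in> lists S" "y = cox_class m S v" by (auto simp: car)
  have "x \<otimes>\<^bsub>coxeter_group m S\<^esub> y = cox_class m S (u @ v)"
    using u v by (simp only: cox_mult)
  moreover have "u @ v \<in> lists S" using u v by simp
  ultimately show "x \<otimes>\<^bsub>coxeter_group m S\<^esub> y \<in> carrier (coxeter_group m S)"
    by (auto simp: car)
  fix z assume "z \<in> carrier (coxeter_group m S)"
  then obtain t where t: "t \<in> lists S" "z = cox_class m S t" by (auto simp: car)
  show "x \<otimes>\<^bsub>coxeter_group m S\<^esub> y \<otimes>\<^bsub>coxeter_group m S\<^esub> z =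
      x \<otimes>\<^bsub>coxeter_group m S\<^esub> (y \<otimes>\<^bsub>coxeter_group m S\<^esub> z)"
    using u v t by (simp add: cox_mult)
qed

lemma cox_prod_eq: "u \<in> lists S \<Longrightarrow> cox_prod m S u = cox_class m S u"
proof (induction u)
  case Nil
  then show ?case by (simp add: cox_prod_def coxeter_group_def)
next
  case (Cons s u)
  then have "cox_prod m S (s # u) = cox_class m S [s] \<otimes>\<^bsub>coxeter_group m S\<^esub> cox_class m S u"
    by (auto simp: cox_prod_def)
  then show ?case using Cons.prems cox_mult[of "[s]" S u m] by auto
qed

definition expression :: "(nat \<Rightarrow> nat \<Rightarrow> nat) \<Rightarrow> nat set \<Rightarrow> nat list set \<Rightarrow> nat list \<Rightarrow> bool" where
  "expression m S w u \<longleftrightarrow> u \<in> lists S \<and> cox_prod m S u = w"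

definition reduced_expression ::
    "(nat \<Rightarrow> nat \<Rightarrow> nat) \<Rightarrow> nat set \<Rightarrow> nat list set \<Rightarrow> nat list \<Rightarrow> bool" where
  "reduced_expression m S w u \<longleftrightarrow>
     expression m S w u \<and> (\<forall>v. expression m S w v \<longrightarrow> length u \<le> length v)"

definition commutation_step :: "(nat \<Rightarrow> nat \<Rightarrow> nat) \<Rightarrow> nat list \<Rightarrow> nat list \<Rightarrow> bool" where
  "commutation_step m u v \<longleftrightarrow>
     (\<exists>p q s t. m s t = 2 \<and> u = p @ [s, t] @ q \<and> v = p @ [t, s] @ q)"

definition FC :: "(nat \<Rightarrow> nat \<Rightarrow> nat) \<Rightarrow> nat set \<Rightarrow> nat list set set" where
  "FC m S = {w \<in> carrier (coxeter_group m S).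
     \<forall>u v. reduced_expression m S w u \<and> reduced_expression m S w v \<longrightarrow>
       (commutation_step m)\<^sup>*\<^sup>* u v}"

definition nbr :: "nat \<Rightarrow> nat \<Rightarrow> bool" where
  "nbr i j \<longleftrightarrow> j = Suc i \<or> i = Suc j"

definition cox_A :: "nat \<Rightarrow> nat \<Rightarrow> nat" where
  "cox_A i j = (if i = j then 1 else if nbr i j then 3 else 2)"

definition cox_C :: "nat \<Rightarrow> nat \<Rightarrow> nat \<Rightarrow> nat" where
  "cox_C n i j =
     (if i = j then 1
      else if nbr i j then (if {i, j} = {1, 2} \<or> {i, j} = {n, n + 1} then 4 else 3)
      else 2)"

abbreviation FC_A :: "nat \<Rightarrow> nat list set set" where
  "FC_A n \<equiv> FC cox_A {1..n+1}"

abbreviation FC_C :: "nat \<Rightarrow> nat list set set" where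
  "FC_C n \<equiv> FC (cox_C n) {1..n+1}"


section \<open>Heaps\<close>

text \<open>
  The field \<open>prec\<close> is the strict order (\<open>(x, y) \<in> prec H\<close> means that \<open>x\<close> is above \<open>y\<close>),
  and \<open>col\<close> is the label, i.e. the column.  Only the values of \<open>col\<close> on the nodes matter.
\<close>

record 'a heap =
  nodes :: "'a set"
  prec :: "('a \<times> 'a) set"
  col :: "'a \<Rightarrow> nat"

definition word_heap :: "(nat \<Rightarrow> nat \<Rightarrow> nat) \<Rightarrow> nat list \<Rightarrow> nat heap" where
  "word_heap m u =
     \<lparr>nodes = {..<length u},
      prec = {(i, j). i < j \<and> j < length u \<and> m (u ! i) (u ! j) \<notin> {1, 2}}\<^sup>+,
      col = (\<lambda>i. u ! i)\<rparr>"

definition heap_iso :: "'a heap \<Rightarrow> 'b heap \<Rightarrow> bool" (infix \<open>\<cong>\<^sub>h\<close> 50) where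
  "H \<cong>\<^sub>h K \<longleftrightarrow>
     (\<exists>f. bij_betw f (nodes H) (nodes K) \<and>
          (\<forall>x\<in>nodes H. \<forall>y\<in>nodes H. (x, y) \<in> prec H \<longleftrightarrow> (f x, f y) \<in> prec K) \<and>
          (\<forall>x\<in>nodes H. col K (f x) = col H x))"

text \<open>
  \<open>heap_class m S w\<close> is the isomorphism class \<open>H(w)\<close>; for fully commutative \<open>w\<close> the choice of
  the reduced expression is irrelevant.
\<close>

definition heap_class :: "(nat \<Rightarrow> nat \<Rightarrow> nat) \<Rightarrow> nat set \<Rightarrow> nat list set \<Rightarrow> nat heap set" where
  "heap_class m S w =
     {H. prec H \<subseteq> nodes H \<times> nodes H \<and>
         (\<exists>u. reduced_expression m S w u \<and> H \<cong>\<^sub>h word_heap m u)}"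

definition convex_in :: "'a heap \<Rightarrow> 'a set \<Rightarrow> bool" where
  "convex_in H C \<longleftrightarrow> C \<subseteq> nodes H \<and>
     (\<forall>u\<in>C. \<forall>v\<in>C. \<forall>y\<in>nodes H. (u, y) \<in> prec H \<and> (y, v) \<in> prec H \<longrightarrow> y \<in> C)"

text \<open>A fork, with upper node \<open>a\<close>, middle node \<open>x\<close> and lower node \<open>b\<close>.\<close>

definition is_fork :: "'a heap \<Rightarrow> 'a \<Rightarrow> 'a \<Rightarrow> 'a \<Rightarrow> bool" where
  "is_fork H a x b \<longleftrightarrow>
     convex_in H {a, x, b} \<and> (a, x) \<in> prec H \<and> (x, b) \<in> prec H \<and>
     col H b = col H a \<and> nbr (col H a) (col H x)"

text \<open>
  Deletion of the node \<open>x\<close> with all its edges, followed by the identification \<open>\<phi>\<close> of nodes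
  (each merged pair is represented by one of its members).  The edges of a heap are understood
  here as the generating relations of its order, that is, all comparable pairs of nodes in
  neighbouring columns, as in the definition of a heap.  Keeping only covering relations would
  be wrong: if \<open>y\<close> is above \<open>z\<close> in a neighbouring column and this pair is not a covering only
  because of a chain through \<open>x\<close>, then deleting the coverings at \<open>x\<close> would leave \<open>y\<close> and \<open>z\<close>
  incomparable, which cannot happen in the heap of a word.
\<close>

definition contract :: "'a heap \<Rightarrow> 'a \<Rightarrow> ('a \<Rightarrow> 'a) \<Rightarrow> 'a heap" where
  "contract H x \<phi> =
     \<lparr>nodes = \<phi> ` (nodes H - {x}),
      prec = (map_prod \<phi> \<phi> ` {(u, v) \<in> prec H. nbr (col H u) (col H v) \<and> u \<noteq> x \<and> v \<noteq> x})\<^sup>+,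
      col = col H\<rparr>"

text \<open>
  The situation of step (F3) for a fork with upper node \<open>a\<close> and middle node \<open>x\<close>.  The column
  of \<open>p\<close> and \<open>q\<close> is the neighbour of the column of \<open>x\<close> other than that of \<open>a\<close>.  For
  generators numbered \<open>1\<close> to \<open>n + 1\<close> the side conditions \<open>i < n\<close> and \<open>i > 2\<close> just say that this
  column exists.
\<close>

definition disconnected_by :: "'a heap \<Rightarrow> 'a \<Rightarrow> 'a \<Rightarrow> 'a \<Rightarrow> 'a \<Rightarrow> bool" where
  "disconnected_by H a x p q \<longleftrightarrow>
     p \<in> nodes H \<and> q \<in> nodes H \<and> col H p = col H q \<and>
     nbr (col H x) (col H p) \<and> col H p \<noteq> col H a \<and>
     (p, x) \<in> prec H \<and> (x, q) \<in> prec H \<and>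
     (\<forall>y\<in>nodes H. (p, y) \<in> prec H \<and> (y, q) \<in> prec H \<longrightarrow>
        col H y \<noteq> col H p \<and> (nbr (col H y) (col H p) \<longrightarrow> y = x))"

text \<open>
  \<open>fork_elim H H' d\<close>: eliminating some fork of \<open>H\<close> yields \<open>H'\<close>, with \<open>d\<close> identifications in
  step (F3).
\<close>

inductive fork_elim :: "'a heap \<Rightarrow> 'a heap \<Rightarrow> nat \<Rightarrow> bool" where
  without_F3: "\<lbrakk>is_fork H a x b; \<nexists>p q. disconnected_by H a x p q\<rbrakk> \<Longrightarrow>
     fork_elim H (contract H x (id(b := a))) 0"
| with_F3: "\<lbrakk>is_fork H a x b; disconnected_by H a x p q\<rbrakk> \<Longrightarrow>
     fork_elim H (contract H x (id(b := a, q := p))) 1"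

inductive fork_elims :: "'a heap \<Rightarrow> 'a heap \<Rightarrow> nat \<Rightarrow> bool" where
  stop: "fork_elims H H 0"
| step: "fork_elim H H' d \<Longrightarrow> fork_elims H' R k \<Longrightarrow> fork_elims H R (d + k)"

text \<open>
  \<open>reduction H R k\<close>: some run of the reduction algorithm started at \<open>H\<close> ends with the heap \<open>R\<close>
  and makes \<open>k\<close> identifications in the steps (F3), so that \<open>R\<close> and \<open>k\<close> are the values of
  \<open>\<RR>(H)\<close> and \<open>del(H)\<close> produced by this run.  Labels are just column numbers, so the final
  relabelling of the nodes by generators of type \<open>A\<close> leaves \<open>col\<close> unchanged.
\<close>

definition reduction :: "'a heap \<Rightarrow> 'a heap \<Rightarrow> nat \<Rightarrow> bool" where
  "reduction H R k \<longleftrightarrow> fork_elims H R k \<and> (\<nexists>a x b. is_fork R a x b)"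


section \<open>Temperley--Lieb diagrams\<close>

text \<open>
  Up to isotopy, a loop-free pseudo \<open>N\<close>-diagram is determined by the pairs of nodes it joins,
  and the pairings that occur are the non-crossing ones.  The level \<open>Middle\<close> is used only when
  two diagrams are stacked.
\<close>

datatype level = North | Middle | South

type_synonym node = "level \<times> nat"
type_synonym diagram = "node set set"

definition box_nodes :: "nat \<Rightarrow> node set" where
  "box_nodes N = {North, South} \<times> {1..N}"

text \<open>Position on the boundary of the box, read clockwise from the first node on the north face.\<close>

fun pos :: "nat \<Rightarrow> node \<Rightarrow> nat" where
  "pos N (North, i) = i"
| "pos N (South, i) = 2 * N + 1 - i"
| "pos N (Middle, i) = 0"

definition crossing :: "nat \<Rightarrow> node set \<Rightarrow> node set \<Rightarrow> bool" where
  "crossing N e f \<longleftrightarrow>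
     (\<exists>a b c d. e = {a, b} \<and> f = {c, d} \<and>
        pos N a < pos N c \<and> pos N c < pos N b \<and> pos N b < pos N d)"

definition diagrams :: "nat \<Rightarrow> diagram set" where
  "diagrams N =
     {D. (\<forall>e\<in>D. e \<subseteq> box_nodes N \<and> card e = 2) \<and>
         (\<forall>v\<in>box_nodes N. \<exists>!e. e \<in> D \<and> v \<in> e) \<and>
         (\<forall>e\<in>D. \<forall>f\<in>D. \<not> crossing N e f)}"

fun to_upper :: "node \<Rightarrow> node" where
  "to_upper (South, i) = (Middle, i)"
| "to_upper v = v"

fun to_lower :: "node \<Rightarrow> node" where
  "to_lower (North, i) = (Middle, i)"
| "to_lower v = v"

text \<open>\<open>connected D' D\<close> relates the nodes that are joined by a curve when \<open>D'\<close> is placed on top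
  of \<open>D\<close>.\<close>

definition connected :: "diagram \<Rightarrow> diagram \<Rightarrow> (node \<times> node) set" where
  "connected D' D = {(u, v). {u, v} \<in> image to_upper ` D' \<union> image to_lower ` D}\<^sup>*"

definition stack :: "diagram \<Rightarrow> diagram \<Rightarrow> diagram" where
  "stack D' D =
     {{u, v} | u v. u \<noteq> v \<and> fst u \<noteq> Middle \<and> fst v \<noteq> Middle \<and> (u, v) \<in> connected D' D}"

definition loops :: "nat \<Rightarrow> diagram \<Rightarrow> diagram \<Rightarrow> nat" where
  "loops N D' D =
     card {C. C \<subseteq> {Middle} \<times> UNIV \<and> (\<exists>i\<in>{1..N}. C = connected D' D `` {(Middle, i)})}"

text \<open>
  Replacing every loop by the factor \<open>\<delta>\<close>, the loop-free diagrams form a basis of the algebra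
  \<open>\<D>(A\<^bsub>N-1\<^esub>)\<close>.  Its elements are given by their coefficients in \<open>\<int>[\<delta>]\<close>.
\<close>

type_synonym tl_elem = "diagram \<Rightarrow> int poly"

definition delta :: "int poly" where
  "delta = [:0, 1:]"

definition basis :: "diagram \<Rightarrow> tl_elem" where
  "basis D = (\<lambda>E. if E = D then 1 else 0)"

definition tl_mult :: "nat \<Rightarrow> tl_elem \<Rightarrow> tl_elem \<Rightarrow> tl_elem" where
  "tl_mult N f g =
     (\<lambda>E. \<Sum>D'\<in>diagrams N. \<Sum>D\<in>diagrams N.
        f D' * g D * delta ^ loops N D' D * basis (stack D' D) E)"

lemma finite_diagrams: "finite (diagrams N)"
proof (rule finite_subset)
  show "diagrams N \<subseteq> Pow (Pow (box_nodes N))" by (auto simp: diagrams_def)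
  show "finite (Pow (Pow (box_nodes N)))" by (simp add: box_nodes_def)
qed

lemma tl_mult_basis:
  assumes "D' \<in> diagrams N" "D \<in> diagrams N"
  shows "tl_mult N (basis D') (basis D) = (\<lambda>E. delta ^ loops N D' D * basis (stack D' D) E)"
proof
  fix E
  let ?g = "\<lambda>X Y. delta ^ loops N X Y * basis (stack X Y) E"
  have "tl_mult N (basis D') (basis D) E =
      (\<Sum>X\<in>diagrams N. \<Sum>Y\<in>diagrams N. if X = D' then if Y = D then ?g X Y else 0 else 0)"
    unfolding tl_mult_def by (intro sum.cong) (auto simp: basis_def)
  also have "\<dots> = (\<Sum>X\<in>diagrams N. if X = D' then ?g X D else 0)"
    using assms by (intro sum.cong) (auto simp: finite_diagrams)
  finally show "tl_mult N (basis D') (basis D) E = ?g D' D"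
    using assms by (simp add: finite_diagrams)
qed

definition id_diagram :: "nat \<Rightarrow> diagram" where
  "id_diagram N = {{(North, j), (South, j)} | j. j \<in> {1..N}}"

definition simple_diagram :: "nat \<Rightarrow> nat \<Rightarrow> diagram" where
  "simple_diagram N i =
     {{(North, i), (North, i + 1)}, {(South, i), (South, i + 1)}} \<union>
     {{(North, j), (South, j)} | j. j \<in> {1..N} - {i, i + 1}}"

definition word_diagram :: "nat \<Rightarrow> nat list \<Rightarrow> tl_elem" where
  "word_diagram N u =
     foldr (tl_mult N) (map (\<lambda>i. basis (simple_diagram N i)) u) (basis (id_diagram N))"

text \<open>
  \<open>diag_A n w\<close> is \<open>d\<^sub>w\<close> for \<open>w \<in> FC(A\<^bsub>n+1\<^esub>)\<close>, and \<open>diag_C n w\<close> is \<open>d(w)\<close> for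
  \<open>w \<in> FC(C\<^sub>n)\<close> (affine type \<open>C\<close>).  For such \<open>w\<close> the choice of the reduced expression is
  irrelevant.
\<close>

definition diag_A :: "nat \<Rightarrow> nat list set \<Rightarrow> tl_elem" where
  "diag_A n w = word_diagram (n + 2) (SOME u. reduced_expression cox_A {1..n+1} w u)"

definition diag_C :: "nat \<Rightarrow> nat list set \<Rightarrow> tl_elem" where
  "diag_C n w = word_diagram (n + 2) (SOME u. reduced_expression (cox_C n) {1..n+1} w u)"

definition alpha_tau :: "nat \<Rightarrow> nat list set \<Rightarrow> nat \<times> nat list set" where
  "alpha_tau n w =
     (THE (a, t). t \<in> FC_A n \<and> diag_C n w = (\<lambda>E. delta ^ a * diag_A n t E))"

definition alpha :: "nat \<Rightarrow> nat list set \<Rightarrow> nat" where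
  "alpha n w = fst (alpha_tau n w)"

definition tau :: "nat \<Rightarrow> nat list set \<Rightarrow> nat list set" where
  "tau n w = snd (alpha_tau n w)"

end

theory Submission
  imports Defs
begin

text \<open>
  Linear extensions turn heaps into words up to commutation.  A fork can be made contiguous in a
  linear extension, so that its elimination is the relation \<open>d\<^sub>i d\<^sub>j d\<^sub>i = d\<^sub>i\<close>, and (F3) is an
  additional \<open>d\<^sub>k d\<^sub>k = \<delta> d\<^sub>k\<close>.  Every run therefore preserves the diagram up to the recorded power
  of \<open>\<delta>\<close>, as well as the property that nodes in the same column are comparable.  A final heap
  has no fork, and since the Coxeter graph is a path this forces its word to be alternating: any
  two neighbouring letters \<open>j\<close>, \<open>j + 1\<close> alternate.

  In the diagram of an alternating word every strand is horizontally monotone.  Hence the number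
  of letters \<open>j\<close> and the first letter among \<open>j\<close>, \<open>j + 1\<close> can be read off from the diagram, so
  that the diagram determines the word up to commutation.  The representation \<open>s\<^sub>i \<mapsto> d\<^sub>i - 1\<close> of the
  Coxeter group of type \<open>A\<close> at \<open>\<delta> = 2\<close> has the diagram of a word as its leading term; this shows
  that alternating words are exactly the reduced words of the fully commutative elements.
\<close>

section \<open>Commutation classes of words\<close>

text \<open>No local confluence is proved: overlapping forks are never compared, because the diagram
  with its power of \<delta> is an invariant of all runs from which the final heap can be recovered.
  What survives is \<open>columns_chains\<close>, which keeps adjacent equal letters out of every
  linear extension; (F3) is the repair of this property when the deleted node was the only link
  between two nodes of a column. On the type A side, \<open>tau\<close> is specified by a definite
  description over all of \<open>FC_A n\<close>, so every candidate must be comparable by its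
  diagram. Coxeter relations do not preserve diagrams, hence a word that is shortest for its diagram
  is not reduced for free; the representation bridges this gap. The value \<delta> = 2 is forced by
  (d_i - 1)^2 = 1, and since one coefficient is enough, everything is phrased for
  functionals.\<close>

abbreviation comm_equiv :: "nat list \<Rightarrow> nat list \<Rightarrow> bool" (infix \<open>\<sim>\<^sub>c\<close> 50) where
  "u \<sim>\<^sub>c v \<equiv> (commutation_step cox_A)\<^sup>*\<^sup>* u v"

lemma nbr_sym: "nbr i j \<longleftrightarrow> nbr j i"
  by (auto simp: nbr_def)

lemma not_nbr_refl [simp]: "\<not> nbr i i"
  by (simp add: nbr_def)

lemma cox_A_eq_2_iff: "cox_A i j = 2 \<longleftrightarrow> i \<noteq> j \<and> \<not> nbr i j"
  by (simp add: cox_A_def)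

lemma commutation_step_cox_C: "commutation_step (cox_C n) = commutation_step cox_A"
proof -
  have "cox_C n s t = 2 \<longleftrightarrow> cox_A s t = 2" for s t
    by (simp add: cox_A_def cox_C_def)
  then show ?thesis by (intro ext) (simp add: commutation_step_def)
qed

lemma commutation_step_sym: "commutation_step cox_A u v \<Longrightarrow> commutation_step cox_A v u"
  unfolding commutation_step_def cox_A_eq_2_iff by (metis nbr_sym)

lemma comm_equiv_sym: "u \<sim>\<^sub>c v \<Longrightarrow> v \<sim>\<^sub>c u"
  by (induction rule: rtranclp_induct)
    (auto dest: commutation_step_sym intro: converse_rtranclp_into_rtranclp)

lemma comm_equiv_context:
  assumes "u \<sim>\<^sub>c v"
  shows "p @ u @ q \<sim>\<^sub>c p @ v @ q"
  using assms
proof (induction rule: rtranclp_induct)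
  case (step v v')
  from step.hyps(2) obtain l r s t where
    "cox_A s t = 2" "v = l @ [s, t] @ r" "v' = l @ [t, s] @ r"
    unfolding commutation_step_def by blast
  then have "commutation_step cox_A (p @ v @ q) (p @ v' @ q)"
    unfolding commutation_step_def
    by (intro exI[of _ "p @ l"] exI[of _ "r @ q"] exI[of _ s] exI[of _ t]) simp
  then show ?case using step.IH by (rule rtranclp.rtrancl_into_rtrancl[rotated])
qed simp

lemma comm_equiv_mset: "u \<sim>\<^sub>c v \<Longrightarrow> mset u = mset v"
  by (induction rule: rtranclp_induct) (auto simp: commutation_step_def)

lemma comm_equiv_length: "u \<sim>\<^sub>c v \<Longrightarrow> length u = length v"
  by (metis comm_equiv_mset size_mset)

lemma comm_equiv_set: "u \<sim>\<^sub>c v \<Longrightarrow> set u = set v"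
  by (metis comm_equiv_mset set_mset_mset)

lemma comm_equiv_swap: "\<not> nbr s t \<Longrightarrow> [s, t] \<sim>\<^sub>c [t, s]"
proof (cases "s = t")
  case False
  assume "\<not> nbr s t"
  then have "commutation_step cox_A [s, t] [t, s]"
    unfolding commutation_step_def
    by (intro exI[of _ "[]"] exI[of _ s] exI[of _ t]) (use False in \<open>simp add: cox_A_def\<close>)
  then show ?thesis by blast
qed simp

lemma comm_equiv_move:
  assumes "\<And>k. k \<in> set p \<Longrightarrow> \<not> nbr k j"
  shows "p @ j # q \<sim>\<^sub>c j # p @ q"
  using assms
proof (induction p)
  case (Cons k p)
  have "[k] @ (p @ j # q) @ [] \<sim>\<^sub>c [k] @ (j # p @ q) @ []"
    by (rule comm_equiv_context) (use Cons in auto)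
  moreover have "[] @ [k, j] @ (p @ q) \<sim>\<^sub>c [] @ [j, k] @ (p @ q)"
    by (rule comm_equiv_context) (use Cons.prems in \<open>auto intro: comm_equiv_swap\<close>)
  ultimately show ?case by simp
qed simp

text \<open>The projection criterion for partially commutative words, as only the pairs
  \<open>j\<close>, \<open>Suc j\<close> fail to commute. If \<open>i\<close> heads
  \<open>u\<close>, the projections containing \<open>i\<close> show that no neighbour of
  \<open>i\<close> precedes its first occurrence in \<open>v\<close>, so that occurrence can be
  moved to the front.\<close>

lemma comm_equiv_if_filters_eq:
  assumes "\<And>j. filter (\<lambda>x. x = j \<or> x = Suc j) u = filter (\<lambda>x. x = j \<or> x = Suc j) v"
  shows "u \<sim>\<^sub>c v"
  using assms
proof (induction u arbitrary: v)
  case Nil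
  have "x \<notin> set v" for x
    using Nil[of x, symmetric] by (auto simp: filter_empty_conv)
  then show ?case by (cases v) auto
next
  case (Cons i u)
  have "i \<in> set (filter (\<lambda>x. x = i \<or> x = Suc i) v)"
    unfolding Cons.prems[of i, symmetric] by simp
  then obtain p q where v: "v = p @ i # q" and p: "i \<notin> set p"
    by (auto dest: split_list_first)
  \<comment> \<open>A letter of the prefix that survives the filter would have to be the head
    \<open>i\<close>, which the prefix avoids.\<close>
  have first: "filter P p = []" if "filter P (i # u) = filter P (p @ i # q)" "P i" for P
  proof (rule ccontr)
    assume "filter P p \<noteq> []"
    then obtain x xs where x: "filter P p = x # xs" by (cases "filter P p") auto
    then have "x = i" using that by simp
    moreover have "x \<in> set p" using x by (metis filter_is_subset list.set_intros(1) subsetD)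
    ultimately show False using p by simp
  qed
  have up: "Suc i \<notin> set p"
    using first[OF Cons.prems[of i, unfolded v]] by (auto simp: filter_empty_conv)
  have down: "k \<notin> set p" if "i = Suc k" for k
    using first[OF Cons.prems[of k, unfolded v]] that by (auto simp: filter_empty_conv)
  have move: "v \<sim>\<^sub>c i # p @ q"
    unfolding v by (rule comm_equiv_move) (use up down in \<open>auto simp: nbr_def\<close>)
  have "u \<sim>\<^sub>c p @ q"
  proof (rule Cons.IH)
    fix j
    show "filter (\<lambda>x. x = j \<or> x = Suc j) u = filter (\<lambda>x. x = j \<or> x = Suc j) (p @ q)"
      using Cons.prems[of j] first[OF Cons.prems[of j, unfolded v]]
      by (cases "i = j \<or> i = Suc j") (auto simp: v)
  qed
  then have "[i] @ u @ [] \<sim>\<^sub>c [i] @ (p @ q) @ []" by (rule comm_equiv_context)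
  then show ?case using comm_equiv_sym[OF move] by simp
qed

text \<open>For letters in \<open>{1..M}\<close> the cases \<open>j = 0\<close> and
  \<open>j = M\<close> say that 1 and \<open>M\<close> occur at most once, so the ends of the path
  are covered by the same formula.\<close>

definition alternating :: "nat list \<Rightarrow> bool" where
  "alternating u \<longleftrightarrow> (\<forall>j. distinct_adj (filter (\<lambda>x. x = j \<or> x = Suc j) u))"

lemma alternating_ConsD: "alternating (i # u) \<Longrightarrow> alternating u"
  unfolding alternating_def by (auto dest: distinct_adj_ConsD split: if_splits)

lemma not_distinct_adj_filterE:
  assumes "\<not> distinct_adj (filter P u)"
  obtains l c m r where "u = l @ c # m @ c # r" "P c" "\<And>x. x \<in> set m \<Longrightarrow> \<not> P x"
  using assms
proof (induction u arbitrary: thesis)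
  case (Cons a u)
  show ?case
  proof (cases "distinct_adj (filter P u)")
    case True
    with Cons.prems(2) have "P a" by (auto split: if_splits)
    with Cons.prems(2) True have ne: "filter P u \<noteq> []" "hd (filter P u) = a"
      by (auto simp: distinct_adj_Cons)
    then obtain b bs where b: "filter P u = b # bs" by (cases "filter P u") auto
    then obtain m r where "u = m @ b # r" "\<forall>x\<in>set m. \<not> P x"
      by (auto simp: filter_eq_Cons_iff)
    with ne b \<open>P a\<close> show ?thesis by (intro Cons.prems(1)[of "[]" a m r]) auto
  next
    case False
    then obtain l c m r where "u = l @ c # m @ c # r" "P c" "\<And>x. x \<in> set m \<Longrightarrow> \<not> P x"
      using Cons.IH by blast
    then show ?thesis by (intro Cons.prems(1)[of "a # l" c m r]) auto
  qed
qed simp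

lemma two_occurrencesE:
  assumes "\<not> count_list m k \<le> 1"
  obtains m1 m2 m3 where "m = m1 @ k # m2 @ k # m3" "k \<notin> set m2"
proof -
  from assms have "k \<in> set m" by (metis count_notin le0)
  then obtain m1 m' where m: "m = m1 @ k # m'" "k \<notin> set m1" by (meson split_list_first)
  then have "count_list m' k \<noteq> 0" using assms count_notin[of k m1] by simp
  then have "k \<in> set m'" by (metis count_notin)
  then obtain m2 m3 where "m' = m2 @ k # m3" "k \<notin> set m2" by (meson split_list_first)
  then show ?thesis using that m by auto
qed

text \<open>Two consecutive letters \<open>c\<close> that miss a neighbour between them on one side enclose a
  pair of consecutive letters on the other side with the same defect; this stops at the end of
  the Coxeter graph.\<close>

lemma innermost_pair_down:
  assumes "u = l @ c # m @ c # r" "0 \<notin> set u" "c \<notin> set m" "Suc c \<notin> set m"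
  shows "\<exists>l c m r. u = l @ c # m @ c # r \<and> c \<notin> set m \<and>
    (Suc c \<notin> set m \<and> count_list m (c - 1) \<le> 1 \<or> c - 1 \<notin> set m \<and> count_list m (Suc c) \<le> 1)"
  using assms
proof (induction c arbitrary: l m r)
  case (Suc c)
  show ?case
  proof (cases "count_list m c \<le> 1")
    case True
    then show ?thesis
      using Suc.prems by (intro exI[of _ l] exI[of _ "Suc c"] exI[of _ m] exI[of _ r]) simp
  next
    case False
    then obtain m1 m2 m3 where "m = m1 @ c # m2 @ c # m3" "c \<notin> set m2"
      by (rule two_occurrencesE)
    then show ?thesis
      using Suc.prems by (intro Suc.IH[of "l @ Suc c # m1" m2 "m3 @ Suc c # r"]) auto
  qed
qed simp

text \<open>The mirror image; the induction is now on the distance of \<open>c\<close> to the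
  largest possible letter.\<close>

lemma innermost_pair_up:
  assumes "u = l @ c # m @ c # r" "\<And>x. x \<in> set u \<Longrightarrow> x \<le> M" "c \<notin> set m" "c - 1 \<notin> set m"
  shows "\<exists>l c m r. u = l @ c # m @ c # r \<and> c \<notin> set m \<and>
    (Suc c \<notin> set m \<and> count_list m (c - 1) \<le> 1 \<or> c - 1 \<notin> set m \<and> count_list m (Suc c) \<le> 1)"
  using assms
proof (induction "M - c" arbitrary: l c m r)
  case 0
  then have "c = M" by force
  then have "Suc c \<notin> set m" using 0 by fastforce
  then show ?case
    using 0 by (intro exI[of _ l] exI[of _ c] exI[of _ m] exI[of _ r]) simp
next
  case (Suc d)
  show ?case
  proof (cases "count_list m (Suc c) \<le> 1")
    case True
    then show ?thesis
      using Suc.prems by (intro exI[of _ l] exI[of _ c] exI[of _ m] exI[of _ r]) simp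
  next
    case False
    then obtain m1 m2 m3 where "m = m1 @ Suc c # m2 @ Suc c # m3" "Suc c \<notin> set m2"
      by (rule two_occurrencesE)
    then show ?thesis
      using Suc.prems Suc.hyps(2)
      by (intro Suc.hyps(1)[of "Suc c" "l @ c # m1" m2 "m3 @ c # r"]) auto
  qed
qed

lemma count_le_1_split:
  assumes "count_list m k \<le> 1" "k \<in> set m"
  obtains m1 m2 where "m = m1 @ k # m2" "k \<notin> set m1" "k \<notin> set m2"
proof -
  from assms(2) obtain m1 m2 where m: "m = m1 @ k # m2" "k \<notin> set m1" by (meson split_list_first)
  with assms(1) have "count_list m2 k = 0" by simp
  then have "k \<notin> set m2" by (simp add: count_list_0_iff)
  with m that show ?thesis by blast
qed

text \<open>In the innermost defective pair at most one letter between the two \<open>c\<close>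
  fails to commute with \<open>c\<close>. Both copies slide inwards until they meet each other or
  that letter. This serves to shorten words, to analyse reduced words and to find forks.\<close>

lemma not_alternating_comm_equiv:
  assumes "u \<in> lists {1..M}" "\<not> alternating u"
  shows "\<exists>p c q. u \<sim>\<^sub>c p @ [c, c] @ q \<or> (\<exists>k. nbr c k \<and> u \<sim>\<^sub>c p @ [c, k, c] @ q)"
proof -
  have S: "0 \<notin> set u" "\<And>x. x \<in> set u \<Longrightarrow> x \<le> M"
    using assms(1) by (auto simp: in_lists_conv_set)
  from assms(2) obtain j where "\<not> distinct_adj (filter (\<lambda>x. x = j \<or> x = Suc j) u)"
    by (auto simp: alternating_def)
  then obtain l c m r where u: "u = l @ c # m @ c # r" "c = j \<or> c = Suc j"
      "\<And>x. x \<in> set m \<Longrightarrow> \<not> (x = j \<or> x = Suc j)"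
    using not_distinct_adj_filterE by blast
  have "\<exists>l c m r. u = l @ c # m @ c # r \<and> c \<notin> set m \<and>
    (Suc c \<notin> set m \<and> count_list m (c - 1) \<le> 1 \<or> c - 1 \<notin> set m \<and> count_list m (Suc c) \<le> 1)"
  proof (cases "c = j")
    case True
    then show ?thesis using innermost_pair_down[OF u(1) S(1)] u by blast
  next
    case False
    then have "c = Suc j" "c - 1 = j" using u(2) by auto
    then show ?thesis using innermost_pair_up[OF u(1) S(2)] u(3) by metis
  qed
  then obtain l c m r k where u: "u = l @ c # m @ c # r" and c: "c \<notin> set m"
    and k: "count_list m k \<le> 1" "\<And>x. x \<in> set m \<Longrightarrow> nbr c x \<Longrightarrow> x = k" "nbr c k"
  proof -
    fix thesis
    assume H: "\<And>l c m r k. u = l @ c # m @ c # r \<Longrightarrow> c \<notin> set m \<Longrightarrow> count_list m k \<le> 1 \<Longrightarrow>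
        (\<And>x. x \<in> set m \<Longrightarrow> nbr c x \<Longrightarrow> x = k) \<Longrightarrow> nbr c k \<Longrightarrow> thesis"
    assume "\<exists>l c m r. u = l @ c # m @ c # r \<and> c \<notin> set m \<and>
    (Suc c \<notin> set m \<and> count_list m (c - 1) \<le> 1 \<or> c - 1 \<notin> set m \<and> count_list m (Suc c) \<le> 1)"
    then obtain l c m r where a: "u = l @ c # m @ c # r" "c \<notin> set m"
      and b: "Suc c \<notin> set m \<and> count_list m (c - 1) \<le> 1 \<or> c - 1 \<notin> set m \<and> count_list m (Suc c) \<le> 1"
      by blast
    \<comment> \<open>For \<open>c = 0\<close> truncated subtraction would make \<open>c - 1\<close>
      equal to \<open>c\<close>, which is not a neighbour.\<close>
    have "c \<noteq> 0" using a S(1) by auto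
    from b show thesis
    proof
      assume "Suc c \<notin> set m \<and> count_list m (c - 1) \<le> 1"
      then show thesis
        using \<open>c \<noteq> 0\<close> by (intro H[OF a, of "c - 1"]) (auto simp: nbr_def)
    next
      assume "c - 1 \<notin> set m \<and> count_list m (Suc c) \<le> 1"
      then show thesis
        using \<open>c \<noteq> 0\<close> by (intro H[OF a, of "Suc c"]) (auto simp: nbr_def)
    qed
  qed
  show ?thesis
  proof (cases "k \<in> set m")
    case False
    have "m @ c # ([c] @ r) \<sim>\<^sub>c c # m @ [c] @ r"
      by (rule comm_equiv_move) (use False k(2) nbr_sym in blast)
    then have "l @ (c # m @ c # r) @ [] \<sim>\<^sub>c l @ (m @ [c, c] @ r) @ []"
      by (intro comm_equiv_context) (auto intro: comm_equiv_sym)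
    then have "u \<sim>\<^sub>c (l @ m) @ [c, c] @ r" by (simp add: u)
    then show ?thesis by blast
  next
    case True
    obtain m1 m2 where m: "m = m1 @ k # m2" "k \<notin> set m1" "k \<notin> set m2"
      using k(1) True by (rule count_le_1_split)
    have "m1 @ c # (k # m2 @ c # r) \<sim>\<^sub>c c # m1 @ (k # m2 @ c # r)"
      by (rule comm_equiv_move) (use k(2) m nbr_sym in auto)
    then have "l @ (c # m1 @ k # m2 @ c # r) @ [] \<sim>\<^sub>c l @ (m1 @ c # k # m2 @ c # r) @ []"
      by (intro comm_equiv_context) (auto intro: comm_equiv_sym)
    moreover have "(l @ m1 @ [c, k]) @ (m2 @ c # r) @ [] \<sim>\<^sub>c (l @ m1 @ [c, k]) @ (c # m2 @ r) @ []"
      by (intro comm_equiv_context comm_equiv_move) (use k(2) m nbr_sym in auto)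
    ultimately have "u \<sim>\<^sub>c (l @ m1) @ [c, k, c] @ (m2 @ r)" by (simp add: u m)
    then show ?thesis using k(3) by blast
  qed
qed

section \<open>Diagrams as planar involutions\<close>

text \<open>A loop-free diagram is handled through the involution that maps every node to the other
  end of its edge, extended by the identity outside the box.\<close>

definition matching :: "nat \<Rightarrow> (node \<Rightarrow> node) \<Rightarrow> bool" where
  "matching N f \<longleftrightarrow> (\<forall>v. f (f v) = v) \<and> (\<forall>v. f v \<noteq> v \<longleftrightarrow> v \<in> box_nodes N)"

definition planar :: "nat \<Rightarrow> (node \<Rightarrow> node) \<Rightarrow> bool" where
  "planar N f \<longleftrightarrow> (\<forall>u\<in>box_nodes N. \<forall>v\<in>box_nodes N.
     \<not> (pos N u < pos N v \<and> pos N v < pos N (f u) \<and> pos N (f u) < pos N (f v)))"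

definition diagram_of :: "nat \<Rightarrow> (node \<Rightarrow> node) \<Rightarrow> diagram" where
  "diagram_of N f = {{v, f v} | v. v \<in> box_nodes N}"

text \<open>If \<open>f\<close> joins the north nodes \<open>i\<close> and \<open>i + 1\<close>, then the formula gives \<open>f\<close> itself, in accordance
  with \<open>d\<^sub>i d\<^sub>i = \<delta> d\<^sub>i\<close>.\<close>

definition tl_act :: "nat \<Rightarrow> (node \<Rightarrow> node) \<Rightarrow> node \<Rightarrow> node" where
  "tl_act i f v =
     (if v = (North, i) then (North, Suc i)
      else if v = (North, Suc i) then (North, i)
      else if f v = (North, i) then f (North, Suc i)
      else if f v = (North, Suc i) then f (North, i)
      else f v)"

text \<open>A number rather than a truth value, since it serves as an exponent of \<delta>.\<close>

definition tl_loop :: "nat \<Rightarrow> (node \<Rightarrow> node) \<Rightarrow> nat" where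
  "tl_loop i f = (if f (North, i) = (North, Suc i) then 1 else 0)"

lemma matching_invol: "matching N f \<Longrightarrow> f (f v) = v"
  unfolding matching_def by blast

lemma matching_fixed_iff: "matching N f \<Longrightarrow> f v = v \<longleftrightarrow> v \<notin> box_nodes N"
  unfolding matching_def by blast

lemma matching_eq_iff: "matching N f \<Longrightarrow> f u = f v \<longleftrightarrow> u = v"
  by (metis matching_invol)

lemma matching_swap: "matching N f \<Longrightarrow> f u = v \<longleftrightarrow> u = f v"
  by (metis matching_invol)

lemma matching_in_box: "matching N f \<Longrightarrow> f v \<in> box_nodes N \<longleftrightarrow> v \<in> box_nodes N"
  by (metis matching_def)

lemma North_in_box [simp]: "(North, i) \<in> box_nodes N \<longleftrightarrow> i \<in> {1..N}"
  by (simp add: box_nodes_def)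

lemma South_in_box [simp]: "(South, i) \<in> box_nodes N \<longleftrightarrow> i \<in> {1..N}"
  by (simp add: box_nodes_def)

lemma Middle_notin_box [simp]: "(Middle, i) \<notin> box_nodes N"
  by (simp add: box_nodes_def)

lemma tl_act_North [simp]:
  "tl_act i f (North, i) = (North, Suc i)" "tl_act i f (North, Suc i) = (North, i)"
  by (simp_all add: tl_act_def)

lemma matching_tl_act:
  assumes f: "matching N f" and i: "i \<in> {1..<N}"
  shows "matching N (tl_act i f)"
proof -
  let ?P = "(North, i)" and ?Q = "(North, Suc i)"
  have B: "?P \<in> box_nodes N" "?Q \<in> box_nodes N" using i by auto
  have "tl_act i f (tl_act i f v) = v" for v
  proof -
    consider "v = ?P" | "v = ?Q" | "v \<noteq> ?P" "v \<noteq> ?Q" "f v = ?P" | "v \<noteq> ?P" "v \<noteq> ?Q" "f v = ?Q"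
      | "v \<noteq> ?P" "v \<noteq> ?Q" "f v \<noteq> ?P" "f v \<noteq> ?Q" by blast
    then show ?thesis
    proof cases
      case 3
      then have "v = f ?P" by (metis f matching_invol)
      moreover have "f ?Q \<noteq> ?Q" "f ?Q \<noteq> ?P"
        using B f 3 by (auto simp: matching_def) (metis f matching_invol)
      ultimately show ?thesis using 3 by (auto simp: tl_act_def matching_invol[OF f])
    next
      case 4
      then have "v = f ?Q" by (metis f matching_invol)
      moreover have "f ?P \<noteq> ?P" "f ?P \<noteq> ?Q"
        using B f 4 by (auto simp: matching_def) (metis f matching_invol)
      ultimately show ?thesis using 4 by (auto simp: tl_act_def matching_invol[OF f])
    qed (auto simp: tl_act_def matching_invol[OF f])
  qed
  moreover have "tl_act i f v \<noteq> v \<longleftrightarrow> v \<in> box_nodes N" for v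
  proof -
    have "f v \<noteq> ?Q" if "v = f ?P" "v \<noteq> ?P" "v \<noteq> ?Q"
      using that by (simp add: matching_invol[OF f])
    then show ?thesis
      using B matching_fixed_iff[OF f, of v] matching_eq_iff[OF f, of v] matching_in_box[OF f, of v]
        matching_swap[OF f, of v]
      by (auto simp: tl_act_def)
  qed
  ultimately show ?thesis by (auto simp: matching_def)
qed

lemma tl_act_idem: "tl_act i (tl_act i f) = tl_act i f"
  by (rule ext) (auto simp: tl_act_def)

lemma tl_loop_tl_act_same [simp]: "tl_loop i (tl_act i f) = 1"
  by (simp add: tl_loop_def)

text \<open>The diagram relation d_i d_j d_i = d_i. After d_i the north nodes \<open>i\<close> and
  \<open>Suc i\<close> are joined to each other; d_j meets just one of them, so no arc closes to a
  loop, and the second d_i straightens the detour.\<close>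

lemma tl_act_braid:
  assumes f: "matching N f" and "i \<in> {1..<N}" "j \<in> {1..<N}" "j = Suc i \<or> i = Suc j"
  shows "tl_act i (tl_act j (tl_act i f)) = tl_act i f"
    "tl_loop j (tl_act i f) = 0" "tl_loop i (tl_act j (tl_act i f)) = 0"
proof -
  let ?f = "tl_act i f"
  have m: "matching N ?f" using assms by (intro matching_tl_act)
  have *: "?f v \<noteq> (North, i)" if "v \<noteq> (North, Suc i)" for v
    using that matching_swap[OF m, of v "(North, i)"] by simp
  have **: "?f v \<noteq> (North, Suc i)" if "v \<noteq> (North, i)" for v
    using that matching_swap[OF m, of v "(North, Suc i)"] by simp
  show "tl_loop j ?f = 0" using assms * ** by (auto simp: tl_loop_def)
  show "tl_loop i (tl_act j ?f) = 0"
    using assms * ** by (auto simp: tl_loop_def tl_act_def[of j])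
  show "tl_act i (tl_act j ?f) = ?f"
  proof
    fix v
    from assms(4) show "tl_act i (tl_act j ?f) v = ?f v"
    proof
      assume j: "j = Suc i"
      show ?thesis
        unfolding tl_act_def[of i "tl_act j ?f"] tl_act_def[of j]
        using matching_swap[OF m, of v "(North, Suc j)"] *[of v] **[of v] j by auto
    next
      assume j: "i = Suc j"
      show ?thesis
        unfolding tl_act_def[of i "tl_act j ?f"] tl_act_def[of j]
        using matching_swap[OF m, of v "(North, j)"] *[of v] **[of v] j by auto
    qed
  qed
qed

text \<open>Only the sum of the loop counts is symmetric: if \<open>f\<close> joins north
  \<open>i\<close> and \<open>Suc i\<close>, the resulting loop is counted in the first summand on
  one side and in the second on the other.\<close>

lemma tl_act_commute:
  assumes f: "matching N f" and "i \<in> {1..<N}" "j \<in> {1..<N}" "Suc i < j"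
  shows "tl_act i (tl_act j f) = tl_act j (tl_act i f)"
    "tl_loop j f + tl_loop i (tl_act j f) = tl_loop i f + tl_loop j (tl_act i f)"
proof -
  \<comment> \<open>The four nodes become opaque; the case analysis uses only that they are distinct
    and that \<open>f\<close> is an involution moving each of them.\<close>
  define P Q R T where d: "P = (North, i)" "Q = (North, Suc i)" "R = (North, j)" "T = (North, Suc j)"
  have ne: "P \<noteq> Q" "P \<noteq> R" "P \<noteq> T" "Q \<noteq> R" "Q \<noteq> T" "R \<noteq> T"
    "Q \<noteq> P" "R \<noteq> P" "T \<noteq> P" "R \<noteq> Q" "T \<noteq> Q" "T \<noteq> R"
    using assms by (auto simp: d)
  have fx: "f P \<noteq> P" "f Q \<noteq> Q" "f R \<noteq> R" "f T \<noteq> T"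
    using assms matching_fixed_iff[OF f] by (auto simp: d)
  have sw: "f u = v \<longleftrightarrow> u = f v" for u v by (rule matching_swap[OF f])
  have inv: "f (f v) = v" for v by (rule matching_invol[OF f])
  have pair: "f u = v \<and> f v = u \<or> f u \<noteq> v \<and> f v \<noteq> u" for u v by (metis inv)
  note pairs = pair[of P Q] pair[of P R] pair[of P T] pair[of Q R] pair[of Q T] pair[of R T]
  have inj: "f u = f v \<longleftrightarrow> u = v" for u v by (metis inv)
  have loops: "(if f R = T then 1 else 0) + (if tl_act j f P = Q then 1 else 0) =
      (if f P = Q then 1 else 0) + (if tl_act i f R = T then 1 else (0::nat))"
    unfolding tl_act_def d[symmetric] using ne fx pairs by (simp only: if_False if_True) (auto simp: inj)
  then show "tl_loop j f + tl_loop i (tl_act j f) = tl_loop i f + tl_loop j (tl_act i f)"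
    unfolding tl_loop_def d[symmetric] .
  show "tl_act i (tl_act j f) = tl_act j (tl_act i f)"
  proof
    fix v
    consider "v \<in> {P, Q, R, T}" | "v \<notin> {P, Q, R, T}" "v \<in> {f P, f Q, f R, f T}"
      | "v \<notin> {P, Q, R, T}" "v \<notin> {f P, f Q, f R, f T}" by blast
    then show "tl_act i (tl_act j f) v = tl_act j (tl_act i f) v"
    proof cases
      case 1
      then show ?thesis
        unfolding tl_act_def d[symmetric] using ne fx pairs by (auto simp: inj inv)
    next
      case 2
      then show ?thesis
        unfolding tl_act_def d[symmetric] using ne fx pairs by (auto simp: inj inv)
    next
      case 3
      then have "f v \<notin> {P, Q, R, T}" by (auto simp: inv)
      with 3 show ?thesis unfolding tl_act_def d[symmetric] by auto
    qed
  qed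
qed

declare split_paired_All [simp del] split_paired_Ex [simp del]

text \<open>Nothing lies between consecutive boundary positions, so every other node compares in the
  same way with both. Planarity is preserved for this reason.\<close>

lemma pos_North_adjacent:
  assumes "v \<in> box_nodes N" "i \<in> {1..<N}" "v \<noteq> (North, i)" "v \<noteq> (North, Suc i)"
  shows "pos N v < i \<or> Suc i < pos N v"
  using assms by (cases v; cases "fst v") auto

text \<open>Apart from the new arc, only the edges that ended at north \<open>i\<close> or
  \<open>Suc i\<close> change: they merge into one. As these two ends are adjacent on the boundary,
  an edge crossing the merged one would already have crossed one of the two.\<close>

lemma planar_tl_act:
  assumes f: "matching N f" and p: "planar N f" and i: "i \<in> {1..<N}"
  shows "planar N (tl_act i f)"
  unfolding planar_def
proof (intro ballI notI)
  fix u v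
  let ?P = "(North, i)" and ?Q = "(North, Suc i)" and ?g = "tl_act i f"
  assume u: "u \<in> box_nodes N" and v: "v \<in> box_nodes N"
    and cr: "pos N u < pos N v \<and> pos N v < pos N (?g u) \<and> pos N (?g u) < pos N (?g v)"
  have P: "?P \<in> box_nodes N" "?Q \<in> box_nodes N" using i by auto
  have fb: "f w \<in> box_nodes N" if "w \<in> box_nodes N" for w
    using that f by (simp add: matching_in_box)
  have un: "u \<noteq> ?P" "u \<noteq> ?Q" "v \<noteq> ?P" "v \<noteq> ?Q" using cr by auto
  have g: "?g w = (if f w = ?P then f ?Q else if f w = ?Q then f ?P else f w)"
    if "w \<noteq> ?P" "w \<noteq> ?Q" for w
    using that by (simp add: tl_act_def)
  have inv: "f (f w) = w" for w by (rule matching_invol[OF f])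
  have adj: "pos N w < i \<or> Suc i < pos N w" if "w \<in> box_nodes N" "w \<noteq> ?P" "w \<noteq> ?Q" for w
    using pos_North_adjacent that i by blast
  have pl: "\<not> (pos N a < pos N b \<and> pos N b < pos N (f a) \<and> pos N (f a) < pos N (f b))"
    if "a \<in> box_nodes N" "b \<in> box_nodes N" for a b
    using p that by (auto simp: planar_def)
  note adjs = adj[OF u un(1,2)] adj[OF v un(3,4)]
  have fuv: "f u = w \<longleftrightarrow> u = f w" for u w by (rule matching_swap[OF f])
  consider (uv) "f u \<in> {?P, ?Q}" "f v \<in> {?P, ?Q}" | (u) "f u \<in> {?P, ?Q}" "f v \<notin> {?P, ?Q}"
    | (v) "f u \<notin> {?P, ?Q}" "f v \<in> {?P, ?Q}" | (none) "f u \<notin> {?P, ?Q}" "f v \<notin> {?P, ?Q}" by blast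
  then show False
  proof cases
    \<comment> \<open>Here \<open>u\<close> and \<open>v\<close> are the two ends of the same merged
      edge, which cannot cross itself.\<close>
    case uv
    have "u \<noteq> v" using cr by auto
    then have "f u \<noteq> f v" using matching_eq_iff[OF f] by auto
    then have "?g u = v" using uv un by (auto simp: g inv fuv)
    then show False using cr by simp
  next
    case u': u
    then obtain R T where RT: "f u = R" "R = ?P \<and> T = ?Q \<or> R = ?Q \<and> T = ?P" by blast
    then have gu: "?g u = f T" and gv: "?g v = f v" using u' un by (auto simp: g)
    have T: "T \<in> box_nodes N" "R \<in> box_nodes N" using RT P by auto
    have fR: "f R = u" using RT(1) inv by metis
    have nfv: "f v \<noteq> ?P" "f v \<noteq> ?Q" using u' by auto
    have cmp: "pos N w < pos N R \<longleftrightarrow> pos N w < i" "pos N w < pos N T \<longleftrightarrow> pos N w < i"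
      "pos N R < pos N w \<longleftrightarrow> Suc i < pos N w" "pos N T < pos N w \<longleftrightarrow> Suc i < pos N w"
      if "pos N w < i \<or> Suc i < pos N w" for w
      using RT(2) that by auto
    note adjf = adj[OF fb[OF v] nfv]
    have "\<not> (pos N u < pos N v \<and> pos N v < pos N R \<and> pos N R < pos N (f v))"
      using pl[OF u v] RT(1) by simp
    moreover note pl[OF T(1) v] pl[OF v fb[OF T(1)], unfolded inv]
    ultimately show False
      using cr adjs adjf unfolding gu gv cmp[OF adjs(1)] cmp[OF adjs(2)] cmp[OF adjf] by auto
  next
    case v': v
    then obtain R T where RT: "f v = R" "R = ?P \<and> T = ?Q \<or> R = ?Q \<and> T = ?P" by blast
    then have gv: "?g v = f T" and gu: "?g u = f u" using v' un by (auto simp: g)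
    have T: "T \<in> box_nodes N" "R \<in> box_nodes N" using RT P by auto
    have fR: "f R = v" using RT(1) inv by metis
    have nfv: "f u \<noteq> ?P" "f u \<noteq> ?Q" using v' by auto
    have cmp: "pos N w < pos N R \<longleftrightarrow> pos N w < i" "pos N w < pos N T \<longleftrightarrow> pos N w < i"
      "pos N R < pos N w \<longleftrightarrow> Suc i < pos N w" "pos N T < pos N w \<longleftrightarrow> Suc i < pos N w"
      if "pos N w < i \<or> Suc i < pos N w" for w
      using RT(2) that by auto
    note adjf = adj[OF fb[OF u] nfv]
    have "\<not> (pos N u < pos N v \<and> pos N v < pos N (f u) \<and> pos N (f u) < pos N R)"
      using pl[OF u v] RT(1) by simp
    moreover have "\<not> (pos N R < pos N u \<and> pos N u < pos N v \<and> pos N v < pos N (f u))"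
      using pl[OF T(2) u] fR by simp
    moreover note pl[OF u T(1)]
    ultimately show False
      using cr adjs adjf unfolding gu gv cmp[OF adjs(1)] cmp[OF adjs(2)] cmp[OF adjf] by auto
  next
    case none
    then show False using cr pl[OF u v] un by (simp add: g)
  qed
qed

definition vertical :: "nat \<Rightarrow> node \<Rightarrow> node" where
  "vertical N v = (if v \<in> box_nodes N then (if fst v = North then South else North, snd v) else v)"

lemma matching_vertical: "matching N (vertical N)"
  unfolding matching_def vertical_def by (auto simp: box_nodes_def)

lemma planar_vertical: "planar N (vertical N)"
  unfolding planar_def vertical_def by (auto simp: box_nodes_def)

definition diagram_map :: "nat \<Rightarrow> (node \<Rightarrow> node) \<Rightarrow> bool" where
  "diagram_map N f \<longleftrightarrow> matching N f \<and> planar N f"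

lemma diagram_map_vertical: "diagram_map N (vertical N)"
  by (simp add: diagram_map_def matching_vertical planar_vertical)

lemma diagram_map_tl_act: "diagram_map N f \<Longrightarrow> i \<in> {1..<N} \<Longrightarrow> diagram_map N (tl_act i f)"
  by (simp add: diagram_map_def matching_tl_act planar_tl_act)

lemma diagram_of_in_diagrams:
  assumes "diagram_map N f"
  shows "diagram_of N f \<in> diagrams N"
proof -
  have m: "matching N f" and p: "planar N f" using assms by (auto simp: diagram_map_def)
  have "e \<subseteq> box_nodes N \<and> card e = 2" if "e \<in> diagram_of N f" for e
    using that matching_in_box[OF m] matching_fixed_iff[OF m]
    by (fastforce simp: diagram_of_def card_2_iff)
  moreover have "\<exists>!e. e \<in> diagram_of N f \<and> v \<in> e" if "v \<in> box_nodes N" for v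
    using that by (intro ex1I[of _ "{v, f v}"])
      (auto simp: diagram_of_def matching_invol[OF m])
  moreover have "\<not> crossing N e e'" if "e \<in> diagram_of N f" "e' \<in> diagram_of N f" for e e'
  proof
    have *: "a \<in> box_nodes N \<and> b = f a" if "{a, b} \<in> diagram_of N f" for a b
      using that matching_in_box[OF m] matching_invol[OF m]
      by (auto simp: diagram_of_def doubleton_eq_iff)
    assume "crossing N e e'"
    then obtain a b c d where "e = {a, b}" "e' = {c, d}"
      "pos N a < pos N c \<and> pos N c < pos N b \<and> pos N b < pos N d"
      unfolding crossing_def by blast
    then show False using that p *[of a b] *[of c d] by (auto simp: planar_def)
  qed
  ultimately show ?thesis by (auto simp: diagrams_def)
qed

lemma diagram_of_inject:
  assumes f: "matching N f" and g: "matching N g" and eq: "diagram_of N f = diagram_of N g"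
  shows "f = g"
proof
  fix v
  show "f v = g v"
  proof (cases "v \<in> box_nodes N")
    case True
    then have "{v, f v} \<in> diagram_of N g" unfolding eq[symmetric] by (auto simp: diagram_of_def)
    then obtain w where "{v, f v} = {w, g w}" by (auto simp: diagram_of_def)
    then show ?thesis using matching_invol[OF g, of w] by (auto simp: doubleton_eq_iff)
  next
    case False
    then show ?thesis using f g matching_fixed_iff by metis
  qed
qed

lemma id_diagram_eq: "id_diagram N = diagram_of N (vertical N)"
proof
  show "id_diagram N \<subseteq> diagram_of N (vertical N)"
  proof
    fix e assume "e \<in> id_diagram N"
    then obtain j where "j \<in> {1..N}" "e = {(North, j), (South, j)}" by (auto simp: id_diagram_def)
    then show "e \<in> diagram_of N (vertical N)"
      by (auto simp: diagram_of_def vertical_def intro!: exI[of _ "(North, j)"])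
  qed
  show "diagram_of N (vertical N) \<subseteq> id_diagram N"
    by (auto simp: diagram_of_def vertical_def id_diagram_def box_nodes_def)
qed

lemma tl_act_vertical:
  assumes "i \<in> {1..<N}"
  shows "tl_act i (vertical N) v =
    (if snd v \<in> {i, Suc i} \<and> fst v \<noteq> Middle then (fst v, if snd v = i then Suc i else i)
     else vertical N v)"
  using assms by (cases v; cases "fst v") (auto simp: tl_act_def vertical_def box_nodes_def)

text \<open>d_i is its own product with the identity diagram, so its planarity needs no separate
  proof.\<close>

lemma simple_diagram_eq:
  assumes i: "i \<in> {1..<N}"
  shows "simple_diagram N i = diagram_of N (tl_act i (vertical N))" (is "_ = diagram_of N ?g")
proof
  have edge: "{v, ?g v} \<in> diagram_of N ?g" if "v \<in> box_nodes N" for v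
    using that by (auto simp: diagram_of_def)
  show "simple_diagram N i \<subseteq> diagram_of N ?g"
  proof
    fix e assume "e \<in> simple_diagram N i"
    then consider "e = {(North, i), (North, i + 1)}" | "e = {(South, i), (South, i + 1)}"
      | j where "j \<in> {1..N} - {i, i + 1}" "e = {(North, j), (South, j)}"
      by (auto simp: simple_diagram_def)
    then show "e \<in> diagram_of N ?g"
    proof cases
      case 1
      then show ?thesis using edge[of "(North, i)"] i by simp
    next
      case 2
      then show ?thesis using edge[of "(South, i)"] i by (simp add: tl_act_vertical)
    next
      case 3
      then show ?thesis using edge[of "(North, j)"] i by (auto simp: tl_act_vertical vertical_def)
    qed
  qed
  show "diagram_of N ?g \<subseteq> simple_diagram N i"
  proof
    fix e assume "e \<in> diagram_of N ?g"
    then obtain v where v: "v \<in> box_nodes N" "e = {v, ?g v}" by (auto simp: diagram_of_def)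
    moreover obtain l j where "v = (l, j)" by (cases v)
    ultimately have lj: "l = North \<or> l = South" "j \<in> {1..N}" "e = {(l, j), ?g (l, j)}"
      by (auto simp: box_nodes_def)
    show "e \<in> simple_diagram N i"
    proof (cases "j \<in> {i, Suc i}")
      case True
      then show ?thesis
        using lj i by (auto simp: tl_act_vertical simple_diagram_def insert_commute)
    next
      case False
      then have "e = {(North, j), (South, j)}"
        using lj i by (auto simp: tl_act_vertical vertical_def insert_commute)
      then show ?thesis using False lj(2) by (auto simp: simple_diagram_def)
    qed
  qed
qed

section \<open>Stacking a simple diagram on a diagram\<close>

context
  fixes N i :: nat and f :: "node \<Rightarrow> node"
  assumes f: "matching N f" and i: "i \<in> {1..<N}"
begin

private abbreviation "D' \<equiv> simple_diagram N i"
private abbreviation "D \<equiv> diagram_of N f"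
private abbreviation "g \<equiv> tl_act i f"
private abbreviation "P \<equiv> (North, i)"
private abbreviation "Q \<equiv> (North, Suc i)"

private definition links :: "(node \<times> node) set" where
  "links = {(u, v). {u, v} \<in> image to_upper ` D' \<union> image to_lower ` D}"

private lemma connected_eq: "connected D' D = links\<^sup>*"
  by (simp add: connected_def links_def)

private lemma sym_connected: "(u, v) \<in> links\<^sup>* \<Longrightarrow> (v, u) \<in> links\<^sup>*"
proof -
  have "sym links" by (auto simp: sym_def links_def insert_commute)
  then show "(u, v) \<in> links\<^sup>* \<Longrightarrow> (v, u) \<in> links\<^sup>*" by (metis sym_rtrancl symD)
qed

private lemma g: "matching N g"
  using f i by (rule matching_tl_act)

private lemma PQ_in_box: "P \<in> box_nodes N" "Q \<in> box_nodes N"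
  using i by auto

text \<open>\<open>strand\<close> sends every node of the stacked boxes to the edge of the stacked diagram its curve
  belongs to, and the nodes on the closed loop, if there is one, to the empty set.\<close>

private definition strand :: "node \<Rightarrow> node set" where
  "strand v =
     (if fst v = Middle then
        if snd v \<in> {i, Suc i} then (if f P = Q then {} else {f P, f Q})
        else {(North, snd v), g (North, snd v)}
      else {v, g v})"

private lemma strand_outer: "fst v \<noteq> Middle \<Longrightarrow> strand v = {v, g v}"
  by (simp add: strand_def)

private lemma strand_to_lower: "v \<noteq> P \<Longrightarrow> v \<noteq> Q \<Longrightarrow> v \<in> box_nodes N \<Longrightarrow> strand (to_lower v) = {v, g v}"
  by (cases v rule: to_lower.cases) (auto simp: strand_def)

private lemma g_other: "v \<noteq> P \<Longrightarrow> v \<noteq> Q \<Longrightarrow> f v \<noteq> P \<Longrightarrow> f v \<noteq> Q \<Longrightarrow> g v = f v"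
  by (simp add: tl_act_def)

private lemma g_fP: assumes "f P \<noteq> Q" shows "g (f P) = f Q" "g (f Q) = f P" "f P \<noteq> P" "f Q \<noteq> P" "f Q \<noteq> Q"
proof -
  show *: "f P \<noteq> P" "f Q \<noteq> P" "f Q \<noteq> Q"
    using PQ_in_box matching_fixed_iff[OF f] matching_swap[OF f, of Q P] assms by auto
  show "g (f P) = f Q" "g (f Q) = f P"
    using * assms by (auto simp: tl_act_def matching_invol[OF f])
qed

private lemma strand_lower_edge:
  assumes v: "v \<in> box_nodes N"
  shows "strand (to_lower v) = strand (to_lower (f v))"
proof -
  have fv: "f v \<in> box_nodes N" using v matching_in_box[OF f] by blast
  have sPQ: "strand (to_lower P) = (if f P = Q then {} else {f P, f Q})"
    "strand (to_lower Q) = (if f P = Q then {} else {f P, f Q})"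
    by (simp_all add: strand_def)
  have fPb: "f P \<in> box_nodes N" "f Q \<in> box_nodes N" using PQ_in_box matching_in_box[OF f] by blast+
  have P: "strand (to_lower P) = strand (to_lower (f P))"
  proof (cases "f P = Q")
    case True
    then show ?thesis using sPQ by simp
  next
    case False
    then show ?thesis using sPQ g_fP[OF False] strand_to_lower[of "f P"] fPb by auto
  qed
  have Q: "strand (to_lower Q) = strand (to_lower (f Q))"
  proof (cases "f P = Q")
    case True
    then have "f Q = P" using matching_swap[OF f] by metis
    then show ?thesis using sPQ by simp
  next
    case False
    then show ?thesis using sPQ g_fP[OF False] strand_to_lower[of "f Q"] fPb by auto
  qed
  consider "v = P" | "v = Q" | "f v = P" | "f v = Q" | "v \<noteq> P" "v \<noteq> Q" "f v \<noteq> P" "f v \<noteq> Q" by blast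
  then show ?thesis
  proof cases
    case 1 then show ?thesis using P by simp
  next
    case 2 then show ?thesis using Q by simp
  next
    case 3 then have "v = f P" using matching_swap[OF f] by metis
    then show ?thesis using P 3 by simp
  next
    case 4 then have "v = f Q" using matching_swap[OF f] by metis
    then show ?thesis using Q 4 by simp
  next
    case 5
    then have "g v = f v" "g (f v) = v"
      using matching_invol[OF f] by (simp_all add: g_other)
    then show ?thesis using 5 strand_to_lower v fv by auto
  qed
qed

private lemma upper_edges:
  "image to_upper ` D' =
     {{P, Q}, {(Middle, i), (Middle, Suc i)}} \<union>
     {{(North, j), (Middle, j)} | j. j \<in> {1..N} - {i, Suc i}}"
proof -
  have "image to_upper ` {{(North, j), (South, j)} | j. j \<in> {1..N} - {i, Suc i}} =
     {{(North, j), (Middle, j)} | j. j \<in> {1..N} - {i, Suc i}}"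
    by (simp add: setcompr_eq_image image_image)
  then show ?thesis by (simp add: simple_diagram_def image_Un)
qed

private lemma lower_edges: "image to_lower ` D = {{to_lower v, to_lower (f v)} | v. v \<in> box_nodes N}"
  by (simp add: diagram_of_def setcompr_eq_image image_image)

private lemma strand_link: "(u, v) \<in> links \<Longrightarrow> strand u = strand v"
proof -
  assume "(u, v) \<in> links"
  then have "{u, v} \<in> image to_upper ` D' \<or> {u, v} \<in> image to_lower ` D" by (simp add: links_def)
  then show ?thesis
  proof
    assume "{u, v} \<in> image to_upper ` D'"
    then consider "{u, v} = {P, Q}" | "{u, v} = {(Middle, i), (Middle, Suc i)}"
      | j where "j \<in> {1..N} - {i, Suc i}" "{u, v} = {(North, j), (Middle, j)}"
      unfolding upper_edges by blast
    then show ?thesis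
    proof cases
      case 1
      have "strand P = strand Q" by (simp add: strand_def insert_commute)
      with 1 show ?thesis by (metis doubleton_eq_iff)
    next
      case 2
      have "strand (Middle, i) = strand (Middle, Suc i)" by (simp add: strand_def)
      with 2 show ?thesis by (metis doubleton_eq_iff)
    next
      case 3
      have "strand (North, j) = strand (Middle, j)" using 3(1) by (simp add: strand_def)
      with 3(2) show ?thesis by (metis doubleton_eq_iff)
    qed
  next
    assume "{u, v} \<in> image to_lower ` D"
    then obtain w where "w \<in> box_nodes N" "{u, v} = {to_lower w, to_lower (f w)}"
      unfolding lower_edges by blast
    then show ?thesis using strand_lower_edge[of w] by (auto simp: doubleton_eq_iff)
  qed
qed

text \<open>The upper bound for connectivity: an invariant that is constant along curves keeps
  different curves apart.\<close>

private lemma strand_connected: "(u, v) \<in> links\<^sup>* \<Longrightarrow> strand u = strand v"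
  by (induction rule: rtrancl_induct) (auto dest: strand_link)

private lemma connected_to_lower:
  assumes "v \<in> box_nodes N" "v \<noteq> P" "v \<noteq> Q"
  shows "(v, to_lower v) \<in> links\<^sup>*"
proof (cases v rule: to_lower.cases)
  case (1 j)
  then have "(v, to_lower v) \<in> links" using assms unfolding links_def upper_edges by auto
  then show ?thesis by blast
qed (use assms in auto)

private lemma connected_lower_edge:
  "v \<in> box_nodes N \<Longrightarrow> (to_lower v, to_lower (f v)) \<in> links\<^sup>*"
  unfolding links_def lower_edges by blast

private lemma connected_cap: "((Middle, i), (Middle, Suc i)) \<in> links\<^sup>*"
  unfolding links_def upper_edges by auto

text \<open>The lower bound: follow the curve from \<open>v\<close>. If it reaches the box of d_i
  from below in column \<open>i\<close> or \<open>Suc i\<close>, the lower arc of d_i sends it back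
  down in the other column.\<close>

private lemma connected_g:
  assumes v: "v \<in> box_nodes N"
  shows "(v, g v) \<in> links\<^sup>*"
proof -
  have fPb: "f P \<in> box_nodes N" "f Q \<in> box_nodes N" using PQ_in_box matching_in_box[OF f] by blast+
  have PQ: "(f P, f Q) \<in> links\<^sup>*" if "f P \<noteq> Q"
  proof -
    have "(f P, to_lower (f P)) \<in> links\<^sup>*" "(to_lower (f Q), f Q) \<in> links\<^sup>*"
      using connected_to_lower[of "f P"] sym_connected[OF connected_to_lower[of "f Q"]]
        fPb g_fP[OF that] that by auto
    moreover have "(to_lower (f P), to_lower P) \<in> links\<^sup>*" "(to_lower Q, to_lower (f Q)) \<in> links\<^sup>*"
      using connected_lower_edge PQ_in_box by (blast intro: sym_connected)+
    ultimately show ?thesis using connected_cap by (auto intro: rtrancl_trans)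
  qed
  have cup: "(P, Q) \<in> links\<^sup>*" unfolding links_def upper_edges by auto
  consider "v = P" | "v = Q" | "v \<noteq> P" "v \<noteq> Q" "f v = P" | "v \<noteq> P" "v \<noteq> Q" "f v = Q"
    | "v \<noteq> P" "v \<noteq> Q" "f v \<noteq> P" "f v \<noteq> Q" by blast
  then show ?thesis
  proof cases
    case 1 then show ?thesis using cup by simp
  next
    case 2 then show ?thesis using cup sym_connected by simp
  next
    case 3
    then have "v = f P" using matching_swap[OF f] by metis
    with 3 PQ show ?thesis by (auto simp: g_fP)
  next
    case 4
    then have *: "v = f Q" using matching_swap[OF f] by metis
    with 4 have "f P \<noteq> Q" using matching_swap[OF f, of P Q] by auto
    with * PQ show ?thesis by (auto simp: g_fP intro: sym_connected)
  next
    case 5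
    have fv: "f v \<in> box_nodes N" using v matching_in_box[OF f] by blast
    have "(v, to_lower v) \<in> links\<^sup>*" "(to_lower (f v), f v) \<in> links\<^sup>*"
      using connected_to_lower[of v] sym_connected[OF connected_to_lower[of "f v"]] fv v 5 by auto
    with connected_lower_edge[OF v] show ?thesis
      using 5 by (auto simp: g_other intro: rtrancl_trans)
  qed
qed

lemma stack_simple_diagram: "stack D' D = diagram_of N g"
proof
  show "stack D' D \<subseteq> diagram_of N g"
  proof
    fix e assume "e \<in> stack D' D"
    then obtain u v where e: "e = {u, v}" "u \<noteq> v" "fst u \<noteq> Middle" "fst v \<noteq> Middle" "(u, v) \<in> links\<^sup>*"
      unfolding stack_def connected_eq by blast
    then have "{u, g u} = {v, g v}" using strand_connected strand_outer by metis
    with e(2) have v: "v = g u" by (auto simp: doubleton_eq_iff)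
    then have "u \<in> box_nodes N" using e(2) matching_fixed_iff[OF g] by metis
    then show "e \<in> diagram_of N g" unfolding e(1) v diagram_of_def by blast
  qed
  show "diagram_of N g \<subseteq> stack D' D"
  proof
    fix e assume "e \<in> diagram_of N g"
    then obtain v where v: "v \<in> box_nodes N" "e = {v, g v}" unfolding diagram_of_def by blast
    moreover have "fst w \<noteq> Middle" if "w \<in> box_nodes N" for w
      using that by (auto simp: box_nodes_def)
    moreover have "v \<noteq> g v" using v matching_fixed_iff[OF g] by metis
    ultimately show "e \<in> stack D' D"
      using connected_g matching_in_box[OF g] unfolding stack_def connected_eq by blast
  qed
qed

text \<open>A middle node outside the columns \<open>i\<close> and \<open>Suc i\<close> is joined to
  the north node above it, so only the component of the lower arc of d_i can stay in the middle. It
  does so exactly if \<open>f\<close> joins the two ends of this arc.\<close>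

lemma loops_simple_diagram: "loops N D' D = tl_loop i f"
proof -
  define K where "K k = links\<^sup>* `` {(Middle, k)}" for k
  let ?M = "{Middle} \<times> (UNIV :: nat set)"
  have outer: "k \<in> {i, Suc i}" if "k \<in> {1..N}" "K k \<subseteq> ?M" for k
  proof (rule ccontr)
    assume "k \<notin> {i, Suc i}"
    then have "((Middle, k), (North, k)) \<in> links\<^sup>*"
      using sym_connected[OF connected_to_lower[of "(North, k)"]] that by simp
    then show False using that(2) by (auto simp: K_def)
  qed
  have "K (Suc i) = K i"
    using rtrancl_trans[OF connected_cap] rtrancl_trans[OF sym_connected[OF connected_cap]]
    unfolding K_def by blast
  then have K: "K k = K i" if "k \<in> {1..N}" "K k \<subseteq> ?M" for k
    using outer[OF that] by auto
  have "loops N D' D = card {C. C \<subseteq> ?M \<and> (\<exists>k\<in>{1..N}. C = K k)}"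
    unfolding loops_def connected_eq K_def ..
  also have "{C. C \<subseteq> ?M \<and> (\<exists>k\<in>{1..N}. C = K k)} = {C. C \<subseteq> ?M \<and> C = K i}"
  proof (intro Collect_cong conj_cong HOL.refl iffI)
    fix C assume "C \<subseteq> ?M" "\<exists>k\<in>{1..N}. C = K k"
    then show "C = K i" using K by metis
  next
    fix C assume "C = K i"
    moreover have "i \<in> {1..N}" using i by simp
    ultimately show "\<exists>k\<in>{1..N}. C = K k" by (rule bexI)
  qed
  finally have loops: "loops N D' D = card {C. C \<subseteq> ?M \<and> C = K i}" .
  show ?thesis
  proof (cases "f P = Q")
    case True
    have "fst v = Middle" if "((Middle, i), v) \<in> links\<^sup>*" for v
    proof (rule ccontr)
      assume "fst v \<noteq> Middle"
      then have "strand v \<noteq> {}" by (simp add: strand_outer)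
      moreover have "strand (Middle, i) = {}" using True by (simp add: strand_def)
      ultimately show False using strand_connected[OF that] by simp
    qed
    then have "K i \<subseteq> ?M" by (auto simp: K_def mem_Times_iff)
    then have "{C. C \<subseteq> ?M \<and> C = K i} = {K i}" by auto
    then show ?thesis using True by (simp add: loops tl_loop_def)
  next
    case False
    have "((Middle, i), to_lower (f P)) \<in> links\<^sup>*"
      using connected_lower_edge[OF PQ_in_box(1)] by simp
    moreover have "(to_lower (f P), f P) \<in> links\<^sup>*"
      using sym_connected[OF connected_to_lower[of "f P"]] PQ_in_box matching_in_box[OF f]
        g_fP[OF False] False by blast
    ultimately have "((Middle, i), f P) \<in> links\<^sup>*" by (rule rtrancl_trans)
    then have "f P \<in> K i" by (simp add: K_def)
    moreover have "f P \<notin> ?M"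
      using PQ_in_box(1) matching_in_box[OF f, of P] by (auto simp: box_nodes_def)
    ultimately have "{C. C \<subseteq> ?M \<and> C = K i} = {}" by blast
    then show ?thesis using False by (simp only: loops tl_loop_def card.empty if_False)
  qed
qed

end

section \<open>Words as a power of \<delta> times a single diagram\<close>

lemma tl_mult_scale: "tl_mult N x (\<lambda>E. c * y E) = (\<lambda>E. c * tl_mult N x y E)"
  by (simp add: tl_mult_def sum_distrib_left algebra_simps)

lemma tl_mult_simple_diagram:
  assumes "diagram_map N f" "i \<in> {1..<N}"
  shows "tl_mult N (basis (simple_diagram N i)) (basis (diagram_of N f)) =
    (\<lambda>E. delta ^ tl_loop i f * basis (diagram_of N (tl_act i f)) E)"
proof -
  have m: "matching N f" using assms by (simp add: diagram_map_def)
  have "simple_diagram N i \<in> diagrams N"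
    using assms(2) by (simp add: simple_diagram_eq diagram_of_in_diagrams diagram_map_tl_act diagram_map_vertical)
  then show ?thesis
    using assms m
    by (simp add: tl_mult_basis diagram_of_in_diagrams stack_simple_diagram loops_simple_diagram)
qed

text \<open>The last letter acts first, and on an arbitrary \<open>f\<close>: a relation applied
  inside a word acts on the diagram of the suffix, not on the identity diagram.\<close>

primrec act_word :: "nat list \<Rightarrow> (node \<Rightarrow> node) \<Rightarrow> node \<Rightarrow> node" where
  "act_word [] f = f"
| "act_word (i # u) f = tl_act i (act_word u f)"

primrec loop_word :: "nat list \<Rightarrow> (node \<Rightarrow> node) \<Rightarrow> nat" where
  "loop_word [] f = 0"
| "loop_word (i # u) f = loop_word u f + tl_loop i (act_word u f)"

lemma act_word_append [simp]: "act_word (u @ v) f = act_word u (act_word v f)"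
  by (induction u) auto

lemma loop_word_append [simp]: "loop_word (u @ v) f = loop_word v f + loop_word u (act_word v f)"
  by (induction u) auto

lemma diagram_map_act_word:
  "diagram_map N f \<Longrightarrow> u \<in> lists {1..<N} \<Longrightarrow> diagram_map N (act_word u f)"
  by (induction u) (auto intro: diagram_map_tl_act)

lemma matching_act_word:
  "matching N f \<Longrightarrow> u \<in> lists {1..<N} \<Longrightarrow> matching N (act_word u f)"
  by (induction u) (auto intro: matching_tl_act)

text \<open>A simple diagram sends a multiple of a basis element to a multiple of a basis element,
  so sums in the algebra can be forgotten from here on in favour of \<open>loop_word\<close> and
  \<open>act_word\<close>.\<close>

lemma word_diagram_eq:
  assumes "u \<in> lists {1..<N}"
  shows "word_diagram N u = (\<lambda>E. delta ^ loop_word u (vertical N) *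
    basis (diagram_of N (act_word u (vertical N))) E)"
  using assms
proof (induction u)
  case Nil
  show ?case by (simp add: word_diagram_def id_diagram_eq)
next
  case (Cons i u)
  have "word_diagram N (i # u) = tl_mult N (basis (simple_diagram N i)) (word_diagram N u)"
    by (simp add: word_diagram_def)
  also have "\<dots> = (\<lambda>E. delta ^ loop_word u (vertical N) * (delta ^ tl_loop i (act_word u (vertical N)) *
      basis (diagram_of N (act_word (i # u) (vertical N))) E))"
    using Cons
    by (simp add: tl_mult_scale tl_mult_simple_diagram diagram_map_act_word diagram_map_vertical)
  finally show ?case by (simp add: power_add mult.assoc)
qed

section \<open>Alternating words and their diagrams\<close>

lemma distinct_adj_Cons_filterD:
  "distinct_adj (a # filter P u) \<Longrightarrow> filter P u = [] \<or> P (hd (filter P u)) \<and> hd (filter P u) \<noteq> a"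
  by (cases "filter P u") (auto simp: filter_eq_Cons_iff)

text \<open>In an alternating word strands never change their horizontal direction.\<close>

lemma north_partner_side:
  assumes "alternating u" "u \<in> lists {1..<N}" "j < N"
  shows "case filter (\<lambda>x. x = j \<or> x = Suc j) u of
      [] \<Rightarrow> act_word u (vertical N) (North, Suc j) = (South, Suc j)
    | x # _ \<Rightarrow> if x = j then snd (act_word u (vertical N) (North, Suc j)) \<le> j
        else snd (act_word u (vertical N) (North, Suc j)) > Suc j"
    (is "?side u j")
    and "\<And>i u'. u = i # u' \<Longrightarrow> snd (act_word u' (vertical N) (North, i)) \<le> i \<and>
      Suc i \<le> snd (act_word u' (vertical N) (North, Suc i))"
proof -
  \<comment> \<open>After the head \<open>i\<close>, alternation lets the projection to
    \<open>i - 1\<close>, \<open>i\<close> continue only with \<open>i - 1\<close>, and the one to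
    \<open>i\<close>, \<open>Suc i\<close> only with \<open>Suc i\<close>. Hence the strands at the
    two nodes to be joined never run towards each other.\<close>
  have step: "snd (act_word u (vertical N) (North, i)) \<le> i \<and>
      Suc i \<le> snd (act_word u (vertical N) (North, Suc i))"
    if side: "\<And>j. j < N \<Longrightarrow> ?side u j" and alt: "alternating (i # u)" and i: "i \<in> {1..<N}" for i u
  proof
    obtain k where k: "i = Suc k" using i by (cases i) auto
    have "distinct_adj (i # filter (\<lambda>x. x = k \<or> x = Suc k) u)"
      using alt k unfolding alternating_def by (auto dest: spec[of _ k])
    then have "filter (\<lambda>x. x = k \<or> x = Suc k) u = [] \<or> hd (filter (\<lambda>x. x = k \<or> x = Suc k) u) = k"
      using k by (auto dest: distinct_adj_Cons_filterD)
    then show "snd (act_word u (vertical N) (North, i)) \<le> i"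
      using side[of k] i k by (auto split: list.splits if_splits)
    have "distinct_adj (i # filter (\<lambda>x. x = i \<or> x = Suc i) u)"
      using alt unfolding alternating_def by (auto dest: spec[of _ i])
    then have "filter (\<lambda>x. x = i \<or> x = Suc i) u = [] \<or> hd (filter (\<lambda>x. x = i \<or> x = Suc i) u) = Suc i"
      by (auto dest: distinct_adj_Cons_filterD)
    then show "Suc i \<le> snd (act_word u (vertical N) (North, Suc i))"
      using side[of i] i by (auto split: list.splits if_splits)
  qed
  have all: "?side u j" if "alternating u" "u \<in> lists {1..<N}" "j < N" for u j
    using that
  proof (induction u arbitrary: j)
    case Nil
    then show ?case by (simp add: vertical_def)
  next
    case (Cons i u)
    let ?f = "act_word u (vertical N)"
    have i: "i \<in> {1..<N}" and u: "u \<in> lists {1..<N}" using Cons.prems by auto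
    have IH: "?side u j" if "j < N" for j
      using Cons.IH[OF alternating_ConsD[OF Cons.prems(1)] u that] .
    note dir = step[OF IH Cons.prems(1) i]
    have inv: "?f v = w \<longleftrightarrow> v = ?f w" for v w
      using matching_swap[OF matching_act_word[OF matching_vertical u]] .
    \<comment> \<open>North node \<open>Suc j\<close> is touched by the letters \<open>j\<close> and
      \<open>Suc j\<close> only; for these two its new partner is the adjacent north node.\<close>
    consider "Suc j = i" | "j = i" | "Suc j \<noteq> i" "j \<noteq> i" by blast
    then show ?case
    proof cases
      \<comment> \<open>The letter \<open>i\<close> does not touch node \<open>Suc j\<close>, but
        may lengthen its strand. A strand that ended at \<open>i\<close> came from the left and goes
        on to the right; one that ended at \<open>Suc i\<close> came from the right and goes on to
        the left.\<close>
      case 3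
      have flt: "filter (\<lambda>x. x = j \<or> x = Suc j) (i # u) = filter (\<lambda>x. x = j \<or> x = Suc j) u"
        using 3 by auto
      consider (P) "?f (North, Suc j) = (North, i)" | (Q) "?f (North, Suc j) = (North, Suc i)"
        | (none) "?f (North, Suc j) \<noteq> (North, i)" "?f (North, Suc j) \<noteq> (North, Suc i)" by blast
      then show ?thesis
      proof cases
        case P
        then have "Suc j \<le> i" using dir inv by (metis snd_conv)
        then show ?thesis
          using IH[OF Cons.prems(3)] dir P 3 unfolding flt
          by (auto simp: tl_act_def split: list.splits if_splits)
      next
        case Q
        then have "Suc i \<le> Suc j" using dir inv by (metis snd_conv)
        then show ?thesis
          using IH[OF Cons.prems(3)] dir Q 3 unfolding flt
          by (auto simp: tl_act_def split: list.splits if_splits)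
      next
        case none
        then show ?thesis
          using IH[OF Cons.prems(3)] 3 unfolding flt
          by (auto simp: tl_act_def split: list.splits if_splits)
      qed
    qed auto
  qed
  show "?side u j" by (rule all[OF assms])
  show "snd (act_word u' (vertical N) (North, i)) \<le> i \<and>
      Suc i \<le> snd (act_word u' (vertical N) (North, Suc i))" if "u = i # u'" for i u'
    using assms that by (intro step all) (auto dest: alternating_ConsD)
qed

text \<open>A loop at \<open>i\<close> would need a strand from north \<open>i\<close> to the right,
  while alternation sends it to the left or straight down.\<close>

lemma loop_word_alternating:
  assumes "alternating u" "u \<in> lists {1..<N}"
  shows "loop_word u (vertical N) = 0"
  using assms
proof (induction u)
  case (Cons i u)
  then have "0 < N" by auto
  then have "snd (act_word u (vertical N) (North, i)) \<le> i"
    using north_partner_side(2)[OF Cons.prems] by blast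
  then show ?case using Cons by (auto simp: tl_loop_def dest: alternating_ConsD)
qed simp

text \<open>Every edge that crosses the vertical line between the columns \<open>j\<close> and \<open>j + 1\<close> is counted
  twice, once from each end.  As a letter \<open>j\<close> adds two such edges, it contributes \<open>4\<close>.\<close>

definition crossings :: "nat \<Rightarrow> nat \<Rightarrow> (node \<Rightarrow> node) \<Rightarrow> nat" where
  "crossings N j f = (\<Sum>v\<in>box_nodes N. of_bool ((snd v \<le> j) \<noteq> (snd (f v) \<le> j)))"

text \<open>Under the side conditions the merged edge runs through the two old edges and the gap
  from \<open>i\<close> to \<open>Suc i\<close> without turning back. So nothing changes unless
  \<open>j = i\<close>; then the old edges stay on their sides, while the merged edge and the new
  arc both cross, each counted from both ends.\<close>

lemma crossings_tl_act:
  assumes f: "matching N f" and i: "i \<in> {1..<N}"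
    and side: "snd (f (North, i)) \<le> i" "Suc i \<le> snd (f (North, Suc i))"
  shows "crossings N j (tl_act i f) = crossings N j f + (if i = j then 4 else 0)"
proof -
  define P Q where PQ: "P = (North, i)" "Q = (North, Suc i)"
  let ?g = "tl_act i f" and ?X = "{P, Q, f P, f Q}"
  let ?c = "\<lambda>f v. of_bool ((snd v \<le> j) \<noteq> (snd (f v) \<le> j)) :: nat"
  have inv: "f (f v) = v" for v by (rule matching_invol[OF f])
  have box: "P \<in> box_nodes N" "Q \<in> box_nodes N" using i by (auto simp: PQ)
  then have X: "?X \<subseteq> box_nodes N" using matching_in_box[OF f] by auto
  have ne: "P \<noteq> Q" "f P \<noteq> P" "f Q \<noteq> Q" "f P \<noteq> Q" "f Q \<noteq> P" "f P \<noteq> f Q"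
    using box matching_fixed_iff[OF f] matching_eq_iff[OF f] side by (auto simp: PQ)
  have sp: "snd P = i" "snd Q = Suc i" "snd (f P) \<le> i" "Suc i \<le> snd (f Q)"
    using side by (simp_all add: PQ)
  have g: "?g P = Q" "?g Q = P" "?g (f P) = f Q" "?g (f Q) = f P"
    using ne by (auto simp: tl_act_def PQ[symmetric] inv)
  have rest: "?g v = f v" if "v \<notin> ?X" for v
  proof -
    have "f v \<noteq> P" "f v \<noteq> Q" using that inv[of v] by auto
    then show ?thesis using that by (auto simp: tl_act_def PQ[symmetric])
  qed
  have split: "(\<Sum>v\<in>box_nodes N. h v) = (\<Sum>v\<in>?X. h v) + (\<Sum>v\<in>box_nodes N - ?X. h v)"
    for h :: "node \<Rightarrow> nat"
    using X sum.subset_diff[of ?X "box_nodes N" h] by (simp add: box_nodes_def add.commute)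
  have "(\<Sum>v\<in>box_nodes N - ?X. ?c ?g v) = (\<Sum>v\<in>box_nodes N - ?X. ?c f v)"
    using rest by (intro sum.cong) auto
  moreover have "(\<Sum>v\<in>?X. ?c ?g v) = (\<Sum>v\<in>?X. ?c f v) + (if i = j then 4 else 0)"
  proof -
    have X_sum: "sum h ?X = h P + h Q + h (f P) + h (f Q)" for h :: "node \<Rightarrow> nat"
      using ne by (auto simp: add.assoc)
    show ?thesis unfolding X_sum g inv sp using sp by auto
  qed
  ultimately show ?thesis unfolding crossings_def split[of "?c ?g"] split[of "?c f"] by simp
qed

lemma crossings_alternating:
  assumes "alternating u" "u \<in> lists {1..<N}"
  shows "crossings N j (act_word u (vertical N)) = 4 * count_list u j"
  using assms
proof (induction u)
  case Nil
  have "snd (vertical N v) = snd v" for v by (simp add: vertical_def)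
  then show ?case by (simp add: crossings_def)
next
  case (Cons i u)
  then have "0 < N" by auto
  then have "snd (act_word u (vertical N) (North, i)) \<le> i \<and>
      Suc i \<le> snd (act_word u (vertical N) (North, Suc i))"
    using north_partner_side(2)[OF Cons.prems] by blast
  then show ?case
    using Cons alternating_ConsD[OF Cons.prems(1)]
    by (simp add: crossings_tl_act matching_act_word matching_vertical)
qed

lemma distinct_adj_two_letters_eq:
  assumes "distinct_adj xs" "distinct_adj ys" "set xs \<subseteq> {a, b}" "set ys \<subseteq> {a, b}"
    "length xs = length ys" "xs \<noteq> [] \<Longrightarrow> hd xs = hd ys"
  shows "xs = ys"
  using assms
proof (induction xs arbitrary: ys)
  case (Cons x xs)
  then obtain ys' where ys: "ys = x # ys'" by (cases ys) auto
  have "xs = ys'"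
  proof (rule Cons.IH)
    show "hd xs = hd ys'" if "xs \<noteq> []"
      using that Cons.prems by (cases xs; cases ys') (auto simp: ys)
  qed (use Cons.prems in \<open>auto simp: ys dest: distinct_adj_ConsD\<close>)
  then show ?case by (simp add: ys)
qed simp

lemma length_filter_two_letters:
  "a \<noteq> b \<Longrightarrow> length (filter (\<lambda>x. x = a \<or> x = b) u) = count_list u a + count_list u b"
  by (induction u) auto

text \<open>An alternating sequence in two letters is fixed by its length and its head. The length
  comes from \<open>crossings\<close>, the head from the side on which the partner of north
  \<open>Suc j\<close> lies.\<close>

lemma alternating_comm_equiv:
  assumes u: "alternating u" "u \<in> lists {1..<N}" and v: "alternating v" "v \<in> lists {1..<N}"
    and eq: "act_word u (vertical N) = act_word v (vertical N)"
  shows "u \<sim>\<^sub>c v"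
proof (rule comm_equiv_if_filters_eq)
  fix j
  let ?F = "filter (\<lambda>x. x = j \<or> x = Suc j)"
  show "?F u = ?F v"
  proof (cases "j < N")
    case False
    then have "?F u = []" "?F v = []"
      using assms by (auto simp: filter_empty_conv in_lists_conv_set)
    then show ?thesis by simp
  next
    case True
    have cnt: "count_list u k = count_list v k" for k
      using crossings_alternating[OF u, of k] crossings_alternating[OF v, of k] eq by simp
    have len: "length (?F u) = length (?F v)"
      by (simp add: length_filter_two_letters cnt)
    show ?thesis
    proof (rule distinct_adj_two_letters_eq[OF _ _ _ _ len])
      assume "?F u \<noteq> []"
      then obtain x xs where x: "?F u = x # xs" by (cases "?F u") auto
      with len obtain y ys where y: "?F v = y # ys" by (cases "?F v") auto
      have "x \<in> set (?F u)" "y \<in> set (?F v)" by (simp_all only: x y) simp_all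
      then have "x = j \<or> x = Suc j" "y = j \<or> y = Suc j" by auto
      then show "hd (?F u) = hd (?F v)"
        using north_partner_side(1)[OF u True] north_partner_side(1)[OF v True] eq
        by (auto simp: x y split: if_splits)
    qed (use u v in \<open>auto simp: alternating_def\<close>)
  qed
qed

section \<open>Fully commutative elements of type \<open>A\<close>\<close>

lemma expression_iff: "expression m S w u \<longleftrightarrow> u \<in> lists S \<and> cox_class m S u = w"
  unfolding expression_def by (metis cox_prod_eq)

lemma reduced_expression_iff:
  "reduced_expression m S w u \<longleftrightarrow> u \<in> lists S \<and> cox_class m S u = w \<and>
     (\<forall>v\<in>lists S. cox_cong m S u v \<longrightarrow> length u \<le> length v)"
  unfolding reduced_expression_def expression_iff
  by (metis cox_class_eq_iff)

lemma reduced_expression_cong: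
  "reduced_expression m S w u \<Longrightarrow> reduced_expression m S w v \<Longrightarrow> cox_cong m S u v"
  unfolding reduced_expression_iff using cox_class_eq_iff by metis

lemma ex_reduced_expression:
  assumes "w \<in> carrier (coxeter_group m S)"
  shows "\<exists>u. reduced_expression m S w u"
proof -
  from assms obtain u where "expression m S w u"
    by (auto simp: coxeter_group_def expression_iff)
  then show ?thesis
    using arg_min_nat_lemma[of "expression m S w" u length]
    unfolding reduced_expression_def by blast
qed

context
  fixes m :: "nat \<Rightarrow> nat \<Rightarrow> nat" and S :: "nat set"
  assumes diag: "\<And>s. s \<in> S \<Longrightarrow> m s s = 1"
begin

lemma cox_cong_cancel:
  assumes "p \<in> lists S" "q \<in> lists S" "s \<in> S"
  shows "cox_cong m S (p @ [s, s] @ q) (p @ q)"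
  using cox_cong.relator[of p S q s s m] assms diag by simp

lemma cox_cong_commute:
  assumes "p \<in> lists S" "q \<in> lists S" "s \<in> S" "t \<in> S" "m s t = 2"
  shows "cox_cong m S (p @ [s, t] @ q) (p @ [t, s] @ q)"
proof -
  \<comment> \<open>The word (st)^2 ts is evaluated twice: the relator leaves ts, while cancelling
    tt and then ss leaves st.\<close>
  have "cox_cong m S ([] @ concat (replicate (m s t) [s, t]) @ [t, s]) ([] @ [t, s])"
    by (rule cox_cong.relator) (use assms in auto)
  then have "cox_cong m S [s, t, s, t, t, s] [t, s]"
    using assms(5) by (simp add: numeral_2_eq_2)
  moreover have "cox_cong m S ([s, t, s] @ [t, t] @ [s]) ([s, t, s] @ [s])"
    by (rule cox_cong_cancel) (use assms in auto)
  moreover have "cox_cong m S ([s, t] @ [s, s] @ []) ([s, t] @ [])"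
    by (rule cox_cong_cancel) (use assms in auto)
  ultimately have "cox_cong m S [s, t] [t, s]"
    by simp (meson cox_cong.sym cox_cong.trans)
  then show ?thesis using assms by (intro cox_cong_context) auto
qed

lemma cox_cong_braid:
  assumes "p \<in> lists S" "q \<in> lists S" "s \<in> S" "t \<in> S" "m s t = 3"
  shows "cox_cong m S (p @ [s, t, s] @ q) (p @ [t, s, t] @ q)"
proof -
  \<comment> \<open>The same device: (st)^3 tst becomes tst by the relator, and sts by cancelling
    tt, ss, tt from the inside.\<close>
  have "cox_cong m S ([] @ concat (replicate (m s t) [s, t]) @ [t, s, t]) ([] @ [t, s, t])"
    by (rule cox_cong.relator) (use assms in auto)
  then have "cox_cong m S [s, t, s, t, s, t, t, s, t] [t, s, t]"
    using assms(5) by (simp add: numeral_3_eq_3)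
  moreover have "cox_cong m S ([s, t, s, t, s] @ [t, t] @ [s, t]) ([s, t, s, t, s] @ [s, t])"
    by (rule cox_cong_cancel) (use assms in auto)
  moreover have "cox_cong m S ([s, t, s, t] @ [s, s] @ [t]) ([s, t, s, t] @ [t])"
    by (rule cox_cong_cancel) (use assms in auto)
  moreover have "cox_cong m S ([s, t, s] @ [t, t] @ []) ([s, t, s] @ [])"
    by (rule cox_cong_cancel) (use assms in auto)
  ultimately have "cox_cong m S [s, t, s] [t, s, t]"
    by simp (meson cox_cong.sym cox_cong.trans)
  then show ?thesis using assms by (intro cox_cong_context) auto
qed

lemma cox_cong_commutation_steps:
  assumes "(commutation_step m)\<^sup>*\<^sup>* u v" "u \<in> lists S"
  shows "cox_cong m S u v"
  using assms
proof (induction rule: rtranclp_induct)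
  case base
  then show ?case by (rule cox_cong.refl)
next
  case (step v v')
  then have "cox_cong m S u v" by blast
  moreover from this have "v \<in> lists S" using cox_cong_lists by blast
  with step.hyps(2) have "cox_cong m S v v'"
    unfolding commutation_step_def by (auto intro!: cox_cong_commute[simplified])
  ultimately show ?case by (rule cox_cong.trans)
qed

lemma reduced_expression_no_repetition:
  assumes "reduced_expression m S w u" "(commutation_step m)\<^sup>*\<^sup>* u (p @ [c, c] @ q)"
  shows False
proof -
  have u: "u \<in> lists S" using assms(1) by (simp add: reduced_expression_iff)
  have uv: "cox_cong m S u (p @ [c, c] @ q)" using assms(2) u by (rule cox_cong_commutation_steps)
  then have v: "p @ [c, c] @ q \<in> lists S" using cox_cong_lists by blast
  then have "cox_cong m S (p @ [c, c] @ q) (p @ q)" by (intro cox_cong_cancel) auto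
  with uv have "cox_cong m S u (p @ q)" by (rule cox_cong.trans)
  moreover have "p @ q \<in> lists S" using v by auto
  ultimately have "length u \<le> length (p @ q)"
    using assms(1) unfolding reduced_expression_iff by blast
  moreover have "length u \<le> length (p @ [c, c] @ q) \<and> length (p @ [c, c] @ q) \<le> length u"
    using assms(2) by (induction rule: rtranclp_induct) (auto simp: commutation_step_def)
  ultimately show False by simp
qed

end

lemma cox_A_diag: "cox_A s s = 1" and cox_C_diag: "cox_C n s s = 1"
  by (simp_all add: cox_A_def cox_C_def)

section \<open>Diagrams under commutation and shortening of words\<close>

lemma act_word_comm_equiv:
  assumes "u \<sim>\<^sub>c v" "u \<in> lists {1..<N}" "matching N f"
  shows "act_word v f = act_word u f \<and> loop_word v f = loop_word u f"
  using assms
proof (induction rule: rtranclp_induct)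
  case (step v v')
  from step.hyps(2) obtain p q s t where st: "cox_A s t = 2"
    and v: "v = p @ [s, t] @ q" "v' = p @ [t, s] @ q"
    unfolding commutation_step_def by blast
  have "set v = set u" using comm_equiv_set[OF step.hyps(1)] by simp
  then have "v \<in> lists {1..<N}" using step.prems(1) by (auto simp: in_lists_conv_set)
  then have S: "s \<in> {1..<N}" "t \<in> {1..<N}" "q \<in> lists {1..<N}" by (auto simp: v)
  have m: "matching N (act_word q f)" using step.prems(2) S(3) by (rule matching_act_word)
  have "Suc s < t \<or> Suc t < s" using st by (auto simp: cox_A_eq_2_iff nbr_def)
  then have "tl_act t (tl_act s (act_word q f)) = tl_act s (tl_act t (act_word q f))"
    "tl_loop s (act_word q f) + tl_loop t (tl_act s (act_word q f)) =
     tl_loop t (act_word q f) + tl_loop s (tl_act t (act_word q f))"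
    using tl_act_commute[OF m S(1,2)] tl_act_commute[OF m S(2,1)] by auto
  then show ?case using step by (simp add: v)
qed simp

lemma act_word_fork:
  assumes "nbr c k" "c \<in> {1..<N}" "k \<in> {1..<N}" "q \<in> lists {1..<N}" "matching N f"
  shows "act_word (p @ [c, k, c] @ q) f = act_word (p @ [c] @ q) f"
    "loop_word (p @ [c, k, c] @ q) f = loop_word (p @ [c] @ q) f"
  using tl_act_braid[OF matching_act_word[OF assms(5,4)] assms(2,3)] assms(1)
  by (auto simp: nbr_def)

lemma act_word_repetition:
  "act_word (p @ [c, c] @ q) f = act_word (p @ [c] @ q) f"
  "loop_word (p @ [c, c] @ q) f = Suc (loop_word (p @ [c] @ q) f)"
  by (auto simp: tl_act_idem)

text \<open>Replacing \<open>[c, c]\<close> or \<open>[c, k, c]\<close> by \<open>[c]\<close> keeps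
  the diagram. The first replacement loses a loop, which does not matter here because lengths are
  the issue.\<close>

lemma shorten_not_alternating:
  assumes "u \<in> lists {1..<N}" "\<not> alternating u" "matching N f"
  shows "\<exists>v\<in>lists {1..<N}. length v < length u \<and> act_word v f = act_word u f"
proof -
  have "u \<in> lists {1..N}" using assms(1) by (auto simp: in_lists_conv_set)
  then obtain p c q where
    "u \<sim>\<^sub>c p @ [c, c] @ q \<or> (\<exists>k. nbr c k \<and> u \<sim>\<^sub>c p @ [c, k, c] @ q)"
    using not_alternating_comm_equiv assms(2) by blast
  then show ?thesis
  proof (elim disjE exE conjE)
    assume c: "u \<sim>\<^sub>c p @ [c, c] @ q"
    show ?thesis
    proof (intro bexI[of _ "p @ [c] @ q"] conjI)
      show "length (p @ [c] @ q) < length u" using comm_equiv_length[OF c] by simp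
      show "act_word (p @ [c] @ q) f = act_word u f"
        using act_word_comm_equiv[OF c assms(1,3)] act_word_repetition(1) by metis
      show "p @ [c] @ q \<in> lists {1..<N}"
        using comm_equiv_set[OF c] assms(1) by (auto simp: in_lists_conv_set)
    qed
  next
    fix k assume k: "nbr c k" and c: "u \<sim>\<^sub>c p @ [c, k, c] @ q"
    have S: "c \<in> {1..<N}" "k \<in> {1..<N}" "q \<in> lists {1..<N}" "p @ [c] @ q \<in> lists {1..<N}"
      using comm_equiv_set[OF c] assms(1) by (auto simp: in_lists_conv_set)
    show ?thesis
    proof (intro bexI[of _ "p @ [c] @ q"] conjI)
      show "length (p @ [c] @ q) < length u" using comm_equiv_length[OF c] by simp
      show "act_word (p @ [c] @ q) f = act_word u f"
        using act_word_comm_equiv[OF c assms(1,3)] act_word_fork(1)[OF k S(1-3) assms(3)] by metis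
    qed (rule S)
  qed
qed

lemma ex_alternating:
  assumes "u \<in> lists {1..<N}" "matching N f"
  shows "\<exists>v\<in>lists {1..<N}. alternating v \<and> length v \<le> length u \<and> act_word v f = act_word u f"
  using assms(1)
proof (induction "length u" arbitrary: u rule: less_induct)
  case less
  show ?case
  proof (cases "alternating u")
    case False
    then obtain v where v: "v \<in> lists {1..<N}" "length v < length u" "act_word v f = act_word u f"
      using shorten_not_alternating less.prems assms(2) by blast
    then obtain v' where "v' \<in> lists {1..<N}" "alternating v'" "length v' \<le> length v"
        "act_word v' f = act_word v f"
      using less.hyps by blast
    with v show ?thesis by (intro bexI[of _ v']) auto
  qed (use less.prems in blast)
qed

text \<open>Shortening any competitor ends in an alternating word with the same diagram, which is
  \<open>u\<close> up to commutations.\<close>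

lemma alternating_length_le:
  assumes "alternating u" "u \<in> lists {1..<N}" "v \<in> lists {1..<N}"
    "act_word v (vertical N) = act_word u (vertical N)"
  shows "length u \<le> length v"
proof -
  obtain v' where "v' \<in> lists {1..<N}" "alternating v'" "length v' \<le> length v"
      "act_word v' (vertical N) = act_word v (vertical N)"
    using ex_alternating assms(3) matching_vertical by blast
  then show ?thesis
    using alternating_comm_equiv[OF assms(1,2)] comm_equiv_length assms(4) by metis
qed

lemma comm_equiv_if_minimal:
  assumes "alternating u" "u \<in> lists {1..<N}" "v \<in> lists {1..<N}"
    "act_word v (vertical N) = act_word u (vertical N)" "length v \<le> length u"
  shows "u \<sim>\<^sub>c v"
proof -
  have "alternating v"
  proof (rule ccontr)
    assume "\<not> alternating v"
    then obtain v' where "v' \<in> lists {1..<N}" "length v' < length v"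
        "act_word v' (vertical N) = act_word v (vertical N)"
      using shorten_not_alternating assms(3) matching_vertical by blast
    then show False using alternating_length_le[OF assms(1,2)] assms(4,5) by fastforce
  qed
  then show ?thesis using alternating_comm_equiv assms by metis
qed

text \<open>Setting \<open>\<delta> = 2\<close>, the assignment \<open>s\<^sub>i \<mapsto> d\<^sub>i - 1\<close> is a representation of the Coxeter
  group of type \<open>A\<close>; \<open>dual_word\<close> is its action on functionals, which avoids sums of diagrams.\<close>

definition dual_act :: "nat \<Rightarrow> ((node \<Rightarrow> node) \<Rightarrow> int) \<Rightarrow> (node \<Rightarrow> node) \<Rightarrow> int" where
  "dual_act i \<phi> f = 2 ^ tl_loop i f * \<phi> (tl_act i f) - \<phi> f"

primrec dual_word :: "nat list \<Rightarrow> ((node \<Rightarrow> node) \<Rightarrow> int) \<Rightarrow> (node \<Rightarrow> node) \<Rightarrow> int" where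
  "dual_word [] \<phi> = \<phi>"
| "dual_word (i # u) \<phi> = dual_word u (dual_act i \<phi>)"

lemma dual_word_append [simp]: "dual_word (u @ v) \<phi> = dual_word v (dual_word u \<phi>)"
  by (induction u arbitrary: \<phi>) auto

text \<open>Restricted to matchings, where the diagram relations hold. All functionals are allowed,
  so that a prefix of the word can be absorbed into the functional.\<close>

definition dual_eq :: "nat \<Rightarrow> nat list \<Rightarrow> nat list \<Rightarrow> bool" where
  "dual_eq N u v \<longleftrightarrow> (\<forall>\<phi> f. matching N f \<longrightarrow> dual_word u \<phi> f = dual_word v \<phi> f)"

lemma dual_word_cong:
  assumes "\<And>f. matching N f \<Longrightarrow> \<phi> f = \<psi> f" "u \<in> lists {1..<N}" "matching N f"
  shows "dual_word u \<phi> f = dual_word u \<psi> f"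
  using assms
proof (induction u arbitrary: \<phi> \<psi>)
  case (Cons i u)
  have i: "i \<in> {1..<N}" and u: "u \<in> lists {1..<N}" using Cons.prems(2) by auto
  have "dual_word u (dual_act i \<phi>) f = dual_word u (dual_act i \<psi>) f"
  proof (rule Cons.IH[OF _ u Cons.prems(3)])
    fix h assume h: "matching N h"
    show "dual_act i \<phi> h = dual_act i \<psi> h"
      unfolding dual_act_def Cons.prems(1)[OF h] Cons.prems(1)[OF matching_tl_act[OF h i]] ..
  qed
  then show ?case by simp
qed simp

lemma dual_eq_context:
  assumes "dual_eq N u v" "q \<in> lists {1..<N}"
  shows "dual_eq N (p @ u @ q) (p @ v @ q)"
  unfolding dual_eq_def
proof (intro allI impI)
  fix \<phi> f assume "matching N f"
  then show "dual_word (p @ u @ q) \<phi> f = dual_word (p @ v @ q) \<phi> f"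
    using assms by simp (rule dual_word_cong, auto simp: dual_eq_def)
qed

lemma dual_eq_trans [trans]: "dual_eq N u v \<Longrightarrow> dual_eq N v w \<Longrightarrow> dual_eq N u w"
  by (simp add: dual_eq_def)

text \<open>(d_s - 1)^2 = d_s^2 - 2 d_s + 1, and d_s^2 = 2 d_s at \<delta> = 2.\<close>

lemma dual_eq_cancel:
  assumes "s \<in> {1..<N}"
  shows "dual_eq N [s, s] []"
  by (simp add: dual_eq_def dual_act_def tl_act_idem)

lemma dual_eq_commute:
  assumes "s \<in> {1..<N}" "t \<in> {1..<N}" "Suc s < t"
  shows "dual_eq N [s, t] [t, s]"
  unfolding dual_eq_def
proof (intro allI impI)
  fix \<phi> f assume f: "matching N f"
  note c = tl_act_commute[OF f assms]
  have "(2::int) ^ tl_loop t f * 2 ^ tl_loop s (tl_act t f) = 2 ^ tl_loop s f * 2 ^ tl_loop t (tl_act s f)"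
    by (simp only: power_add[symmetric] c(2))
  then show "dual_word [s, t] \<phi> f = dual_word [t, s] \<phi> f"
    by (simp add: dual_act_def c(1) right_diff_distrib)
qed

text \<open>With d_s^2 = 2 d_s and d_s d_t d_s = d_s, both sides expand to d_s + d_t - d_s d_t - d_t
  d_s - 1, which is symmetric in s and t.\<close>

lemma dual_eq_braid:
  assumes "s \<in> {1..<N}" "t \<in> {1..<N}" "nbr s t"
  shows "dual_eq N [s, t, s] [t, s, t]"
  unfolding dual_eq_def
proof (intro allI impI)
  fix \<phi> f assume f: "matching N f"
  have n: "t = Suc s \<or> s = Suc t" "s = Suc t \<or> t = Suc s" using assms(3) by (auto simp: nbr_def)
  show "dual_word [s, t, s] \<phi> f = dual_word [t, s, t] \<phi> f"
    by (simp add: dual_act_def tl_act_idem tl_act_braid[OF f assms(1,2) n(1)]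
        tl_act_braid[OF f assms(2,1) n(2)] algebra_simps)
qed

lemma dual_eq_relator:
  assumes "s \<in> {1..<N}" "t \<in> {1..<N}"
  shows "dual_eq N (concat (replicate (cox_A s t) [s, t])) []"
proof -
  consider "s = t" | "nbr s t" | "Suc s < t \<or> Suc t < s" unfolding nbr_def by linarith
  then show ?thesis
  proof cases
    case 1
    then show ?thesis using dual_eq_cancel assms by (simp add: cox_A_def)
  next
    case 2
    have "dual_eq N ([] @ [s, t, s] @ [t, s, t]) ([] @ [t, s, t] @ [t, s, t])"
      by (intro dual_eq_context dual_eq_braid) (use assms 2 in auto)
    also have "dual_eq N \<dots> ([t, s] @ [t, t] @ [s, t])"
      by (simp add: dual_eq_def)
    also have "dual_eq N \<dots> ([t, s] @ [] @ [s, t])"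
      by (intro dual_eq_context dual_eq_cancel) (use assms in auto)
    also have "dual_eq N \<dots> ([t] @ [s, s] @ [t])"
      by (simp add: dual_eq_def)
    also have "dual_eq N \<dots> ([t] @ [] @ [t])"
      by (intro dual_eq_context dual_eq_cancel) (use assms in auto)
    also have "dual_eq N \<dots> []"
      using dual_eq_cancel assms by simp
    finally show ?thesis using 2 by (auto simp: cox_A_def numeral_3_eq_3)
  next
    case 3
    have "dual_eq N [s, t] [t, s]"
      using 3 dual_eq_commute[of s N t] dual_eq_commute[of t N s] assms by (auto simp: dual_eq_def)
    then have "dual_eq N ([] @ [s, t] @ [s, t]) ([] @ [t, s] @ [s, t])"
      by (rule dual_eq_context) (use assms in auto)
    also have "dual_eq N \<dots> ([t] @ [s, s] @ [t])"
      by (simp add: dual_eq_def)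
    also have "dual_eq N \<dots> ([t] @ [] @ [t])"
      by (intro dual_eq_context dual_eq_cancel) (use assms in auto)
    also have "dual_eq N \<dots> []"
      using dual_eq_cancel assms by simp
    finally show ?thesis using 3 by (auto simp: cox_A_def nbr_def numeral_2_eq_2)
  qed
qed

lemma dual_eq_cox_cong: "cox_cong cox_A {1..<N} u v \<Longrightarrow> dual_eq N u v"
proof (induction rule: cox_cong.induct)
  case (relator u v s t)
  then show ?case using dual_eq_context[OF dual_eq_relator, of s N t v u] by simp
qed (auto simp: dual_eq_def)

text \<open>Expanding the product of the factors d_i - 1 gives the word itself and, with signs, its
  proper subwords, which \<phi> kills. Vanishing on all shorter words, not only on subwords, is a
  hypothesis that passes easily to \<open>dual_act i \<phi>\<close>.\<close>

lemma dual_word_leading: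
  assumes "\<And>s. s \<in> lists {1..<N} \<Longrightarrow> length s < length v \<Longrightarrow> \<phi> (act_word s f) = 0"
    and "v \<in> lists {1..<N}"
  shows "dual_word v \<phi> f = 2 ^ loop_word v f * \<phi> (act_word v f)"
  using assms
proof (induction v arbitrary: \<phi>)
  case (Cons i v)
  have "dual_word v (dual_act i \<phi>) f = 2 ^ loop_word v f * dual_act i \<phi> (act_word v f)"
  proof (rule Cons.IH)
    fix s assume s: "s \<in> lists {1..<N}" "length s < length v"
    then show "dual_act i \<phi> (act_word s f) = 0"
      using Cons.prems(1)[of s] Cons.prems(1)[of "i # s"] Cons.prems(2) by (simp add: dual_act_def)
  qed (use Cons.prems in auto)
  then show ?case
    using Cons.prems(1)[of v] Cons.prems(2) by (simp add: dual_act_def power_add)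
qed simp

text \<open>The functional picks the coefficient of the diagram of \<open>u\<close>. No word shorter
  than \<open>u\<close> has this diagram, so only leading terms count for \<open>u\<close> and for
  \<open>v\<close>. The two values agree and that of \<open>u\<close> is not 0, hence
  \<open>v\<close> has the same diagram.\<close>

lemma alternating_cox_cong:
  assumes u: "alternating u" "u \<in> lists {1..<N}"
    and uv: "cox_cong cox_A {1..<N} u v" and len: "length v \<le> length u"
  shows "u \<sim>\<^sub>c v"
proof -
  let ?g = "act_word u (vertical N)"
  define \<phi> where "\<phi> = (\<lambda>h. if h = ?g then 1 else (0::int))"
  have v: "v \<in> lists {1..<N}" using uv cox_cong_lists by blast
  have zero: "\<phi> (act_word s (vertical N)) = 0" if "s \<in> lists {1..<N}" "length s < length u" for s
    using alternating_length_le[OF u that(1)] that(2) by (auto simp: \<phi>_def)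
  have "dual_word u \<phi> (vertical N) = 2 ^ loop_word u (vertical N) * \<phi> ?g"
    using zero u(2) by (rule dual_word_leading)
  then have "dual_word u \<phi> (vertical N) \<noteq> 0" by (simp add: \<phi>_def)
  moreover have "dual_word u \<phi> (vertical N) = dual_word v \<phi> (vertical N)"
    using dual_eq_cox_cong[OF uv] matching_vertical by (simp add: dual_eq_def)
  moreover have "dual_word v \<phi> (vertical N) = 2 ^ loop_word v (vertical N) * \<phi> (act_word v (vertical N))"
    using zero len v by (intro dual_word_leading) auto
  ultimately have "act_word v (vertical N) = ?g" by (auto simp: \<phi>_def split: if_splits)
  then show ?thesis using comm_equiv_if_minimal u v len by blast
qed

lemma alternating_reduced_expression:
  assumes "alternating u" "u \<in> lists {1..<N}"
  shows "reduced_expression cox_A {1..<N} (cox_class cox_A {1..<N} u) u"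
  unfolding reduced_expression_iff
  using alternating_cox_cong[OF assms] comm_equiv_length assms(2) by (metis nle_le)

lemma alternating_FC:
  assumes "alternating u" "u \<in> lists {1..<N}"
  shows "cox_class cox_A {1..<N} u \<in> FC cox_A {1..<N}"
proof -
  let ?w = "cox_class cox_A {1..<N} u"
  have "u \<sim>\<^sub>c v" if v: "reduced_expression cox_A {1..<N} ?w v" for v
  proof (rule alternating_cox_cong[OF assms])
    show "cox_cong cox_A {1..<N} u v"
      using alternating_reduced_expression[OF assms] v by (rule reduced_expression_cong)
    show "length v \<le> length u"
      using alternating_reduced_expression[OF assms] v by (simp add: reduced_expression_def)
  qed
  then have "v \<sim>\<^sub>c v'"
    if "reduced_expression cox_A {1..<N} ?w v" "reduced_expression cox_A {1..<N} ?w v'" for v v'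
    using that comm_equiv_sym rtranclp_trans[of "commutation_step cox_A" v u v'] by blast
  then show ?thesis
    using assms(2) unfolding FC_def coxeter_group_def by auto
qed

text \<open>Provides an alternating word for every candidate in the definite description behind
  \<open>tau\<close>, so that candidates can be compared by their diagrams.\<close>

lemma FC_A_alternating:
  assumes "w \<in> FC cox_A {1..<N}" "reduced_expression cox_A {1..<N} w u"
  shows "alternating u"
proof (rule ccontr)
  assume n: "\<not> alternating u"
  have u: "u \<in> lists {1..<N}" using assms(2) by (simp add: reduced_expression_iff)
  then have "u \<in> lists {1..N}" by (auto simp: in_lists_conv_set)
  then obtain p c q where
    "u \<sim>\<^sub>c p @ [c, c] @ q \<or> (\<exists>k. nbr c k \<and> u \<sim>\<^sub>c p @ [c, k, c] @ q)"
    using not_alternating_comm_equiv n by blast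
  then show False
  proof (elim disjE exE conjE)
    assume "u \<sim>\<^sub>c p @ [c, c] @ q"
    then show False using reduced_expression_no_repetition[OF _ assms(2)] cox_A_diag by blast
  next
    fix k assume k: "nbr c k" and c: "u \<sim>\<^sub>c p @ [c, k, c] @ q"
    let ?v = "p @ [k, c, k] @ q"
    have S: "c \<in> {1..<N}" "k \<in> {1..<N}" "p \<in> lists {1..<N}" "q \<in> lists {1..<N}"
      using comm_equiv_set[OF c] u by (auto simp: in_lists_conv_set)
    have "cox_A c k = 3" using k by (auto simp: cox_A_def)
    then have "cox_cong cox_A {1..<N} (p @ [c, k, c] @ q) ?v"
      using S by (intro cox_cong_braid cox_A_diag) auto
    moreover have "cox_cong cox_A {1..<N} u (p @ [c, k, c] @ q)"
      using c u by (intro cox_cong_commutation_steps cox_A_diag)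
    ultimately have uv: "cox_cong cox_A {1..<N} u ?v" by (meson cox_cong.trans)
    have "reduced_expression cox_A {1..<N} w ?v"
      unfolding reduced_expression_iff
    proof (intro conjI ballI impI)
      show "?v \<in> lists {1..<N}" using uv cox_cong_lists by blast
      show "cox_class cox_A {1..<N} ?v = w"
        using uv assms(2) u by (metis cox_class_eq_iff reduced_expression_iff)
      fix x assume "x \<in> lists {1..<N}" "cox_cong cox_A {1..<N} ?v x"
      then have "length u \<le> length x"
        using uv assms(2) unfolding reduced_expression_iff by (meson cox_cong.trans)
      then show "length ?v \<le> length x" using comm_equiv_length[OF c] by simp
    qed
    then have "u \<sim>\<^sub>c ?v" using assms by (auto simp: FC_def)
    \<comment> \<open>Commutations preserve letter multiplicities, while the braid move trades a
      \<open>c\<close> for a \<open>k\<close>.\<close>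
    then have "mset (p @ [c, k, c] @ q) = mset ?v" using comm_equiv_mset c by metis
    then have "k = c" by (auto dest: arg_cong[of _ _ "\<lambda>M. count M k"] split: if_splits)
    then show False using k by simp
  qed
qed

section \<open>Heaps and their linear extensions\<close>

primrec before :: "'a list \<Rightarrow> 'a \<Rightarrow> 'a \<Rightarrow> bool" where
  "before [] x y \<longleftrightarrow> False"
| "before (z # zs) x y \<longleftrightarrow> x = z \<and> y \<in> set zs \<or> before zs x y"

lemma before_in_set: "before xs x y \<Longrightarrow> x \<in> set xs \<and> y \<in> set xs"
  by (induction xs) auto

lemma before_append [simp]:
  "before (xs @ ys) x y \<longleftrightarrow> before xs x y \<or> before ys x y \<or> x \<in> set xs \<and> y \<in> set ys"
  by (induction xs) auto

lemma before_filter [simp]: "before (filter P xs) x y \<longleftrightarrow> before xs x y \<and> P x \<and> P y"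
  by (induction xs) (auto dest: before_in_set)

lemma before_irrefl: "distinct xs \<Longrightarrow> \<not> before xs x x"
  by (induction xs) auto

lemma before_trans: "distinct xs \<Longrightarrow> before xs x y \<Longrightarrow> before xs y z \<Longrightarrow> before xs x z"
  by (induction xs) (auto dest: before_in_set)

lemma before_asym: "distinct xs \<Longrightarrow> before xs x y \<Longrightarrow> \<not> before xs y x"
  using before_trans before_irrefl by metis

lemma before_total: "x \<in> set xs \<Longrightarrow> y \<in> set xs \<Longrightarrow> x \<noteq> y \<Longrightarrow> before xs x y \<or> before xs y x"
  by (induction xs) auto

lemma before_conv_nth:
  "before xs x y \<longleftrightarrow> (\<exists>i j. i < j \<and> j < length xs \<and> xs ! i = x \<and> xs ! j = y)"
proof (induction xs)
  case (Cons z zs)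
  show ?case
  proof
    assume "before (z # zs) x y"
    then consider "x = z" "y \<in> set zs" | "before zs x y" by auto
    then show "\<exists>i j. i < j \<and> j < length (z # zs) \<and> (z # zs) ! i = x \<and> (z # zs) ! j = y"
    proof cases
      case 1
      then obtain j where "j < length zs" "zs ! j = y" by (auto simp: in_set_conv_nth)
      with 1 show ?thesis by (intro exI[of _ 0] exI[of _ "Suc j"]) simp
    next
      case 2
      then obtain i j where "i < j" "j < length zs" "zs ! i = x" "zs ! j = y" using Cons by auto
      then show ?thesis by (intro exI[of _ "Suc i"] exI[of _ "Suc j"]) simp
    qed
  next
    assume "\<exists>i j. i < j \<and> j < length (z # zs) \<and> (z # zs) ! i = x \<and> (z # zs) ! j = y"
    then obtain i j where ij: "i < j" "j < length (z # zs)" "(z # zs) ! i = x" "(z # zs) ! j = y" by blast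
    obtain j' where j: "j = Suc j'" using ij(1) by (cases j) auto
    show "before (z # zs) x y"
    proof (cases i)
      case 0
      then show ?thesis using ij j by auto
    next
      case (Suc i')
      then have "before zs x y" unfolding Cons using ij j by (intro exI[of _ i'] exI[of _ j']) auto
      then show ?thesis by simp
    qed
  qed
qed simp

lemma before_split:
  assumes "before xs x y"
  obtains l m r where "xs = l @ x # m @ y # r"
  using assms
proof (induction xs arbitrary: thesis)
  case (Cons z zs)
  from Cons.prems(2) consider "x = z" "y \<in> set zs" | "before zs x y" by auto
  then show ?case
  proof cases
    case 1
    then obtain m r where "zs = m @ y # r" by (meson split_list)
    with 1 show ?thesis by (intro Cons.prems(1)[of "[]" m r]) simp
  next
    case 2
    then obtain l m r where "zs = l @ x # m @ y # r" using Cons.IH by blast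
    then show ?thesis by (intro Cons.prems(1)[of "z # l" m r]) simp
  qed
qed simp

text \<open>The head of \<open>xs\<close> can be moved to the front of \<open>ys\<close>, since no
  node preceding it there lies in a neighbouring column.\<close>

lemma comm_equiv_reorder:
  assumes "distinct xs" "distinct ys" "set ys = set xs"
    "\<And>x y. nbr (c x) (c y) \<Longrightarrow> before xs x y \<Longrightarrow> before ys x y"
  shows "map c xs \<sim>\<^sub>c map c ys"
  using assms
proof (induction xs arbitrary: ys)
  case (Cons x xs)
  have "x \<in> set ys" using Cons.prems(3) by simp
  then obtain p q where ys: "ys = p @ x # q" by (meson split_list)
  have p: "\<not> nbr k (c x)" if "k \<in> set (map c p)" for k
  proof
    from that obtain z where z: "z \<in> set p" "k = c z" by auto
    assume "nbr k (c x)"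
    moreover have zx: "z \<noteq> x" using z Cons.prems(2) by (auto simp: ys)
    moreover have "z \<in> set ys" using z by (simp add: ys)
    then have "z \<in> set xs" using zx Cons.prems(3) by (metis set_ConsD)
    ultimately have "before ys x z" using Cons.prems(4)[of x z] z by (auto simp: nbr_sym)
    moreover have "before ys z x" using z by (simp add: ys)
    ultimately show False using before_asym[OF Cons.prems(2)] by blast
  qed
  have "map c xs \<sim>\<^sub>c map c (p @ q)"
  proof (rule Cons.IH)
    have "set (p @ q) = set ys - {x}" using Cons.prems(2) by (auto simp: ys)
    moreover have "set xs = set (x # xs) - {x}" using Cons.prems(1) by auto
    ultimately show "set (p @ q) = set xs" using Cons.prems(3) by metis
    fix y z assume yz: "nbr (c y) (c z)" "before xs y z"
    then have "before ys y z" using Cons.prems(4) by simp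
    moreover have "y \<noteq> x" "z \<noteq> x" using before_in_set[OF yz(2)] Cons.prems(1) by auto
    ultimately show "before (p @ q) y z" by (auto simp: ys)
  qed (use Cons.prems in \<open>auto simp: ys\<close>)
  then have "[c x] @ map c xs @ [] \<sim>\<^sub>c [c x] @ map c (p @ q) @ []" by (rule comm_equiv_context)
  moreover have "map c p @ c x # map c q \<sim>\<^sub>c c x # map c p @ map c q"
    using p by (rule comm_equiv_move)
  then have "c x # map c p @ map c q \<sim>\<^sub>c map c p @ c x # map c q" by (rule comm_equiv_sym)
  ultimately show ?case unfolding ys by simp
qed simp

definition heap_links :: "('a \<Rightarrow> nat) \<Rightarrow> 'a list \<Rightarrow> ('a \<times> 'a) set" where
  "heap_links c xs = {(x, y). before xs x y \<and> nbr (c x) (c y)}"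

text \<open>Stronger than a linear extension of a poset: the order must be generated by the pairs in
  neighbouring columns, so that \<open>H\<close> is the heap of the word
  \<open>map (col H) xs\<close> on named nodes.\<close>

definition linear_extension :: "'a heap \<Rightarrow> 'a list \<Rightarrow> bool" where
  "linear_extension H xs \<longleftrightarrow>
     distinct xs \<and> set xs = nodes H \<and> prec H = (heap_links (col H) xs)\<^sup>+"

lemma prec_before:
  assumes "linear_extension H xs" "(x, y) \<in> prec H"
  shows "before xs x y"
proof -
  have "(x, y) \<in> (heap_links (col H) xs)\<^sup>+" and d: "distinct xs"
    using assms by (auto simp: linear_extension_def)
  then show ?thesis
    by (induction rule: trancl_induct) (auto simp: heap_links_def dest: before_trans[OF d])
qed

lemma before_prec:
  "linear_extension H xs \<Longrightarrow> before xs x y \<Longrightarrow> nbr (col H x) (col H y) \<Longrightarrow> (x, y) \<in> prec H"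
  by (auto simp: linear_extension_def heap_links_def)

lemma prec_trans: "linear_extension H xs \<Longrightarrow> (x, y) \<in> prec H \<Longrightarrow> (y, z) \<in> prec H \<Longrightarrow> (x, z) \<in> prec H"
  by (auto simp: linear_extension_def)

lemma linear_extension_reorder:
  assumes xs: "linear_extension H xs" and ys: "distinct ys" "set ys = set xs"
    and ord: "\<And>x y. nbr (col H x) (col H y) \<Longrightarrow> before xs x y \<Longrightarrow> before ys x y"
  shows "linear_extension H ys" "map (col H) xs \<sim>\<^sub>c map (col H) ys"
proof -
  have d: "distinct xs" using xs by (simp add: linear_extension_def)
  show "map (col H) xs \<sim>\<^sub>c map (col H) ys" using d ys ord by (rule comm_equiv_reorder)
  have "before xs x y" if "nbr (col H x) (col H y)" "before ys x y" for x y
  proof (rule ccontr)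
    assume "\<not> before xs x y"
    moreover have "x \<in> set xs" "y \<in> set xs" "x \<noteq> y"
      using before_in_set[OF that(2)] before_irrefl[OF ys(1)] that(2) ys(2) by auto
    ultimately have "before xs y x" using before_total by metis
    then have "before ys y x" using ord that(1) nbr_sym by blast
    then show False using before_asym[OF ys(1)] that(2) by blast
  qed
  then have "heap_links (col H) ys = heap_links (col H) xs"
    using ord by (auto simp: heap_links_def)
  then show "linear_extension H ys" using xs ys by (simp add: linear_extension_def)
qed

text \<open>Swapping two adjacent nodes of non-neighbouring columns changes no link, so a
  commutation of letters lifts to the nodes while the heap itself stays the same.\<close>

lemma linear_extension_comm_equiv:
  assumes "map (col H) xs \<sim>\<^sub>c v" "linear_extension H xs"
  shows "\<exists>ys. linear_extension H ys \<and> map (col H) ys = v"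
  using assms(1)
proof (induction rule: rtranclp_induct)
  case (step v v')
  then obtain ys where ys: "linear_extension H ys" "map (col H) ys = v" by blast
  from step.hyps(2) obtain p s t q where st: "cox_A s t = 2" "v = p @ [s, t] @ q" "v' = p @ [t, s] @ q"
    unfolding commutation_step_def by blast
  with ys(2) obtain p' y z q' where
    yz: "ys = p' @ [y, z] @ q'" "map (col H) p' = p" "col H y = s" "col H z = t" "map (col H) q' = q"
    by (auto simp: map_eq_append_conv Cons_eq_map_conv map_eq_Cons_conv)
  have "distinct ys" using ys by (simp add: linear_extension_def)
  have "linear_extension H (p' @ [z, y] @ q')"
    by (rule linear_extension_reorder[OF ys(1)])
      (use \<open>distinct ys\<close> st yz nbr_sym in \<open>auto simp: cox_A_eq_2_iff\<close>)
  then show ?case using yz st by (intro exI[of _ "p' @ [z, y] @ q'"]) simp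
qed (use assms in blast)

section \<open>Words and isomorphism classes of heaps\<close>

lemma word_heap_cox_C: "word_heap (cox_C n) u = word_heap cox_A u"
proof -
  have "cox_C n s t \<notin> {1, 2} \<longleftrightarrow> cox_A s t \<notin> {1, 2}" for s t
    by (simp add: cox_A_def cox_C_def)
  then show ?thesis by (simp add: word_heap_def)
qed

lemma prec_word_heap:
  "prec (word_heap cox_A u) = {(i, j). i < j \<and> j < length u \<and> nbr (u ! i) (u ! j)}\<^sup>+"
proof -
  have "cox_A s t \<notin> {1, 2} \<longleftrightarrow> nbr s t" for s t
    by (auto simp: cox_A_def)
  then show ?thesis by (simp add: word_heap_def)
qed

lemma trancl_map:
  assumes "(i, j) \<in> G\<^sup>+" "\<And>i j. (i, j) \<in> G \<Longrightarrow> (g i, g j) \<in> L"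
  shows "(g i, g j) \<in> L\<^sup>+"
  using assms(1) by (induction rule: trancl_induct) (auto intro: assms(2) trancl_into_trancl)

lemma linear_extension_if_iso:
  assumes iso: "H \<cong>\<^sub>h word_heap cox_A u" and sub: "prec H \<subseteq> nodes H \<times> nodes H"
  shows "\<exists>xs. linear_extension H xs \<and> map (col H) xs = u"
proof -
  let ?G = "{(i, j). i < j \<and> j < length u \<and> nbr (u ! i) (u ! j)}"
  from iso obtain f where f: "bij_betw f (nodes H) {..<length u}"
      "\<And>x y. x \<in> nodes H \<Longrightarrow> y \<in> nodes H \<Longrightarrow> (x, y) \<in> prec H \<longleftrightarrow> (f x, f y) \<in> ?G\<^sup>+"
      "\<And>x. x \<in> nodes H \<Longrightarrow> u ! f x = col H x"
    unfolding heap_iso_def prec_word_heap by (auto simp: word_heap_def)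
  define g where "g = inv_into (nodes H) f"
  define xs where "xs = map g [0..<length u]"
  have g: "bij_betw g {..<length u} (nodes H)" unfolding g_def using f(1) by (rule bij_betw_inv_into)
  have fg: "f (g i) = i" if "i < length u" for i
    unfolding g_def using f(1) that by (simp add: bij_betw_inv_into_right)
  have gf: "g (f x) = x" if "x \<in> nodes H" for x
    unfolding g_def using f(1) that by (simp add: bij_betw_inv_into_left)
  have gn: "g i \<in> nodes H" if "i < length u" for i using g that by (auto dest: bij_betwE)
  have cg: "col H (g i) = u ! i" if "i < length u" for i
    using f(3)[OF gn[OF that]] fg[OF that] by simp
  have set_xs: "set xs = nodes H" using g by (simp add: xs_def bij_betw_def lessThan_atLeast0)
  have d: "distinct xs"
    using g by (auto simp: xs_def distinct_map bij_betw_def lessThan_atLeast0)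
  have bef: "before xs x y \<longleftrightarrow> (\<exists>i j. i < j \<and> j < length u \<and> g i = x \<and> g j = y)" for x y
  proof -
    have "length xs = length u" "\<And>k. k < length u \<Longrightarrow> xs ! k = g k" by (simp_all add: xs_def)
    then show ?thesis unfolding before_conv_nth by (metis order.strict_trans)
  qed
  have G_L: "(g i, g j) \<in> heap_links (col H) xs" if "(i, j) \<in> ?G" for i j
    using that cg[of i] cg[of j] by (auto simp: heap_links_def bef)
  have L_G: "(f x, f y) \<in> ?G" if "(x, y) \<in> heap_links (col H) xs" for x y
  proof -
    from that obtain i j where "i < j" "j < length u" "g i = x" "g j = y" "nbr (col H x) (col H y)"
      by (auto simp: heap_links_def bef)
    then show ?thesis using fg[of i] fg[of j] cg[of i] cg[of j] by auto
  qed
  have "prec H = (heap_links (col H) xs)\<^sup>+"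
  proof (intro Set.set_eqI iffI; clarify)
    fix x y assume xy: "(x, y) \<in> prec H"
    then have n: "x \<in> nodes H" "y \<in> nodes H" using sub by auto
    then have "(f x, f y) \<in> ?G\<^sup>+" using f(2) xy by blast
    then have "(g (f x), g (f y)) \<in> (heap_links (col H) xs)\<^sup>+" using G_L by (rule trancl_map)
    then show "(x, y) \<in> (heap_links (col H) xs)\<^sup>+" using gf n by simp
  next
    fix x y assume xy: "(x, y) \<in> (heap_links (col H) xs)\<^sup>+"
    have "heap_links (col H) xs \<subseteq> nodes H \<times> nodes H"
      using set_xs by (auto simp: heap_links_def dest: before_in_set)
    then have "x \<in> nodes H" "y \<in> nodes H" using xy trancl_subset_Sigma by blast+
    moreover have "(f x, f y) \<in> ?G\<^sup>+" using xy L_G by (rule trancl_map)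
    ultimately show "(x, y) \<in> prec H" using f(2) by blast
  qed
  then have "linear_extension H xs" using d set_xs by (simp add: linear_extension_def)
  moreover have "map (col H) xs = u" by (rule nth_equalityI) (simp_all add: xs_def cg)
  ultimately show ?thesis by blast
qed

lemma iso_if_linear_extension:
  assumes xs: "linear_extension H xs"
  shows "H \<cong>\<^sub>h word_heap cox_A (map (col H) xs)"
proof -
  let ?G = "{(i, j). i < j \<and> j < length (map (col H) xs) \<and> nbr (map (col H) xs ! i) (map (col H) xs ! j)}"
  have d: "distinct xs" and n: "nodes H = set xs" and p: "prec H = (heap_links (col H) xs)\<^sup>+"
    using xs by (auto simp: linear_extension_def)
  define f where "f = inv_into {..<length xs} ((!) xs)"
  have b: "bij_betw ((!) xs) {..<length xs} (set xs)" using d by (intro bij_betw_nth) auto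
  then have f: "bij_betw f (set xs) {..<length xs}" unfolding f_def by (rule bij_betw_inv_into)
  have fx: "f (xs ! i) = i" if "i < length xs" for i
    unfolding f_def using b that by (simp add: bij_betw_inv_into_left)
  have xf: "xs ! f x = x" if "x \<in> set xs" for x
    unfolding f_def using b that by (simp add: bij_betw_inv_into_right)
  have flen: "f x < length xs" if "x \<in> set xs" for x using f that by (auto dest: bij_betwE)
  have G_L: "(xs ! i, xs ! j) \<in> heap_links (col H) xs" if "(i, j) \<in> ?G" for i j
    using that by (auto simp: heap_links_def before_conv_nth)
  have L_G: "(f x, f y) \<in> ?G" if "(x, y) \<in> heap_links (col H) xs" for x y
  proof -
    from that obtain i j where "i < j" "j < length xs" "xs ! i = x" "xs ! j = y" "nbr (col H x) (col H y)"
      by (auto simp: heap_links_def before_conv_nth)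
    then show ?thesis using fx[of i] fx[of j] by auto
  qed
  have "(x, y) \<in> prec H \<longleftrightarrow> (f x, f y) \<in> ?G\<^sup>+" if "x \<in> set xs" "y \<in> set xs" for x y
  proof
    assume "(x, y) \<in> prec H"
    then show "(f x, f y) \<in> ?G\<^sup>+" unfolding p using L_G by (rule trancl_map)
  next
    assume "(f x, f y) \<in> ?G\<^sup>+"
    then have "(xs ! f x, xs ! f y) \<in> (heap_links (col H) xs)\<^sup>+" using G_L by (rule trancl_map)
    then show "(x, y) \<in> prec H" using that by (simp add: p xf)
  qed
  then show ?thesis
    unfolding heap_iso_def prec_word_heap n
    using f xf flen by (intro exI[of _ f]) (auto simp: word_heap_def)
qed

lemma heap_iso_via:
  assumes "A \<cong>\<^sub>h W" "B \<cong>\<^sub>h W"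
  shows "A \<cong>\<^sub>h B"
proof -
  from assms(1) obtain f where f: "bij_betw f (nodes A) (nodes W)"
      "\<forall>x\<in>nodes A. \<forall>y\<in>nodes A. (x, y) \<in> prec A \<longleftrightarrow> (f x, f y) \<in> prec W"
      "\<forall>x\<in>nodes A. col W (f x) = col A x"
    unfolding heap_iso_def by blast
  from assms(2) obtain g where g: "bij_betw g (nodes B) (nodes W)"
      "\<forall>x\<in>nodes B. \<forall>y\<in>nodes B. (x, y) \<in> prec B \<longleftrightarrow> (g x, g y) \<in> prec W"
      "\<forall>x\<in>nodes B. col W (g x) = col B x"
    unfolding heap_iso_def by blast
  define h where "h = inv_into (nodes B) g \<circ> f"
  have h: "bij_betw h (nodes A) (nodes B)"
    unfolding h_def using f(1) bij_betw_inv_into[OF g(1)] by (rule bij_betw_trans)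
  have gh: "g (h x) = f x" if "x \<in> nodes A" for x
    using bij_betw_inv_into_right[OF g(1)] f(1) that by (auto simp: h_def dest: bij_betwE)
  have hB: "h x \<in> nodes B" if "x \<in> nodes A" for x using h that by (auto dest: bij_betwE)
  show ?thesis
    unfolding heap_iso_def
    using h f(2,3) g(2,3) gh hB by (intro exI[of _ h] conjI ballI) metis+
qed

lemma iso_if_comm_equiv:
  assumes "linear_extension A xs" "linear_extension B ys" "map (col A) xs \<sim>\<^sub>c map (col B) ys"
  shows "A \<cong>\<^sub>h B"
proof -
  obtain xs' where "linear_extension A xs'" "map (col A) xs' = map (col B) ys"
    using linear_extension_comm_equiv[OF assms(3,1)] by blast
  then show ?thesis using iso_if_linear_extension assms(2) heap_iso_via by metis
qed

section \<open>Fork elimination on linear extensions\<close>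

lemma nbr_trans_far: "nbr a x \<Longrightarrow> nbr x p \<Longrightarrow> p \<noteq> a \<Longrightarrow> \<not> nbr p a"
  by (auto simp: nbr_def)

text \<open>The invariant of all runs. On a linear extension it means that some neighbouring letter
  occurs between any two equal letters, so commutations can never bring equal letters
  together.\<close>

definition columns_chains :: "'a heap \<Rightarrow> bool" where
  "columns_chains H \<longleftrightarrow> (\<forall>y\<in>nodes H. \<forall>z\<in>nodes H.
     y \<noteq> z \<and> col H y = col H z \<longrightarrow> (y, z) \<in> prec H \<or> (z, y) \<in> prec H)"

lemma columns_chains_iff:
  assumes xs: "linear_extension H xs"
  shows "columns_chains H \<longleftrightarrow> (\<forall>y z. before xs y z \<and> col H y = col H z \<longrightarrow>
    (\<exists>w. before xs y w \<and> before xs w z \<and> nbr (col H y) (col H w)))"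
proof
  have d: "distinct xs" and n: "set xs = nodes H" and p: "prec H = (heap_links (col H) xs)\<^sup>+"
    using xs by (auto simp: linear_extension_def)
  {
    assume c: "columns_chains H"
    show "\<forall>y z. before xs y z \<and> col H y = col H z \<longrightarrow>
      (\<exists>w. before xs y w \<and> before xs w z \<and> nbr (col H y) (col H w))"
    proof (intro allI impI; elim conjE)
      fix y z assume yz: "before xs y z" "col H y = col H z"
      then have "y \<in> nodes H" "z \<in> nodes H" "y \<noteq> z"
        using before_in_set before_irrefl[OF d] n by fastforce+
      then have "(y, z) \<in> prec H \<or> (z, y) \<in> prec H" using c yz(2) by (auto simp: columns_chains_def)
      then have "(y, z) \<in> prec H" using prec_before[OF xs] before_asym[OF d] yz(1) by blast
      then obtain w where w: "(y, w) \<in> heap_links (col H) xs" "(w, z) \<in> (heap_links (col H) xs)\<^sup>*"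
        unfolding p by (meson tranclD)
      then have "w \<noteq> z" using yz(2) by (auto simp: heap_links_def)
      with w(2) have "(w, z) \<in> prec H" unfolding p by (auto simp: rtrancl_eq_or_trancl)
      then show "\<exists>w. before xs y w \<and> before xs w z \<and> nbr (col H y) (col H w)"
        using w(1) prec_before[OF xs] by (auto simp: heap_links_def)
    qed
  next
    assume c: "\<forall>y z. before xs y z \<and> col H y = col H z \<longrightarrow>
      (\<exists>w. before xs y w \<and> before xs w z \<and> nbr (col H y) (col H w))"
    have *: "(y, z) \<in> prec H" if yz: "before xs y z" "col H y = col H z" for y z
    proof -
      obtain w where "before xs y w" "before xs w z" "nbr (col H y) (col H w)" using c yz by blast
      then show ?thesis
        using before_prec[OF xs] prec_trans[OF xs] yz(2) nbr_sym by metis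
    qed
    show "columns_chains H"
      unfolding columns_chains_def n[symmetric] using * before_total by metis
  }
qed

text \<open>List first the nodes other than \<open>a\<close> that are not below \<open>a\<close>,
  then \<open>a\<close>, \<open>x\<close>, \<open>b\<close>, then the other nodes below
  \<open>a\<close>. A node of the last group that had to precede \<open>x\<close> or
  \<open>b\<close> would lie between it and \<open>a\<close>, against convexity.\<close>

lemma fork_linear_extension:
  assumes fork: "is_fork H a x b" and xs: "linear_extension H xs"
  shows "\<exists>l r. linear_extension H (l @ [a, x, b] @ r) \<and> map (col H) xs \<sim>\<^sub>c map (col H) (l @ [a, x, b] @ r)"
proof -
  have d: "distinct xs" and n: "set xs = nodes H" using xs by (auto simp: linear_extension_def)
  have ax: "(a, x) \<in> prec H" and xb: "(x, b) \<in> prec H"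
    and conv: "\<And>u v y. u \<in> {a, x, b} \<Longrightarrow> v \<in> {a, x, b} \<Longrightarrow> (u, y) \<in> prec H \<Longrightarrow> (y, v) \<in> prec H \<Longrightarrow>
      y \<in> nodes H \<Longrightarrow> y \<in> {a, x, b}" and sub: "{a, x, b} \<subseteq> nodes H"
    using fork by (auto simp: is_fork_def convex_in_def)
  have ab: "(a, b) \<in> prec H" using ax xb by (rule prec_trans[OF xs])
  have irr: "\<not> ((y, z) \<in> prec H \<and> (z, y) \<in> prec H)" "(y, y) \<notin> prec H" for y z
    using prec_before[OF xs] before_asym[OF d] before_irrefl[OF d] by blast+
  define U where "U = (\<lambda>y. (a, y) \<in> prec H)"
  define l where "l = filter (\<lambda>y. y \<noteq> a \<and> \<not> U y) xs"
  define r where "r = filter (\<lambda>y. U y \<and> y \<noteq> x \<and> y \<noteq> b) xs"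
  have ne: "a \<noteq> x" "a \<noteq> b" "x \<noteq> b" "U x" "U b" "\<not> U a"
    using ax xb ab irr by (auto simp: U_def)
  have dist: "distinct (l @ [a, x, b] @ r)" using d ne by (auto simp: l_def r_def)
  have set: "set (l @ [a, x, b] @ r) = set xs" using sub n by (auto simp: l_def r_def)
  have ord: "before (l @ [a, x, b] @ r) y z" if yz: "nbr (col H y) (col H z)" "before xs y z" for y z
  proof -
    have p: "(y, z) \<in> prec H" using before_prec[OF xs] yz by blast
    have s: "y \<in> set xs" "z \<in> set xs" "y \<noteq> z" using before_in_set[OF yz(2)] yz(1) by auto
    have Uz: "U z" if "y = a \<or> U y" using that p prec_trans[OF xs] by (auto simp: U_def)
    have up: "z \<noteq> x \<and> z \<noteq> b" if "U y" "y \<noteq> x" "y \<noteq> b"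
      using conv[of a z y] that p s n ne(6) by (auto simp: U_def)
    have x: "z \<noteq> x" if "y = b" using that xb p irr by blast
    consider "y \<noteq> a" "\<not> U y" | "y = a" | "y = x" | "y = b" | "U y" "y \<noteq> x" "y \<noteq> b" by blast
    then show ?thesis
    proof cases
      case 1 then show ?thesis using s yz(2) by (cases "z \<noteq> a \<and> \<not> U z") (auto simp: l_def r_def)
    next
      case 2 then show ?thesis using s Uz by (auto simp: r_def)
    next
      case 3 then show ?thesis using s Uz ne by (auto simp: r_def)
    next
      case 4 then show ?thesis using s Uz ne x by (auto simp: r_def)
    next
      case 5 then show ?thesis using s Uz up yz(2) by (auto simp: r_def)
    qed
  qed
  show ?thesis
    using linear_extension_reorder[OF xs dist set ord] by blast
qed

text \<open>\<open>fwd\<close> carries the surviving links over to the new list; \<open>bwd\<close>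
  lifts a link of the new list to the old one on the chosen representatives, where \<phi> is the
  identity.\<close>

lemma linear_extension_contract:
  assumes xs: "linear_extension H xs" and ys: "distinct ys" "set ys = \<phi> ` (set xs - {x})"
    and col: "\<And>y. y \<in> set xs \<Longrightarrow> col H (\<phi> y) = col H y"
    and fwd: "\<And>u v. before xs u v \<Longrightarrow> nbr (col H u) (col H v) \<Longrightarrow> u \<noteq> x \<Longrightarrow> v \<noteq> x \<Longrightarrow>
      before ys (\<phi> u) (\<phi> v)"
    and bwd: "\<And>u v. before ys u v \<Longrightarrow> nbr (col H u) (col H v) \<Longrightarrow>
      before xs u v \<and> \<phi> u = u \<and> \<phi> v = v \<and> u \<noteq> x \<and> v \<noteq> x"
  shows "linear_extension (contract H x \<phi>) ys"
proof -
  have "map_prod \<phi> \<phi> ` {(u, v) \<in> prec H. nbr (col H u) (col H v) \<and> u \<noteq> x \<and> v \<noteq> x} =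
      heap_links (col H) ys"
  proof (intro Set.set_eqI iffI)
    fix e assume "e \<in> map_prod \<phi> \<phi> ` {(u, v) \<in> prec H. nbr (col H u) (col H v) \<and> u \<noteq> x \<and> v \<noteq> x}"
    then obtain u v where e: "e = (\<phi> u, \<phi> v)" and uv: "(u, v) \<in> prec H" "nbr (col H u) (col H v)" "u \<noteq> x" "v \<noteq> x"
      by auto
    have "before xs u v" using prec_before[OF xs uv(1)] .
    then show "e \<in> heap_links (col H) ys"
      using fwd uv col before_in_set[of xs u v] by (auto simp: e heap_links_def)
  next
    fix e assume "e \<in> heap_links (col H) ys"
    then obtain u v where e: "e = (u, v)" "before ys u v" "nbr (col H u) (col H v)"
      by (auto simp: heap_links_def)
    note b = bwd[OF e(2,3)]
    then have "(u, v) \<in> prec H" using before_prec[OF xs] e(3) by blast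
    then show "e \<in> map_prod \<phi> \<phi> ` {(u, v) \<in> prec H. nbr (col H u) (col H v) \<and> u \<noteq> x \<and> v \<noteq> x}"
      using b e by (intro image_eqI[of _ _ "(u, v)"]) auto
  qed
  then show ?thesis
    using xs ys by (simp add: linear_extension_def contract_def)
qed

text \<open>Only pairs connected through \<open>x\<close> are at risk. In the column of the fork,
  the pairs involving \<open>a\<close> or \<open>b\<close> still provide another connection; in the
  column on the other side of \<open>x\<close>, the absence of an (F3) situation does.\<close>

lemma contract_without_F3:
  assumes xs: "linear_extension H (l @ [a, x, b] @ r)" and chains: "columns_chains H"
    and fork: "col H b = col H a" "nbr (col H a) (col H x)"
    and conn: "\<nexists>p q. disconnected_by H a x p q"
  shows "linear_extension (contract H x (id(b := a))) (l @ [a] @ r)"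
    and "columns_chains (contract H x (id(b := a)))"
proof -
  let ?xs = "l @ [a, x, b] @ r" and ?ys = "l @ [a] @ r" and ?H = "contract H x (id(b := a))"
  have d: "distinct ?xs" and n: "nodes H = set ?xs" using xs by (auto simp: linear_extension_def)
  show ys: "linear_extension ?H ?ys"
  proof (rule linear_extension_contract[OF xs])
    show "set ?ys = id(b := a) ` (set ?xs - {x})" using d by (auto simp: image_iff)
  next
    fix u v assume "before ?xs u v" "nbr (col H u) (col H v)" "u \<noteq> x" "v \<noteq> x"
    then show "before ?ys ((id(b := a)) u) ((id(b := a)) v)"
      using d fork by (auto dest: before_in_set)
  next
    fix u v assume "before ?ys u v" "nbr (col H u) (col H v)"
    then show "before ?xs u v \<and> (id(b := a)) u = u \<and> (id(b := a)) v = v \<and> u \<noteq> x \<and> v \<noteq> x"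
      using d by (auto dest: before_in_set)
  qed (use d fork in auto)
  have between: "\<exists>w. before ?xs y w \<and> before ?xs w z \<and> nbr (col H y) (col H w)"
    if "before ?xs y z" "col H y = col H z" for y z
    using chains that unfolding columns_chains_iff[OF xs] by blast
  have "\<exists>w. before ?ys y w \<and> before ?ys w z \<and> nbr (col H y) (col H w)"
    if yz: "before ?ys y z" "col H y = col H z" for y z
  proof -
    have new: "y \<notin> {x, b}" "z \<notin> {x, b}" "y \<in> set ?ys" "z \<in> set ?ys"
      using before_in_set[OF yz(1)] d by auto
    have yz': "before ?xs y z" using yz(1) by auto
    \<comment> \<open>A witness other than \<open>x\<close> survives; only \<open>b\<close> has to
      be replaced by its representative \<open>a\<close>.\<close>
    have keep: ?thesis if w: "before ?xs y w" "before ?xs w z" "nbr (col H y) (col H w)" "w \<noteq> x" for w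
    proof (cases "w = b")
      case True
      then have "y \<in> set l" "z \<in> set r" using w new fork d by (auto dest: before_in_set)
      then show ?thesis using w(3) True fork by (intro exI[of _ a]) auto
    next
      case False
      then show ?thesis using w new d by (intro exI[of _ w]) (auto dest: before_in_set)
    qed
    obtain w where w: "before ?xs y w" "before ?xs w z" "nbr (col H y) (col H w)"
      using between yz' yz(2) by blast
    show ?thesis
    proof (cases "w = x")
      case True
      have yl: "y \<in> set l \<or> y = a" and zr: "z \<in> set r"
        using w(1,2) new d by (auto simp: True dest: before_in_set)
      consider "y = a" | "y \<in> set l" "col H y = col H a" | "y \<in> set l" "col H y \<noteq> col H a"
        using yl by blast
      then show ?thesis
      proof cases
        \<comment> \<open>The twin \<open>b\<close> of \<open>a\<close> also precedes
          \<open>z\<close>, and a witness between \<open>b\<close> and \<open>z\<close> comes after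
          \<open>x\<close>.\<close>
        case 1
        then obtain w' where "before ?xs b w'" "before ?xs w' z" "nbr (col H b) (col H w')"
          using between[of b z] zr yz(2) fork by auto
        then show ?thesis using d 1 fork by (intro keep) (auto dest: before_in_set)
      next
        case 2
        then obtain w' where "before ?xs y w'" "before ?xs w' a" "nbr (col H y) (col H w')"
          using between[of y a] by auto
        then show ?thesis using d zr by (intro keep) (auto dest: before_in_set)
      next
        case 3
        have "(y, x) \<in> prec H" "(x, z) \<in> prec H"
          using before_prec[OF xs] w True yz(2) nbr_sym by metis+
        \<comment> \<open>As (F3) does not apply, there is some \<open>v\<close> between
          \<open>y\<close> and \<open>z\<close> either in a neighbouring column, other than
          \<open>x\<close>, or in their own column. In the second case a witness is found between
          \<open>y\<close> and \<open>v\<close> or between \<open>v\<close> and \<open>z\<close>,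
          whichever stays on one side of the fork.\<close>
        moreover have "\<not> disconnected_by H a x y z" using conn by blast
        ultimately obtain v where v: "(y, v) \<in> prec H" "(v, z) \<in> prec H"
            "col H v = col H y \<or> nbr (col H v) (col H y) \<and> v \<noteq> x"
          using 3 zr yz(2) w(3) True n nbr_sym unfolding disconnected_by_def by auto
        have v': "before ?xs y v" "before ?xs v z" using prec_before[OF xs] v by blast+
        show ?thesis
        proof (cases "nbr (col H v) (col H y) \<and> v \<noteq> x")
          case True
          then show ?thesis using keep[OF v'] nbr_sym[of "col H v"] by blast
        next
          case False
          then have c: "col H v = col H y" using v(3) by blast
          have "v \<notin> {a, x, b}" using c 3 fork w(3) True by (auto simp: \<open>w = x\<close>)
          then have "v \<in> set l \<or> v \<in> set r" using before_in_set[OF v'(1)] by auto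
          then show ?thesis
          proof
            assume "v \<in> set l"
            then obtain w' where "before ?xs y w'" "before ?xs w' v" "nbr (col H y) (col H w')"
              using between[OF v'(1) c[symmetric]] by blast
            moreover have "w' \<in> set l"
              using calculation(2) \<open>v \<in> set l\<close> d by (auto dest: before_in_set)
            ultimately show ?thesis using d zr by (intro keep[of w']) auto
          next
            assume "v \<in> set r"
            then obtain w' where "before ?xs v w'" "before ?xs w' z" "nbr (col H v) (col H w')"
              using between[OF v'(2)] c yz(2) by metis
            moreover have "w' \<in> set r"
              using calculation(1) \<open>v \<in> set r\<close> d by (auto dest: before_in_set)
            ultimately show ?thesis using d 3 c by (intro keep[of w']) auto
          qed
        qed
      qed
    qed (use keep w in blast)
  qed
  then show "columns_chains ?H"
    unfolding columns_chains_iff[OF ys] by (simp add: contract_def)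
qed

text \<open>Between \<open>p\<close> and \<open>q\<close> only \<open>x\<close> lies in a
  neighbouring column, so \<open>p\<close> can slide down to the fork and \<open>q\<close> up to
  it.\<close>

lemma disconnected_linear_extension:
  assumes xs: "linear_extension H (l @ [a, x, b] @ r)" and fork: "col H b = col H a"
    and dis: "disconnected_by H a x p q"
  shows "\<exists>l' r'. linear_extension H (l' @ [p, a, x, b, q] @ r') \<and>
    map (col H) (l @ [a, x, b] @ r) \<sim>\<^sub>c map (col H) (l' @ [p, a, x, b, q] @ r')"
proof -
  let ?xs = "l @ [a, x, b] @ r"
  have d: "distinct ?xs" and n: "nodes H = set ?xs" using xs by (auto simp: linear_extension_def)
  have pq: "col H p = col H q" "nbr (col H x) (col H p)" "col H p \<noteq> col H a"
    "(p, x) \<in> prec H" "(x, q) \<in> prec H"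
    "\<And>y. y \<in> nodes H \<Longrightarrow> (p, y) \<in> prec H \<Longrightarrow> (y, q) \<in> prec H \<Longrightarrow> nbr (col H y) (col H p) \<Longrightarrow> y = x"
    using dis by (auto simp: disconnected_by_def)
  have "before ?xs p x" "before ?xs x q" using prec_before[OF xs] pq by blast+
  then have "p \<in> set l" "q \<in> set r" using d pq fork by (auto dest: before_in_set)
  then obtain l1 l2 r1 r2 where lr: "l = l1 @ p # l2" "r = r1 @ q # r2" by (meson split_list)
  let ?ys = "(l1 @ l2) @ [p, a, x, b, q] @ (r1 @ r2)"
  have bet: False if "y \<in> set l2 \<or> y \<in> set r1" "nbr (col H p) (col H y)" for y
  proof -
    have "before ?xs p y" "before ?xs y q" "y \<in> nodes H" "y \<noteq> x" using that(1) lr d n by auto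
    then show False using pq(1,6) that(2) before_prec[OF xs] nbr_sym by metis
  qed
  have "distinct ?ys" "set ?ys = set ?xs" using d by (auto simp: lr)
  moreover have "before ?ys y z" if "nbr (col H y) (col H z)" "before ?xs y z" for y z
  proof -
    have "\<not> (y = p \<and> z \<in> set l2)" "\<not> (z = q \<and> y \<in> set r1)"
      using bet that(1) pq(1) nbr_sym by metis+
    then show ?thesis using that(2) by (auto simp: lr)
  qed
  ultimately show ?thesis using linear_extension_reorder[OF xs] by blast
qed

text \<open>The columns of \<open>a\<close> and \<open>p\<close> lie on different sides of that of
  \<open>x\<close>, hence are not neighbours, and the two identifications do not interfere.
  Connections lost with \<open>x\<close> concern these columns only; passing from \<open>a\<close>
  to \<open>b\<close> or from \<open>p\<close> to \<open>q\<close> yields a witness beyond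
  \<open>x\<close>.\<close>

lemma contract_with_F3:
  assumes xs: "linear_extension H (l @ [p, a, x, b, q] @ r)" and chains: "columns_chains H"
    and fork: "col H b = col H a" "nbr (col H a) (col H x)"
    and pq: "col H p = col H q" "nbr (col H x) (col H p)" "col H p \<noteq> col H a"
  shows "linear_extension (contract H x (id(b := a, q := p))) (l @ [p, a] @ r)"
    and "columns_chains (contract H x (id(b := a, q := p)))"
proof -
  let ?xs = "l @ [p, a, x, b, q] @ r" and ?ys = "l @ [p, a] @ r" and ?\<phi> = "id(b := a, q := p)"
  let ?H = "contract H x ?\<phi>"
  have d: "distinct ?xs" and n: "nodes H = set ?xs" using xs by (auto simp: linear_extension_def)
  have far: "\<not> nbr (col H p) (col H a)" "\<not> nbr (col H a) (col H p)"
    using nbr_trans_far[OF fork(2) pq(2,3)] nbr_sym by blast+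
  show ys: "linear_extension ?H ?ys"
  proof (rule linear_extension_contract[OF xs])
    show "set ?ys = ?\<phi> ` (set ?xs - {x})" using d by (auto simp: image_iff)
  next
    fix u v assume "before ?xs u v" "nbr (col H u) (col H v)" "u \<noteq> x" "v \<noteq> x"
    then show "before ?ys (?\<phi> u) (?\<phi> v)"
      using d fork pq far by (auto dest: before_in_set)
  next
    fix u v assume "before ?ys u v" "nbr (col H u) (col H v)"
    then show "before ?xs u v \<and> ?\<phi> u = u \<and> ?\<phi> v = v \<and> u \<noteq> x \<and> v \<noteq> x"
      using d by (auto dest: before_in_set)
  qed (use d fork pq in auto)
  have between: "\<exists>w. before ?xs y w \<and> before ?xs w z \<and> nbr (col H y) (col H w)"
    if "before ?xs y z" "col H y = col H z" for y z
    using chains that unfolding columns_chains_iff[OF xs] by blast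
  have "\<exists>w. before ?ys y w \<and> before ?ys w z \<and> nbr (col H y) (col H w)"
    if yz: "before ?ys y z" "col H y = col H z" for y z
  proof -
    have new: "y \<notin> {x, b, q}" "z \<notin> {x, b, q}" "y \<in> set ?ys" "z \<in> set ?ys"
      using before_in_set[OF yz(1)] d by auto
    have yz': "before ?xs y z" using yz(1) by auto
    have keep: ?thesis if w: "before ?xs y w" "before ?xs w z" "nbr (col H y) (col H w)" "w \<noteq> x" for w
    proof -
      consider "w = b" | "w = q" | "w \<notin> {b, q}" by blast
      then show ?thesis
      proof cases
        case 1
        then have "y \<in> set l" "z \<in> set r" using w new fork far d by (auto dest: before_in_set)
        then show ?thesis using w(3) 1 fork by (intro exI[of _ a]) auto
      next
        case 2
        then have "y \<in> set l" "z \<in> set r" using w new fork pq far d by (auto dest: before_in_set)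
        then show ?thesis using w(3) 2 pq by (intro exI[of _ p]) auto
      next
        case 3
        then show ?thesis using w new d by (intro exI[of _ w]) (auto dest: before_in_set)
      qed
    qed
    obtain w where w: "before ?xs y w" "before ?xs w z" "nbr (col H y) (col H w)"
      using between yz' yz(2) by blast
    show ?thesis
    proof (cases "w = x")
      case True
      have yl: "y \<in> set l \<or> y = p \<or> y = a" and zr: "z \<in> set r"
        using w(1,2) new d by (auto simp: True dest: before_in_set)
      have "col H y = col H a \<or> col H y = col H p"
        using w(3) fork pq by (auto simp: True nbr_def)
      with yl pq(3) consider "y = a" | "y = p" | "y \<in> set l" "col H y = col H a"
        | "y \<in> set l" "col H y = col H p" by fastforce
      then show ?thesis
      proof cases
        case 1
        then obtain w' where "before ?xs b w'" "before ?xs w' z" "nbr (col H b) (col H w')"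
          using between[of b z] zr yz(2) fork by auto
        then show ?thesis using d 1 fork by (intro keep) (auto dest: before_in_set)
      next
        case 2
        then obtain w' where "before ?xs q w'" "before ?xs w' z" "nbr (col H q) (col H w')"
          using between[of q z] zr yz(2) pq by auto
        then show ?thesis using d 2 pq by (intro keep) (auto dest: before_in_set)
      next
        case 3
        then have "before ?xs y a" by simp
        from between[OF this 3(2)]
        obtain w' where "before ?xs y w'" "before ?xs w' a" "nbr (col H y) (col H w')" by blast
        moreover have "w' \<in> set l \<or> w' = p"
          using calculation(2) d by (auto dest: before_in_set)
        ultimately show ?thesis using d zr by (intro keep[of w']) auto
      next
        case 4
        then have "before ?xs y p" by simp
        from between[OF this 4(2)]
        obtain w' where "before ?xs y w'" "before ?xs w' p" "nbr (col H y) (col H w')" by blast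
        moreover have "w' \<in> set l"
          using calculation(2) d by (auto dest: before_in_set)
        ultimately show ?thesis using d zr by (intro keep[of w']) auto
      qed
    qed (use keep w in blast)
  qed
  then show "columns_chains ?H"
    unfolding columns_chains_iff[OF ys] by (simp add: contract_def)
qed

text \<open>A block \<open>[c, c]\<close> contradicts \<open>columns_chains\<close>. A block
  \<open>[c, k, c]\<close> is a fork: its nodes are consecutive in a linear extension, which gives
  convexity.\<close>

lemma alternating_if_no_fork:
  assumes xs: "linear_extension H xs" and chains: "columns_chains H"
    and S: "map (col H) xs \<in> lists {1..M}" and nf: "\<nexists>a x b. is_fork H a x b"
  shows "alternating (map (col H) xs)"
proof (rule ccontr)
  assume "\<not> alternating (map (col H) xs)"
  then obtain p c q where
    "map (col H) xs \<sim>\<^sub>c p @ [c, c] @ q \<or> (\<exists>k. nbr c k \<and> map (col H) xs \<sim>\<^sub>c p @ [c, k, c] @ q)"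
    using not_alternating_comm_equiv S by blast
  then show False
  proof (elim disjE exE conjE)
    assume "map (col H) xs \<sim>\<^sub>c p @ [c, c] @ q"
    then obtain ys where ys: "linear_extension H ys" "map (col H) ys = p @ [c, c] @ q"
      using linear_extension_comm_equiv xs by blast
    from ys(2) obtain l y z r where yz: "ys = l @ [y, z] @ r" "col H y = c" "col H z = c"
      by (auto simp: map_eq_append_conv map_eq_Cons_conv)
    have d: "distinct ys" using ys by (simp add: linear_extension_def)
    have "before ys y z" using yz by simp
    then obtain w where "before ys y w" "before ys w z"
      using chains yz unfolding columns_chains_iff[OF ys(1)] by metis
    then show False using d by (auto simp: yz dest: before_in_set)
  next
    fix k assume k: "nbr c k" and "map (col H) xs \<sim>\<^sub>c p @ [c, k, c] @ q"
    then obtain ys where ys: "linear_extension H ys" "map (col H) ys = p @ [c, k, c] @ q"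
      using linear_extension_comm_equiv xs by blast
    from ys(2) obtain l a x b r where yz: "ys = l @ [a, x, b] @ r" "col H a = c" "col H x = k" "col H b = c"
      by (auto simp: map_eq_append_conv map_eq_Cons_conv)
    have d: "distinct ys" and n: "nodes H = set ys" using ys by (auto simp: linear_extension_def)
    have "y \<in> {a, x, b}" if "u \<in> {a, x, b}" "v \<in> {a, x, b}" "(u, y) \<in> prec H" "(y, v) \<in> prec H" for u v y
    proof -
      have "before ys u y" "before ys y v" using that prec_before[OF ys(1)] by blast+
      then show ?thesis using that(1,2) d by (auto simp: yz dest: before_in_set)
    qed
    moreover have "{a, x, b} \<subseteq> nodes H" by (auto simp: n yz)
    ultimately have "convex_in H {a, x, b}" unfolding convex_in_def by blast
    moreover have "(a, x) \<in> prec H" "(x, b) \<in> prec H"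
      using k yz nbr_sym by (auto intro!: before_prec[OF ys(1)])
    ultimately have "is_fork H a x b" using k yz by (simp add: is_fork_def)
    then show False using nf by blast
  qed
qed

section \<open>Runs of the reduction algorithm\<close>

lemma ex_reduction: "finite (nodes H) \<Longrightarrow> \<exists>R k. reduction H R k"
proof (induction "card (nodes H)" arbitrary: H rule: less_induct)
  case less
  show ?case
  proof (cases "\<exists>a x b. is_fork H a x b")
    case False
    then have "reduction H H 0" unfolding reduction_def by (blast intro: fork_elims.stop)
    then show ?thesis by blast
  next
    case True
    then obtain a x b where fork: "is_fork H a x b" by blast
    have "\<exists>\<phi> d. fork_elim H (contract H x \<phi>) d"
      using fork_elim.intros[OF fork] by blast
    then obtain \<phi> d where e: "fork_elim H (contract H x \<phi>) d" by blast
    have "x \<in> nodes H" using fork by (auto simp: is_fork_def convex_in_def)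
    \<comment> \<open>Deleting \<open>x\<close> lowers the number of nodes and identifications
      cannot raise it, so every run terminates.\<close>
    then have "card (nodes H - {x}) < card (nodes H)"
      using less.prems by (intro card_Diff1_less)
    then have "card (nodes (contract H x \<phi>)) < card (nodes H)"
      using card_image_le[of "nodes H - {x}" \<phi>] less.prems by (simp add: contract_def)
    moreover have "finite (nodes (contract H x \<phi>))" using less.prems by (simp add: contract_def)
    ultimately obtain R k where "reduction (contract H x \<phi>) R k"
      using less.hyps by blast
    then show ?thesis using e fork_elims.step unfolding reduction_def by blast
  qed
qed

text \<open>The letters of the block \<open>p a x b q\<close>. The inner fork reduces to
  \<open>i\<close>, which commutes with \<open>c\<close>; then the two \<open>c\<close> meet and
  close one loop. This is why an identification in (F3) stands for a factor \<delta>.\<close>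

lemma word_of_F3:
  assumes "matching N f" "p @ [c, i, k, i, c] @ q \<in> lists {1..<N}" "nbr i k" "nbr k c" "c \<noteq> i"
  shows "act_word (p @ [c, i, k, i, c] @ q) f = act_word (p @ [c, i] @ q) f"
    "loop_word (p @ [c, i, k, i, c] @ q) f = Suc (loop_word (p @ [c, i] @ q) f)"
proof -
  have S: "i \<in> {1..<N}" "k \<in> {1..<N}" "[c] @ q \<in> lists {1..<N}" "p @ [c, i, c] @ q \<in> lists {1..<N}"
    using assms(2) by auto
  note fork = act_word_fork[OF assms(3) S(1-3) assms(1), of "p @ [c]"]
  have "\<not> nbr i c" using assms(3-5) nbr_trans_far nbr_sym by blast
  then have "(p @ [c]) @ [i, c] @ q \<sim>\<^sub>c (p @ [c]) @ [c, i] @ q"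
    by (intro comm_equiv_context comm_equiv_swap)
  then have swap: "p @ [c, i, c] @ q \<sim>\<^sub>c p @ [c, c] @ i # q" by simp
  note rep = act_word_repetition[of p c "i # q" f]
  show "act_word (p @ [c, i, k, i, c] @ q) f = act_word (p @ [c, i] @ q) f"
    "loop_word (p @ [c, i, k, i, c] @ q) f = Suc (loop_word (p @ [c, i] @ q) f)"
    using fork rep act_word_comm_equiv[OF swap S(4) assms(1)]
    by (simp_all del: act_word_append loop_word_append act_word.simps loop_word.simps)
qed

lemma fork_elim_word:
  assumes elim: "fork_elim H H' d" and xs: "linear_extension H xs" and chains: "columns_chains H"
    and S: "map (col H) xs \<in> lists {1..<N}"
  shows "\<exists>ys. linear_extension H' ys \<and> columns_chains H' \<and> map (col H') ys \<in> lists {1..<N} \<and>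
    (\<forall>f. matching N f \<longrightarrow> act_word (map (col H) xs) f = act_word (map (col H') ys) f \<and>
      loop_word (map (col H) xs) f = d + loop_word (map (col H') ys) f)"
  using elim
proof cases
  case (without_F3 a x b)
  let ?c = "col H"
  have fork: "?c b = ?c a" "nbr (?c a) (?c x)" using without_F3(3) by (auto simp: is_fork_def)
  obtain l r where L: "linear_extension H (l @ [a, x, b] @ r)"
    and c: "map ?c xs \<sim>\<^sub>c map ?c (l @ [a, x, b] @ r)"
    using fork_linear_extension[OF without_F3(3) xs] by blast
  have "map ?c (l @ [a, x, b] @ r) \<in> lists {1..<N}"
    using S comm_equiv_set[OF c] by (metis in_lists_conv_set)
  then have in_S: "?c a \<in> {1..<N}" "?c x \<in> {1..<N}" "map ?c r \<in> lists {1..<N}" "map ?c (l @ [a] @ r) \<in> lists {1..<N}"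
    by auto
  have "col H' = ?c" using without_F3(1) by (simp add: contract_def)
  moreover have "act_word (map ?c xs) f = act_word (map ?c (l @ [a] @ r)) f \<and>
      loop_word (map ?c xs) f = loop_word (map ?c (l @ [a] @ r)) f" if "matching N f" for f
    using act_word_comm_equiv[OF c S that] act_word_fork[OF fork(2) in_S(1-3) that, of "map ?c l"] fork(1)
    by (simp del: act_word_append loop_word_append act_word.simps loop_word.simps)
  ultimately show ?thesis
    using contract_without_F3[OF L chains fork without_F3(4)] without_F3(1,2) in_S(4)
    by (intro exI[of _ "l @ [a] @ r"]) simp
next
  case (with_F3 a x b p q)
  let ?c = "col H"
  have fork: "?c b = ?c a" "nbr (?c a) (?c x)" using with_F3(3) by (auto simp: is_fork_def)
  have pq: "?c p = ?c q" "nbr (?c x) (?c p)" "?c p \<noteq> ?c a"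
    using with_F3(4) by (auto simp: disconnected_by_def)
  obtain l' r' where L': "linear_extension H (l' @ [a, x, b] @ r')"
    and c': "map ?c xs \<sim>\<^sub>c map ?c (l' @ [a, x, b] @ r')"
    using fork_linear_extension[OF with_F3(3) xs] by blast
  obtain l r where L: "linear_extension H (l @ [p, a, x, b, q] @ r)"
    and c: "map ?c (l' @ [a, x, b] @ r') \<sim>\<^sub>c map ?c (l @ [p, a, x, b, q] @ r)"
    using disconnected_linear_extension[OF L' fork(1) with_F3(4)] by blast
  have c: "map ?c xs \<sim>\<^sub>c map ?c (l @ [p, a, x, b, q] @ r)" using c' c by (rule rtranclp_trans)
  have "map ?c (l @ [p, a, x, b, q] @ r) \<in> lists {1..<N}"
    using S comm_equiv_set[OF c] by (metis in_lists_conv_set)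
  then have in_S: "map ?c l @ [?c p, ?c a, ?c x, ?c a, ?c p] @ map ?c r \<in> lists {1..<N}"
      "map ?c (l @ [p, a] @ r) \<in> lists {1..<N}"
    using fork pq by auto
  have "col H' = ?c" using with_F3(1) by (simp add: contract_def)
  moreover have "act_word (map ?c xs) f = act_word (map ?c (l @ [p, a] @ r)) f \<and>
      loop_word (map ?c xs) f = Suc (loop_word (map ?c (l @ [p, a] @ r)) f)" if "matching N f" for f
    using act_word_comm_equiv[OF c S that] word_of_F3[OF that in_S(1) fork(2) pq(2,3)] fork(1) pq(1)
    by (simp del: act_word_append loop_word_append act_word.simps loop_word.simps)
  ultimately show ?thesis
    using contract_with_F3[OF L chains fork pq] with_F3(1,2) in_S(2)
    by (intro exI[of _ "l @ [p, a] @ r"]) simp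
qed

lemma fork_elims_word:
  assumes "fork_elims H R k" "linear_extension H xs" "columns_chains H"
    "map (col H) xs \<in> lists {1..<N}"
  shows "\<exists>ys. linear_extension R ys \<and> columns_chains R \<and> map (col R) ys \<in> lists {1..<N} \<and>
    (\<forall>f. matching N f \<longrightarrow> act_word (map (col H) xs) f = act_word (map (col R) ys) f \<and>
      loop_word (map (col H) xs) f = k + loop_word (map (col R) ys) f)"
  using assms
proof (induction arbitrary: xs rule: fork_elims.induct)
  case (stop H)
  then show ?case by (intro exI[of _ xs]) simp
next
  case (step H H' d R k)
  from fork_elim_word[OF step.hyps(1) step.prems]
  obtain ys where ys: "linear_extension H' ys" "columns_chains H'" "map (col H') ys \<in> lists {1..<N}"
    and H': "\<And>f. matching N f \<Longrightarrow> act_word (map (col H) xs) f = act_word (map (col H') ys) f \<and>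
      loop_word (map (col H) xs) f = d + loop_word (map (col H') ys) f" by blast
  from step.IH[OF ys]
  obtain zs where zs: "linear_extension R zs" "columns_chains R" "map (col R) zs \<in> lists {1..<N}"
    and R: "\<And>f. matching N f \<Longrightarrow> act_word (map (col H') ys) f = act_word (map (col R) zs) f \<and>
      loop_word (map (col H') ys) f = k + loop_word (map (col R) zs) f" by blast
  show ?case
    using zs H' R by (intro exI[of _ zs]) simp
qed

text \<open>The invariant at the start of a run: without a neighbour between them, two equal letters
  could be commuted together and cancelled, contrary to reducedness.\<close>

lemma columns_chains_reduced:
  assumes xs: "linear_extension H xs" and red: "reduced_expression m S w (map (col H) xs)"
    and m: "\<And>s. s \<in> S \<Longrightarrow> m s s = 1" "commutation_step m = commutation_step cox_A"
  shows "columns_chains H"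
  unfolding columns_chains_iff[OF xs]
proof (intro allI impI; elim conjE)
  fix y z assume yz: "before xs y z" "col H y = col H z"
  obtain l v r where l: "xs = l @ y # v @ z # r" using yz(1) by (rule before_split)
  let ?c = "col H"
  have "\<exists>w\<in>set v. nbr (?c y) (?c w)"
  proof (rule ccontr)
    assume n: "\<not> (\<exists>w\<in>set v. nbr (?c y) (?c w))"
    have "map ?c v @ ?c y # [?c z] @ map ?c r \<sim>\<^sub>c ?c y # map ?c v @ [?c z] @ map ?c r"
      by (rule comm_equiv_move) (use n nbr_sym in auto)
    then have "map ?c l @ (?c y # map ?c v @ [?c z] @ map ?c r) @ [] \<sim>\<^sub>c
        map ?c l @ (map ?c v @ ?c y # [?c z] @ map ?c r) @ []"
      by (rule comm_equiv_context[OF comm_equiv_sym])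
    then have "(commutation_step m)\<^sup>*\<^sup>* (map ?c xs) ((map ?c l @ map ?c v) @ [?c y, ?c y] @ map ?c r)"
      using yz(2) m(2) by (simp add: l)
    then show False by (rule reduced_expression_no_repetition[OF m(1) red, rotated]) simp
  qed
  then show "\<exists>w. before xs y w \<and> before xs w z \<and> nbr (?c y) (?c w)"
    by (auto simp: l)
qed

section \<open>Uniqueness of exponent and diagram, and the theorem\<close>

lemma delta_power_eq_iff: "delta ^ a = delta ^ b \<longleftrightarrow> a = b"
proof
  have "degree (delta ^ k) = k" for k
    by (simp add: delta_def degree_power_eq)
  then show "delta ^ a = delta ^ b \<Longrightarrow> a = b" by metis
qed simp

lemma delta_power_basis_eq_iff:
  "(\<lambda>E. delta ^ a * basis D E) = (\<lambda>E. delta ^ b * basis D' E) \<longleftrightarrow> a = b \<and> D = D'"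
proof
  assume eq: "(\<lambda>E. delta ^ a * basis D E) = (\<lambda>E. delta ^ b * basis D' E)"
  have "delta \<noteq> 0" by (simp add: delta_def)
  have "delta ^ a = delta ^ b * basis D' D"
    using fun_cong[OF eq, of D] by (simp add: basis_def)
  then have "D = D'" using \<open>delta \<noteq> 0\<close> by (auto simp: basis_def split: if_splits)
  with \<open>delta ^ a = delta ^ b * basis D' D\<close> show "a = b \<and> D = D'"
    by (simp add: basis_def delta_power_eq_iff)
qed simp

theorem theorem4p8:
  fixes n :: nat and w :: "nat list set" and H :: "nat heap"
  assumes "n \<ge> 2"
    and "w \<in> FC_C n"
    and "H \<in> heap_class (cox_C n) {1..n+1} w"
  shows "(\<exists>R k. reduction H R k) \<and>
    (\<forall>R k R' k'. reduction H R k \<and> reduction H R' k' \<longrightarrow> R \<cong>\<^sub>h R' \<and> k = k') \<and>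
    (\<forall>R k. reduction H R k \<longrightarrow>
       R \<in> heap_class cox_A {1..n+1} (tau n w) \<and> k = alpha n w)"
proof -
  \<comment> \<open>The letter \<open>i\<close> acts on the nodes \<open>i\<close> and
    \<open>Suc i\<close>, so \<open>n + 1\<close> generators need \<open>n + 2\<close> nodes on each
    face, and the letters are the positive numbers below \<open>N\<close>.\<close>
  define N where "N = n + 2"
  define S where "S = {1..<N}"
  have S: "{1..n+1} = S" by (auto simp: S_def N_def)
  have w: "w \<in> FC (cox_C n) S" using assms(2) unfolding S .
  let ?V = "vertical N"
  from assms(3) obtain u where H: "prec H \<subseteq> nodes H \<times> nodes H" "H \<cong>\<^sub>h word_heap cox_A u"
    and u: "reduced_expression (cox_C n) S w u"
    unfolding heap_class_def S word_heap_cox_C by blast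
  obtain xs where xs: "linear_extension H xs" "map (col H) xs = u"
    using linear_extension_if_iso[OF H(2,1)] by blast
  have uS: "u \<in> lists {1..<N}" using u by (simp add: reduced_expression_iff S_def)
  have chains: "columns_chains H"
    using xs u by (intro columns_chains_reduced[of H xs "cox_C n" S w])
      (auto simp: cox_C_diag commutation_step_cox_C)
  \<comment> \<open>\<open>diag_C\<close> chooses its own reduced expression, possibly different
    from \<open>u\<close>; full commutativity of \<open>w\<close> makes the two commutation
    equivalent.\<close>
  have diag_C: "diag_C n w = (\<lambda>E. delta ^ loop_word u ?V * basis (diagram_of N (act_word u ?V)) E)"
  proof -
    define v where "v = (SOME v. reduced_expression (cox_C n) S w v)"
    have v: "reduced_expression (cox_C n) S w v" unfolding v_def using u by (rule someI)
    then have uv: "u \<sim>\<^sub>c v" using w u by (auto simp: FC_def commutation_step_cox_C)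
    have "v \<in> lists {1..<N}" using v by (simp add: reduced_expression_iff S_def)
    then show ?thesis
      using act_word_comm_equiv[OF uv uS matching_vertical] word_diagram_eq[of v N]
      by (simp only: diag_C_def S v_def[symmetric] N_def[symmetric])
  qed
  define D where "D = diagram_of N (act_word u ?V)"
  have diag_A: "diag_A n t = basis (diagram_of N (act_word v ?V))"
    if t: "t \<in> FC cox_A S" and v: "v \<in> lists S" "cox_class cox_A S v = t" "alternating v" for t v
  proof -
    define v' where "v' = (SOME v. reduced_expression cox_A S t v)"
    have rv: "reduced_expression cox_A S t v"
      using alternating_reduced_expression[of v N] v by (simp add: S_def)
    then have v': "reduced_expression cox_A S t v'" unfolding v'_def by (rule someI)
    then have vv': "v \<sim>\<^sub>c v'" using t rv by (auto simp: FC_def)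
    have "v' \<in> lists {1..<N}" using v' by (simp add: reduced_expression_iff S_def)
    moreover have vS: "v \<in> lists {1..<N}" using v by (simp add: S_def)
    ultimately have "word_diagram N v' = basis (diagram_of N (act_word v ?V))"
      using act_word_comm_equiv[OF vv' vS matching_vertical] word_diagram_eq[of v' N]
        loop_word_alternating[OF v(3) vS] by simp
    then show ?thesis by (simp only: diag_A_def S v'_def[symmetric] N_def[symmetric])
  qed
  \<comment> \<open>The final word is alternating and closes no loop itself, so the count of the run
    is the whole loop count of \<open>u\<close>, whatever forks were chosen.\<close>
  have run: "\<exists>ys. linear_extension R ys \<and> map (col R) ys \<in> lists S \<and> alternating (map (col R) ys) \<and>
      act_word (map (col R) ys) ?V = act_word u ?V \<and> k = loop_word u ?V"
    if "reduction H R k" for R k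
  proof -
    have R: "fork_elims H R k" "\<nexists>a x b. is_fork R a x b" using that by (auto simp: reduction_def)
    obtain ys where ys: "linear_extension R ys" "columns_chains R" "map (col R) ys \<in> lists {1..<N}"
      and f: "\<And>f. matching N f \<Longrightarrow> act_word u f = act_word (map (col R) ys) f \<and>
        loop_word u f = k + loop_word (map (col R) ys) f"
      using fork_elims_word[OF R(1) xs(1) chains] uS xs(2) by blast
    have "map (col R) ys \<in> lists {1..N}" using ys(3) by (auto simp: in_lists_conv_set)
    then have alt: "alternating (map (col R) ys)"
      using alternating_if_no_fork[OF ys(1,2) _ R(2)] by blast
    then show ?thesis
      using ys f[OF matching_vertical] loop_word_alternating[OF alt ys(3)]
      by (intro exI[of _ ys]) (simp add: S_def)
  qed
  have tau_alpha: "R \<in> heap_class cox_A S (tau n w) \<and> k = alpha n w" if red: "reduction H R k" for R k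
  proof -
    obtain ys where ys: "linear_extension R ys" "map (col R) ys \<in> lists S" "alternating (map (col R) ys)"
      and act: "act_word (map (col R) ys) ?V = act_word u ?V" and k: "k = loop_word u ?V"
      using run[OF red] by blast
    let ?v = "map (col R) ys"
    let ?t = "cox_class cox_A S ?v"
    have t: "?t \<in> FC cox_A S"
      using alternating_FC[OF ys(3), of N] ys(2) by (simp add: S_def)
    \<comment> \<open>For the uniqueness part, a competitor has an alternating reduced word. Equal
      exponents and equal diagrams make that word commutation equivalent to the final word of the
      run, hence the group elements agree.\<close>
    have "alpha_tau n w = (k, ?t)"
      unfolding alpha_tau_def S
    proof (rule the_equality; clarify)
      show "?t \<in> FC cox_A S \<and> diag_C n w = (\<lambda>E. delta ^ k * diag_A n ?t E)"
        using t diag_A[OF t ys(2) HOL.refl ys(3)] by (simp add: diag_C act k)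
      fix a t' assume t': "t' \<in> FC cox_A S" and eq: "diag_C n w = (\<lambda>E. delta ^ a * diag_A n t' E)"
      obtain v where v: "reduced_expression cox_A S t' v"
        using ex_reduced_expression t' unfolding FC_def by blast
      then have alt: "alternating v" using FC_A_alternating[of t' N v] t' by (simp add: S_def)
      have vS: "v \<in> lists S" "cox_class cox_A S v = t'" using v by (auto simp: reduced_expression_iff)
      have "k = a \<and> diagram_of N (act_word u ?V) = diagram_of N (act_word v ?V)"
        using eq unfolding diag_C diag_A[OF t' vS alt] k delta_power_basis_eq_iff .
      moreover have "matching N (act_word u ?V)" "matching N (act_word v ?V)"
        using matching_act_word[OF matching_vertical] uS vS(1) by (simp_all add: S_def)
      ultimately have "k = a" and "act_word u ?V = act_word v ?V"
        using diagram_of_inject by blast+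
      then have "?v \<sim>\<^sub>c v"
        using alternating_comm_equiv[OF ys(3) _ alt] ys(2) vS act by (simp add: S_def)
      then have "cox_cong cox_A S ?v v"
        using ys(2) by (intro cox_cong_commutation_steps) (simp_all add: cox_A_diag)
      then have "?t = t'" using ys(2) vS(2) cox_class_eq_iff by metis
      with \<open>k = a\<close> show "a = k \<and> t' = ?t" by simp
    qed
    moreover have "R \<in> heap_class cox_A S ?t"
      unfolding heap_class_def
    proof (intro CollectI conjI exI)
      have "prec R = (heap_links (col R) ys)\<^sup>+" "set ys = nodes R"
        using ys(1) by (auto simp: linear_extension_def)
      moreover have "heap_links (col R) ys \<subseteq> set ys \<times> set ys"
        by (auto simp: heap_links_def dest: before_in_set)
      ultimately show "prec R \<subseteq> nodes R \<times> nodes R" using trancl_subset_Sigma by metis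
      show "reduced_expression cox_A S ?t ?v"
        using alternating_reduced_expression[OF ys(3), of N] ys(2) by (simp add: S_def)
      show "R \<cong>\<^sub>h word_heap cox_A ?v" by (rule iso_if_linear_extension[OF ys(1)])
    qed
    ultimately show ?thesis by (simp add: tau_def alpha_def)
  qed
  have unique: "R \<cong>\<^sub>h R' \<and> k = k'" if red: "reduction H R k" "reduction H R' k'" for R k R' k'
  proof -
    obtain ys where ys: "linear_extension R ys" "map (col R) ys \<in> lists S" "alternating (map (col R) ys)"
      "act_word (map (col R) ys) ?V = act_word u ?V" "k = loop_word u ?V"
      using run[OF red(1)] by blast
    obtain zs where zs: "linear_extension R' zs" "map (col R') zs \<in> lists S" "alternating (map (col R') zs)"
      "act_word (map (col R') zs) ?V = act_word u ?V" "k' = loop_word u ?V"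
      using run[OF red(2)] by blast
    have "map (col R) ys \<sim>\<^sub>c map (col R') zs"
      using alternating_comm_equiv[of _ N] ys(2-4) zs(2-4) by (simp add: S_def)
    then show ?thesis using iso_if_comm_equiv ys(1,5) zs(1,5) by blast
  qed
  have "finite (nodes H)"
    using xs(1) unfolding linear_extension_def by (metis List.finite_set)
  then have "\<exists>R k. reduction H R k" by (rule ex_reduction)
  with unique tau_alpha show ?thesis unfolding S by blast
qed

end
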